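(* Assume (A1) and (A2), let $\alpha \ge \frac12\max\{0,\operatorname{ess\,sup}_{\Omega}(V+\omega)\}+\frac12$, and if $d\ge3$ assume additionally $1<p\le d/(d-2)$. Let $u^0\in H^1(\Omega)\cap\mathcal S_{p+1}$. Then for every fixed $\tau>0$: (i) the GFALM sequence $\{u^n\}_{n\ge0}$ has a subsequence $\{u^{n_j}\}$ converging strongly in $H^1(\Omega)$; (ii) every accumulation point $u^\star\in\mathcal S_{p+1}$ of $\{u^n\}$ in $H^1(\Omega)$ satisfies the Euler–Lagrange equation in weak form $$\langle\mathcal Au^\star,v\rangle=\widetilde\lambda(u^\star)\langle|u^\star|^{p-1}u^\star,v\rangle\quad\forall v\in H^1(\Omega),$$ i.e. $\int_\Omega[\frac12\nabla u^\star\cdot\nabla\bar v+(V+\omega)u^\star\bar v-\widetilde\lambda(u^\star)|u^\star|^{p-1}u^\star\bar v]\,d\mathbf x=0$, and all accumulation points have the same multiplier and energy: $\widetilde\lambda(u^\star)=Q(u^\star)=\inf_{n\ge0}Q(u^n)$.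
   Context: Setting (semi-discrete). $\Omega\subset\mathbb R^d$ is a bounded box with homogeneous Dirichlet or periodic boundary conditions; $X=H^1(\Omega)$ with these boundary conditions incorporated; $\langle\cdot,\cdot\rangle$ is the $L^2(\Omega)$ inner product. Assumption (A1): $1<p<\frac{d+2}{d-2}$ if $d\ge3$ and $1<p<\infty$ if $d=1,2$; $V\in L^\infty(\Omega)$ and $V\ge0$. Let $\lambda_0:=\inf\{\frac12\|\nabla u\|_{L^2}^2+\int_\Omega V|u|^2\,d\mathbf x:\ u\in X,\ \|u\|_{L^2}=1\}$. Assumption (A2): $\omega>-\lambda_0$. Define $Q(u):=\frac12\|\nabla u\|_{L^2}^2+\int_\Omega V|u|^2\,d\mathbf x+\omega\|u\|_{L^2}^2$, $\mathcal A:=-\frac12\Delta+V+\omega$, $\mathcal S_{p+1}:=\{u\in X:\|u\|_{L^{p+1}}=1\}$, and $\widetilde\lambda(u):=Q(u)/\|u\|_{L^{p+1}}^{p+1}$. GFALM scheme with time step $\tau>0$ and parameter $\alpha\ge0$: given $u^n$, let $\widetilde u^{n+1}\in X$ solve (with the same boundary conditions) $\frac1\tau(\widetilde u^{n+1}-u^n)=-\widetilde\mu^{n+1}$, where $\widetilde\mu^{n+1}=(-\frac12\Delta+\alpha)\widetilde u^{n+1}+(V+\omega-\widetilde\lambda(u^n)|u^n|^{p-1}-\alpha)u^n$, and then set $u^{n+1}=\widetilde u^{n+1}/\|\widetilde u^{n+1}\|_{L^{p+1}}$. *)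

theory Defs
  imports "HOL-Analysis.Analysis" "HOL-Probability.Essential_Supremum"
begin

text \<open>Box domain Omega = box a b (open box; its boundary is a null set).
Functions are complex valued; integrals are Lebesgue integrals over Omega.\<close>

definition L2ip :: "'a::euclidean_space set \<Rightarrow> ('a \<Rightarrow> complex) \<Rightarrow> ('a \<Rightarrow> complex) \<Rightarrow> complex" where
  "L2ip \<Omega> f g = (LINT x|lebesgue_on \<Omega>. f x * cnj (g x))"

definition Lpnorm :: "'a::euclidean_space set \<Rightarrow> real \<Rightarrow> ('a \<Rightarrow> complex) \<Rightarrow> real" where
  "Lpnorm \<Omega> q f = (LINT x|lebesgue_on \<Omega>. norm (f x) powr q) powr (1 / q)"

definition in_L2 :: "'a::euclidean_space set \<Rightarrow> ('a \<Rightarrow> complex) \<Rightarrow> bool" where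
  "in_L2 \<Omega> f \<longleftrightarrow> f \<in> borel_measurable (lebesgue_on \<Omega>) \<and>
     integrable (lebesgue_on \<Omega>) (\<lambda>x. (norm (f x))\<^sup>2)"

definition pderiv_dir :: "('a::euclidean_space \<Rightarrow> complex) \<Rightarrow> 'a \<Rightarrow> 'a \<Rightarrow> complex" where
  "pderiv_dir \<phi> b x = frechet_derivative \<phi> (at x) b"

definition C1_fun :: "('a::euclidean_space \<Rightarrow> complex) \<Rightarrow> bool" where
  "C1_fun \<phi> \<longleftrightarrow> (\<forall>x. \<phi> differentiable (at x)) \<and>
     (\<forall>b\<in>Basis. continuous_on UNIV (pderiv_dir \<phi> b))"

definition test_fns :: "'a::euclidean_space set \<Rightarrow> ('a \<Rightarrow> complex) set" where
  "test_fns \<Omega> = {\<phi>. C1_fun \<phi> \<and> compact (closure {x. \<phi> x \<noteq> 0}) \<and> closure {x. \<phi> x \<noteq> 0} \<subseteq> \<Omega>}"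

definition has_weak_deriv :: "'a::euclidean_space set \<Rightarrow> ('a \<Rightarrow> complex) \<Rightarrow> 'a \<Rightarrow> ('a \<Rightarrow> complex) \<Rightarrow> bool" where
  "has_weak_deriv \<Omega> u b g \<longleftrightarrow> integrable (lebesgue_on \<Omega>) g \<and>
     (\<forall>\<phi>\<in>test_fns \<Omega>. (LINT x|lebesgue_on \<Omega>. u x * pderiv_dir \<phi> b x)
                       = - (LINT x|lebesgue_on \<Omega>. g x * \<phi> x))"

definition wgrad :: "'a::euclidean_space set \<Rightarrow> ('a \<Rightarrow> complex) \<Rightarrow> 'a \<Rightarrow> ('a \<Rightarrow> complex)" where
  "wgrad \<Omega> u b = (SOME g. has_weak_deriv \<Omega> u b g)"

definition H1 :: "'a::euclidean_space set \<Rightarrow> ('a \<Rightarrow> complex) set" where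
  "H1 \<Omega> = {u. in_L2 \<Omega> u \<and>
     (\<forall>b\<in>Basis. \<exists>g. has_weak_deriv \<Omega> u b g \<and> in_L2 \<Omega> g)}"

definition grad_ip :: "'a::euclidean_space set \<Rightarrow> ('a \<Rightarrow> complex) \<Rightarrow> ('a \<Rightarrow> complex) \<Rightarrow> complex" where
  "grad_ip \<Omega> u v = (\<Sum>b\<in>Basis. L2ip \<Omega> (wgrad \<Omega> u b) (wgrad \<Omega> v b))"

definition grad_norm2 :: "'a::euclidean_space set \<Rightarrow> ('a \<Rightarrow> complex) \<Rightarrow> real" where
  "grad_norm2 \<Omega> u = (\<Sum>b\<in>Basis. LINT x|lebesgue_on \<Omega>. (norm (wgrad \<Omega> u b x))\<^sup>2)"

definition L2norm2 :: "'a::euclidean_space set \<Rightarrow> ('a \<Rightarrow> complex) \<Rightarrow> real" where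
  "L2norm2 \<Omega> u = (LINT x|lebesgue_on \<Omega>. (norm (u x))\<^sup>2)"

definition H1dist :: "'a::euclidean_space set \<Rightarrow> ('a \<Rightarrow> complex) \<Rightarrow> ('a \<Rightarrow> complex) \<Rightarrow> real" where
  "H1dist \<Omega> u w = sqrt (L2norm2 \<Omega> (\<lambda>x. u x - w x) + grad_norm2 \<Omega> (\<lambda>x. u x - w x))"

datatype bcond = Dirichlet | Periodic

definition periodic_C1 :: "'a::euclidean_space \<Rightarrow> 'a \<Rightarrow> ('a \<Rightarrow> complex) set" where
  "periodic_C1 a b = {\<psi>. C1_fun \<psi> \<and>
     (\<forall>i\<in>Basis. \<forall>x. \<psi> (x + ((b - a) \<bullet> i) *\<^sub>R i) = \<psi> x)}"

text \<open>The space X: H^1_0(Omega) (closure of C_c^1(Omega) in H^1) for Dirichlet conditions,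
  H^1_per(Omega) (closure of restrictions of smooth periodic functions in H^1) for periodic ones.\<close>
definition Xsp :: "bcond \<Rightarrow> 'a::euclidean_space \<Rightarrow> 'a \<Rightarrow> ('a \<Rightarrow> complex) set" where
  "Xsp bc a b = {u \<in> H1 (box a b). \<exists>\<phi>::nat \<Rightarrow> 'a \<Rightarrow> complex.
       (\<forall>k. \<phi> k \<in> (case bc of Dirichlet \<Rightarrow> test_fns (box a b) | Periodic \<Rightarrow> periodic_C1 a b)) \<and>
       (\<lambda>k. H1dist (box a b) u (\<phi> k)) \<longlonglongrightarrow> 0}"

definition Qf :: "'a::euclidean_space set \<Rightarrow> ('a \<Rightarrow> real) \<Rightarrow> real \<Rightarrow> ('a \<Rightarrow> complex) \<Rightarrow> real" where
  "Qf \<Omega> V \<omega> u = grad_norm2 \<Omega> u / 2 + (LINT x|lebesgue_on \<Omega>. V x * (norm (u x))\<^sup>2)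
                 + \<omega> * L2norm2 \<Omega> u"

definition lam_tilde :: "'a::euclidean_space set \<Rightarrow> ('a \<Rightarrow> real) \<Rightarrow> real \<Rightarrow> real \<Rightarrow> ('a \<Rightarrow> complex) \<Rightarrow> real" where
  "lam_tilde \<Omega> V \<omega> p u = Qf \<Omega> V \<omega> u / (Lpnorm \<Omega> (p + 1) u) powr (p + 1)"

definition A_form :: "'a::euclidean_space set \<Rightarrow> ('a \<Rightarrow> real) \<Rightarrow> real \<Rightarrow> ('a \<Rightarrow> complex) \<Rightarrow> ('a \<Rightarrow> complex) \<Rightarrow> complex" where
  "A_form \<Omega> V \<omega> u v = grad_ip \<Omega> u v / 2 + L2ip \<Omega> (\<lambda>x. complex_of_real (V x + \<omega>) * u x) v"

definition lambda0 :: "bcond \<Rightarrow> 'a::euclidean_space \<Rightarrow> 'a \<Rightarrow> ('a \<Rightarrow> real) \<Rightarrow> real" where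
  "lambda0 bc a b V = Inf {grad_norm2 (box a b) u / 2 + (LINT x|lebesgue_on (box a b). V x * (norm (u x))\<^sup>2)
      | u. u \<in> Xsp bc a b \<and> L2norm2 (box a b) u = 1}"

definition gfalm_step :: "bcond \<Rightarrow> 'a::euclidean_space \<Rightarrow> 'a \<Rightarrow> ('a \<Rightarrow> real) \<Rightarrow> real \<Rightarrow> real \<Rightarrow> real \<Rightarrow> real
    \<Rightarrow> ('a \<Rightarrow> complex) \<Rightarrow> ('a \<Rightarrow> complex) \<Rightarrow> bool" where
  "gfalm_step bc a b V \<omega> p \<tau> \<alpha> uold unew \<longleftrightarrow>
     (\<exists>ut \<in> Xsp bc a b.
        (\<forall>v \<in> Xsp bc a b.
           L2ip (box a b) (\<lambda>x. ut x - uold x) v / complex_of_real \<tau>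
           = - (grad_ip (box a b) ut v / 2 + complex_of_real \<alpha> * L2ip (box a b) ut v
                + L2ip (box a b)
                   (\<lambda>x. complex_of_real (V x + \<omega> - lam_tilde (box a b) V \<omega> p uold * norm (uold x) powr (p - 1) - \<alpha>)
                        * uold x) v))
        \<and> unew = (\<lambda>x. ut x / complex_of_real (Lpnorm (box a b) (p + 1) ut)))"

end

theory Submission
  imports Defs "HOL-Library.Diagonal_Subsequence"
begin

text \<open>The energy identity behind the scheme is \<open>Q ut + \<parallel>ut - u\<parallel>\<^sup>2 / 2 \<le> Q u * N\<^sup>2\<close>, where \<open>ut\<close> is the
  unnormalised iterate and \<open>N\<close> its \<open>L\<^bsup>p+1\<^esup>\<close> norm. So the energies decrease and the increments tend to
  zero in \<open>H\<^sup>1\<close>. A subsequence converges in \<open>L\<^bsup>p+1\<^esup>\<close> by compactness, then in \<open>H\<^sup>1\<close> because the quadratic form \<open>Q\<close>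
  is coercive and the iterates solve the limit equation up to a vanishing error; the same error estimate
  identifies the limits.

  Under both boundary conditions the space is the closure of functions that are \<open>C\<^sup>1\<close> on the whole space, so
  the Sobolev and Rellich theorems are only needed for \<open>C\<^sup>1\<close> functions on the closed box, and the boundary
  conditions play no role. There the averages \<open>S_h f x = avg_z f ((1 - h) x + h z)\<close> do everything: they are
  bounded and Lipschitz in terms of the \<open>H\<^sup>1\<close> norm of \<open>f\<close>, and \<open>f - S_h f\<close> is small in every subcritical \<open>L\<^bsup>q\<^esup>\<close>.\<close>

section \<open>Sobolev and Rellich estimates for $C^1$ functions on a box\<close>

text \<open>The lower bound on \<alpha> enters at one point. Testing a step with its own increment
  \<open>e\<close> and expanding \<open>Q\<close> around the old iterate leaves the quadratic
  remainder \<open>2 * Re (K e e) - Q e\<close>. Since V + \<omega> \<le> 2 \<alpha> - 1 almost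
  everywhere, this remainder dominates half the squared H1 norm of \<open>e\<close>, whatever \<tau>
  > 0 is. The bound on \<omega> makes \<open>Q\<close> coercive, and the constraint in the L^(p+1)
  norm together with the Sobolev inequality makes \<open>Q\<close> positive along the iteration.

  The error estimate for the averages meets the critical exponent as follows. The averaged gradient
  is bounded pointwise by the L2 norm of the gradient, but with a negative power of the contraction
  parameter. To integrate its q-th power, q - 2 factors are estimated pointwise and two are
  integrated; the accumulated singularity can be absorbed when q (d - 2) < 2 d.

  Functions are not identified when they agree almost everywhere, and \<open>wgrad\<close> is a
  choice among weak derivatives. Uniqueness of weak derivatives therefore precedes every linear
  identity for gradients.\<close>

definition gradsum :: "('a::euclidean_space \<Rightarrow> complex) \<Rightarrow> 'a \<Rightarrow> real" where
  "gradsum \<phi> x = (\<Sum>b\<in>Basis. norm (pderiv_dir \<phi> b x))"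

lemma gradsum_nonneg [simp]: "0 \<le> gradsum \<phi> x"
  by (simp add: gradsum_def sum_nonneg)

lemma C1_fun_continuous: "C1_fun \<phi> \<Longrightarrow> continuous_on S \<phi>"
  unfolding C1_fun_def
  by (meson UNIV_I continuous_on_subset differentiable_imp_continuous_on differentiable_on_def
      differentiable_at_withinI subset_UNIV)

lemma continuous_gradsum: "C1_fun \<phi> \<Longrightarrow> continuous_on S (gradsum \<phi>)"
  unfolding gradsum_def [abs_def] C1_fun_def
  by (intro continuous_intros) (meson continuous_on_subset subset_UNIV)

lemma C1_fun_has_derivative:
  "C1_fun \<phi> \<Longrightarrow> (\<phi> has_derivative frechet_derivative \<phi> (at x)) (at x)"
  unfolding C1_fun_def using frechet_derivative_works by blast

lemma norm_frechet_derivative_le_gradsum: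
  fixes \<phi> :: "'a::euclidean_space \<Rightarrow> complex"
  assumes "C1_fun \<phi>"
  shows "norm (frechet_derivative \<phi> (at x) v) \<le> norm v * gradsum \<phi> x"
proof -
  interpret linear "frechet_derivative \<phi> (at x)"
    using C1_fun_has_derivative[OF assms] has_derivative_linear by blast
  have "frechet_derivative \<phi> (at x) v = frechet_derivative \<phi> (at x) (\<Sum>b\<in>Basis. (v \<bullet> b) *\<^sub>R b)"
    by (simp add: euclidean_representation)
  also have "\<dots> = (\<Sum>b\<in>Basis. (v \<bullet> b) *\<^sub>R pderiv_dir \<phi> b x)"
    by (simp add: sum scale pderiv_dir_def)
  also have "norm \<dots> \<le> (\<Sum>b\<in>Basis. norm v * norm (pderiv_dir \<phi> b x))"
    by (intro sum_norm_le) (simp add: Basis_le_norm mult_right_mono)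
  finally show ?thesis
    by (simp add: gradsum_def sum_distrib_left)
qed

lemma continuous_pderiv_dir: "C1_fun \<phi> \<Longrightarrow> b \<in> Basis \<Longrightarrow> continuous_on S (pderiv_dir \<phi> b)"
  unfolding C1_fun_def by (meson continuous_on_subset subset_UNIV)

text \<open>Expanding the direction in the basis reduces joint continuity in base point and
  direction to continuity of the partial derivatives.\<close>

lemma continuous_frechet_derivative_path:
  fixes \<phi> :: "'a::euclidean_space \<Rightarrow> complex"
  assumes "C1_fun \<phi>" "continuous_on S g" "continuous_on S w"
  shows "continuous_on S (\<lambda>t. frechet_derivative \<phi> (at (g t)) (w t))"
proof -
  have "frechet_derivative \<phi> (at y) v = (\<Sum>b\<in>Basis. (v \<bullet> b) *\<^sub>R pderiv_dir \<phi> b y)" for y v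
  proof -
    interpret linear "frechet_derivative \<phi> (at y)"
      using C1_fun_has_derivative[OF assms(1)] has_derivative_linear by blast
    have "frechet_derivative \<phi> (at y) v = frechet_derivative \<phi> (at y) (\<Sum>b\<in>Basis. (v \<bullet> b) *\<^sub>R b)"
      by (simp add: euclidean_representation)
    then show ?thesis
      by (simp add: sum scale pderiv_dir_def)
  qed
  moreover have "continuous_on S (\<lambda>t. pderiv_dir \<phi> b (g t))" if "b \<in> Basis" for b
    by (rule continuous_on_compose2[OF continuous_pderiv_dir[OF assms(1) that, of UNIV] assms(2)]) auto
  ultimately show ?thesis
    by (auto intro!: continuous_intros assms)
qed

text \<open>Mean value inequality in integral form: chain rule and fundamental theorem along
  \<open>g\<close>, with the speed replaced by its bound \<open>k\<close>. It serves three kinds of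
  paths: contraction towards a point, a contraction whose centre moves along a segment, and
  translation in a basis direction.\<close>

lemma C1_fun_path_bound:
  fixes \<phi> :: "'a::euclidean_space \<Rightarrow> complex"
  assumes \<phi>: "C1_fun \<phi>" and h: "0 \<le> h"
    and g: "\<And>s. s \<in> cbox 0 h \<Longrightarrow> (g has_vector_derivative g' s) (at s within cbox 0 h)"
    and le: "\<And>s. s \<in> cbox 0 h \<Longrightarrow> norm (g' s) \<le> k s"
    and g'c: "continuous_on (cbox 0 h) g'" and kc: "continuous_on (cbox 0 h) k"
  shows "norm (\<phi> (g h) - \<phi> (g 0)) \<le> integral (cbox 0 h) (\<lambda>s. k s * gradsum \<phi> (g s))"
proof -
  have gc: "continuous_on (cbox 0 h) g"
    using g has_vector_derivative_continuous continuous_on_eq_continuous_within by blast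
  have "((\<phi> \<circ> g) has_vector_derivative frechet_derivative \<phi> (at (g s)) (g' s)) (at s within cbox 0 h)"
    if "s \<in> cbox 0 h" for s
    by (rule vector_derivative_diff_chain_within[OF g[OF that]
          has_derivative_at_withinI[OF C1_fun_has_derivative[OF \<phi>]]])
  then have "((\<lambda>s. frechet_derivative \<phi> (at (g s)) (g' s)) has_integral (\<phi> \<circ> g) h - (\<phi> \<circ> g) 0) {0..h}"
    using h by (intro fundamental_theorem_of_calculus) (simp_all only: box_real)
  then have "\<phi> (g h) - \<phi> (g 0) = integral (cbox 0 h) (\<lambda>s. frechet_derivative \<phi> (at (g s)) (g' s))"
    by (simp add: integral_unique)
  also have "norm \<dots> \<le> integral (cbox 0 h) (\<lambda>s. k s * gradsum \<phi> (g s))"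
  proof (rule integral_norm_bound_integral)
    show "(\<lambda>s. frechet_derivative \<phi> (at (g s)) (g' s)) integrable_on cbox 0 h"
      by (intro integrable_continuous continuous_frechet_derivative_path \<phi> gc g'c)
    show "(\<lambda>s. k s * gradsum \<phi> (g s)) integrable_on cbox 0 h"
      by (intro integrable_continuous continuous_intros kc
          continuous_on_compose2[OF continuous_gradsum[OF \<phi>] gc subset_UNIV])
    show "norm (frechet_derivative \<phi> (at (g s)) (g' s)) \<le> k s * gradsum \<phi> (g s)" if "s \<in> cbox 0 h" for s
      using norm_frechet_derivative_le_gradsum[OF \<phi>, of "g s" "g' s"] le[OF that]
      by (meson gradsum_nonneg mult_right_mono order_trans)
  qed
  finally show ?thesis .
qed

section \<open>Jensen's inequality and contractions of the box\<close>

text \<open>Jensen's inequality for the power q. Young's inequality at the mean \<open>A\<close> is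
  the tangent-line bound for the power function at \<open>A\<close>; integrating it and cancelling
  gives the claim. The mean zero is treated separately because \<open>A\<close> is split off as a
  factor by powers.\<close>

lemma integral_power_mean:
  fixes F :: "'a::euclidean_space \<Rightarrow> real"
  assumes q: "q > 1" and c: "measure lborel (cbox a b) > 0"
    and F: "continuous_on (cbox a b) F" and F0: "\<And>x. x \<in> cbox a b \<Longrightarrow> 0 \<le> F x"
  shows "(integral (cbox a b) F / measure lborel (cbox a b)) powr q
         \<le> integral (cbox a b) (\<lambda>x. F x powr q) / measure lborel (cbox a b)"
proof -
  define c where "c = measure lborel (cbox a b)"
  have c0: "c > 0" using c c_def by simp
  define A where "A = integral (cbox a b) F / c"
  have A0: "A \<ge> 0"
    unfolding A_def using c0 F0 by (auto intro!: divide_nonneg_pos integral_nonneg integrable_continuous F)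
  show ?thesis
  proof (cases "A = 0")
    case True
    have "0 \<le> integral (cbox a b) (\<lambda>x. F x powr q) / c"
      using c0 q F F0 by (auto intro!: divide_nonneg_pos integral_nonneg integrable_continuous continuous_on_powr')
    moreover have "integral (cbox a b) F / measure lborel (cbox a b) = 0"
      using True by (simp only: A_def c_def)
    ultimately show ?thesis by (simp only: c_def) simp
  next
    case False
    then have A: "A > 0" using A0 by simp
    have ptw: "A powr (q - 1) * F x \<le> F x powr q / q + A powr q * (1 - 1 / q)" if "x \<in> cbox a b" for x
    proof -
      have "1 / q + 1 / (q / (q - 1)) = 1" "q / (q - 1) > 1"
        using q by (auto simp: diff_divide_distrib)
      then have "F x * A powr (q - 1) \<le> F x powr q / q + (A powr (q - 1)) powr (q / (q - 1)) / (q / (q - 1))"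
        using q F0[OF that] by (intro Youngs_inequality) simp_all
      moreover have "(A powr (q - 1)) powr (q / (q - 1)) = A powr q"
        using q by (simp add: powr_powr)
      ultimately show ?thesis using q by (simp add: field_simps)
    qed
    have Fq: "(\<lambda>x. F x powr q) integrable_on cbox a b"
      using q F F0 by (intro integrable_continuous continuous_on_powr') auto
    have "integral (cbox a b) (\<lambda>x. A powr (q - 1) * F x)
        \<le> integral (cbox a b) (\<lambda>x. F x powr q / q + A powr q * (1 - 1 / q))"
      using q F F0 ptw by (intro integral_le integrable_continuous continuous_intros continuous_on_powr') auto
    also have "\<dots> = integral (cbox a b) (\<lambda>x. F x powr q) / q + c * (A powr q * (1 - 1 / q))"
    proof (subst integral_add)
      show "(\<lambda>x. F x powr q / q) integrable_on cbox a b"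
        using integrable_on_mult_right[OF Fq, of "1 / q"] by simp
    qed (simp_all add: c_def integrable_const)
    also have "integral (cbox a b) (\<lambda>x. A powr (q - 1) * F x) = A powr (q - 1) * A * c"
      using c0 by (simp add: A_def)
    also have "A powr (q - 1) * A = A powr q"
      using A by (simp add: powr_diff)
    finally have "A powr q * c / q \<le> integral (cbox a b) (\<lambda>x. F x powr q) / q"
      by (simp add: right_diff_distrib mult.commute)
    then have "A powr q * c \<le> integral (cbox a b) (\<lambda>x. F x powr q)"
      using q by (simp add: divide_le_cancel)
    then have "A powr q \<le> integral (cbox a b) (\<lambda>x. F x powr q) / c"
      using c0 by (simp add: pos_le_divide_eq)
    then show ?thesis
      by (simp only: A_def c_def)
  qed
qed

lemma integral_square_mean:
  fixes F :: "'a::euclidean_space \<Rightarrow> real"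
  assumes c: "measure lborel (cbox a b) > 0"
    and F: "continuous_on (cbox a b) F" and F0: "\<And>x. x \<in> cbox a b \<Longrightarrow> 0 \<le> F x"
  shows "(integral (cbox a b) F / measure lborel (cbox a b))\<^sup>2
         \<le> integral (cbox a b) (\<lambda>x. (F x)\<^sup>2) / measure lborel (cbox a b)"
proof -
  have "integral (cbox a b) F / measure lborel (cbox a b) \<ge> 0"
    using c F0 by (auto intro!: divide_nonneg_pos integral_nonneg integrable_continuous F)
  moreover have "integral (cbox a b) (\<lambda>x. F x powr 2) = integral (cbox a b) (\<lambda>x. (F x)\<^sup>2)"
    using F0 by (intro integral_cong) auto
  ultimately show ?thesis
    using integral_power_mean[of 2 a b F] assms by simp
qed

text \<open>The map \<open>x \<mapsto> (1 - t) y + t x\<close> sends the box into itself with Jacobian \<open>t ^ d\<close>.\<close>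
lemma integral_contract_le:
  fixes g :: "'a::euclidean_space \<Rightarrow> real"
  assumes t: "0 < t" "t \<le> 1" and y: "y \<in> cbox a b"
    and g: "continuous_on UNIV g" and g0: "\<And>x. 0 \<le> g x"
  shows "integral (cbox a b) (\<lambda>x. g ((1 - t) *\<^sub>R y + t *\<^sub>R x)) \<le> integral (cbox a b) g / t ^ DIM('a)"
proof -
  have ne: "cbox a b \<noteq> {}" using y by auto
  define a' where "a' = t *\<^sub>R a + (1 - t) *\<^sub>R y"
  define b' where "b' = t *\<^sub>R b + (1 - t) *\<^sub>R y"
  have im: "(\<lambda>x. t *\<^sub>R x + (1 - t) *\<^sub>R y) ` cbox a b = cbox a' b'"
    using t ne by (simp add: image_affinity_cbox a'_def b'_def)
  have sub: "cbox a' b' \<subseteq> cbox a b"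
  proof -
    have "t *\<^sub>R x + (1 - t) *\<^sub>R y \<in> cbox a b" if "x \<in> cbox a b" for x
      by (rule convexD[OF convex_box(1) that y]) (use t in simp_all)
    then show ?thesis unfolding im[symmetric] by blast
  qed
  have gi: "(g has_integral integral (cbox a' b') g) (cbox a' b')"
    by (intro integrable_integral integrable_continuous continuous_on_subset[OF g]) auto
  \<comment> \<open>The affine change of variables integrates over the image under the inverse map,
    so the shrunken box has to be recognised as the preimage of the full one.\<close>
  have inv: "(\<lambda>x. (1 / t) *\<^sub>R x + - ((1 / t) *\<^sub>R ((1 - t) *\<^sub>R y))) ` cbox a' b' = cbox a b"
    unfolding im[symmetric] image_image using t by (simp add: scaleR_add_right)
  have "((\<lambda>x. g (t *\<^sub>R x + (1 - t) *\<^sub>R y)) has_integral (1 / \<bar>t\<bar> ^ DIM('a)) *\<^sub>R integral (cbox a' b') g) (cbox a b)"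
    using has_integral_affinity[OF gi, of t "(1 - t) *\<^sub>R y"] t unfolding inv by simp
  then have "integral (cbox a b) (\<lambda>x. g ((1 - t) *\<^sub>R y + t *\<^sub>R x)) = integral (cbox a' b') g / t ^ DIM('a)"
    using t by (simp add: integral_unique add.commute)
  moreover have "integral (cbox a' b') g \<le> integral (cbox a b) g"
    using sub g0 by (intro integral_subset_le integrable_continuous continuous_on_subset[OF g]) auto
  ultimately show ?thesis
    using t by (simp add: divide_right_mono)
qed

text \<open>Points are moved by the parameter \<open>s ^ m\<close> instead of \<open>s\<close>: for large \<open>m\<close> the factor \<open>m * s ^ (m - 1)\<close>
  of the velocity absorbs the singularity \<open>s ^ (- m * d)\<close> of the averaged gradient for every subcritical
  exponent, so that only unweighted integrals over \<open>s\<close> occur.\<close>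
definition contr :: "nat \<Rightarrow> real \<Rightarrow> 'a::real_vector \<Rightarrow> 'a \<Rightarrow> 'a" where
  "contr m s x z = (1 - s ^ m) *\<^sub>R x + s ^ m *\<^sub>R z"

text \<open>The operator S_h of the overview, but with contraction parameter \<open>h ^ m\<close> in
  place of h.\<close>

definition box_avg :: "'a::euclidean_space \<Rightarrow> 'a \<Rightarrow> nat \<Rightarrow> real \<Rightarrow> ('a \<Rightarrow> complex) \<Rightarrow> 'a \<Rightarrow> complex" where
  "box_avg a b m h \<phi> x = integral (cbox a b) (\<lambda>z. \<phi> (contr m h x z)) /\<^sub>R measure lborel (cbox a b)"

lemma contr_0 [simp]: "m > 0 \<Longrightarrow> contr m 0 x z = x"
  by (simp add: contr_def power_0_left)

lemma continuous_contr [continuous_intros]: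
  fixes f g :: "'b::topological_space \<Rightarrow> 'a::real_normed_vector"
  assumes "continuous_on S s" "continuous_on S f" "continuous_on S g"
  shows "continuous_on S (\<lambda>t. contr m (s t) (f t) (g t))"
  unfolding contr_def by (intro continuous_intros assms)

lemma continuous_gradsum_comp:
  "C1_fun \<phi> \<Longrightarrow> continuous_on S f \<Longrightarrow> continuous_on S (\<lambda>t. gradsum \<phi> (f t))"
  by (rule continuous_on_compose2[OF continuous_gradsum[of \<phi> UNIV]]) auto

lemma continuous_C1_comp:
  "C1_fun \<phi> \<Longrightarrow> continuous_on S f \<Longrightarrow> continuous_on S (\<lambda>t. \<phi> (f t))"
  by (rule continuous_on_compose2[OF C1_fun_continuous[of \<phi> UNIV]]) auto

section \<open>Boundedness, Lipschitz and error estimates for the averages\<close>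

context
  fixes a b :: "'a::euclidean_space" and m :: nat and D c :: real
  assumes ne: "box a b \<noteq> {}" and m: "m \<ge> 2"
  defines "c \<equiv> measure lborel (cbox a b)" and "D \<equiv> norm (b - a)"
begin

lemma content_pos: "0 < c"
  using ne content_pos_lt_eq[of a b] by (simp add: c_def box_ne_empty)

lemma norm_diff_le_D: "x \<in> cbox a b \<Longrightarrow> z \<in> cbox a b \<Longrightarrow> norm (z - x) \<le> D"
  unfolding D_def by (rule norm_le_componentwise) (auto simp: mem_box inner_diff_left abs_if, (smt (verit) mem_box(2))+)

text \<open>Jensen's inequality squares the mean. The contraction towards \<open>x\<close> has
  Jacobian \<open>s ^ (m * DIM('a))\<close>, so the mean of the squared gradient is bounded by its
  full integral, uniformly in \<open>x\<close>, at the price of a singularity in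
  \<open>s\<close>.\<close>

lemma gradsum_avg_sq_le:
  assumes \<phi>: "C1_fun \<phi>" and s: "0 < s" "s \<le> 1" and x: "x \<in> cbox a b"
  shows "(integral (cbox a b) (\<lambda>z. gradsum \<phi> (contr m s x z)) / c)\<^sup>2
      \<le> integral (cbox a b) (\<lambda>z. (gradsum \<phi> (contr m s x z))\<^sup>2) / c"
    and "integral (cbox a b) (\<lambda>z. (gradsum \<phi> (contr m s x z))\<^sup>2)
      \<le> integral (cbox a b) (\<lambda>y. (gradsum \<phi> y)\<^sup>2) / s ^ (m * DIM('a))"
proof -
  show "(integral (cbox a b) (\<lambda>z. gradsum \<phi> (contr m s x z)) / c)\<^sup>2
      \<le> integral (cbox a b) (\<lambda>z. (gradsum \<phi> (contr m s x z))\<^sup>2) / c"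
    unfolding c_def using content_pos unfolding c_def
    by (rule integral_square_mean)
      (auto intro!: continuous_intros continuous_gradsum_comp[OF \<phi>])
  have "s ^ m \<le> 1" using s by (simp add: power_le_one)
  then show "integral (cbox a b) (\<lambda>z. (gradsum \<phi> (contr m s x z))\<^sup>2)
      \<le> integral (cbox a b) (\<lambda>y. (gradsum \<phi> y)\<^sup>2) / s ^ (m * DIM('a))"
    unfolding contr_def power_mult using s x
    by (intro integral_contract_le[where g = "\<lambda>y. (gradsum \<phi> y)\<^sup>2"])
      (auto intro!: continuous_intros continuous_gradsum[OF \<phi>])
qed

text \<open>Jensen's inequality and the change of variables again, applied to \<phi> itself:
  averaging turns an L2 bound into a uniform bound.\<close>

lemma box_avg_bound:
  assumes \<phi>: "C1_fun \<phi>" and h: "0 < h" "h \<le> 1" and x: "x \<in> cbox a b"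
  shows "(norm (box_avg a b m h \<phi> x))\<^sup>2
     \<le> integral (cbox a b) (\<lambda>y. (norm (\<phi> y))\<^sup>2) / (c * h ^ (m * DIM('a)))"
proof -
  let ?I = "integral (cbox a b) (\<lambda>z. norm (\<phi> (contr m h x z)))"
  have "norm (integral (cbox a b) (\<lambda>z. \<phi> (contr m h x z))) \<le> ?I"
    by (intro integral_norm_bound_integral integrable_continuous continuous_intros continuous_C1_comp[OF \<phi>]) auto
  then have "norm (box_avg a b m h \<phi> x) \<le> ?I / c"
    using content_pos by (simp add: box_avg_def c_def divide_inverse mult.commute mult_right_mono)
  then have "(norm (box_avg a b m h \<phi> x))\<^sup>2 \<le> (?I / c)\<^sup>2"
    by (simp add: power_mono)
  also have "\<dots> \<le> integral (cbox a b) (\<lambda>z. (norm (\<phi> (contr m h x z)))\<^sup>2) / c"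
    unfolding c_def using content_pos unfolding c_def
    by (rule integral_square_mean)
      (auto intro!: continuous_intros continuous_C1_comp[OF \<phi>])
  also have "integral (cbox a b) (\<lambda>z. (norm (\<phi> (contr m h x z)))\<^sup>2)
      \<le> integral (cbox a b) (\<lambda>y. (norm (\<phi> y))\<^sup>2) / (h ^ m) ^ DIM('a)"
    unfolding contr_def using h x power_le_one[of h m]
    by (intro integral_contract_le[where g = "\<lambda>y. (norm (\<phi> y))\<^sup>2"])
      (auto intro!: continuous_intros C1_fun_continuous[OF \<phi>])
  finally show ?thesis
    using content_pos by (simp add: divide_right_mono power_mult mult.commute)
qed

text \<open>While the centre runs along the segment from \<open>x\<close> to \<open>y\<close>, the
  contracted point moves with velocity \<open>(1 - h ^ m) *\<^sub>R (y - x)\<close>. After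
  exchanging the integrals only averages of the gradient over contracted boxes remain, and these are
  bounded uniformly.\<close>

lemma box_avg_Lipschitz:
  assumes \<phi>: "C1_fun \<phi>" and h: "0 < h" "h \<le> 1" and x: "x \<in> cbox a b" and y: "y \<in> cbox a b"
  shows "norm (box_avg a b m h \<phi> y - box_avg a b m h \<phi> x)
     \<le> norm (y - x) * sqrt (integral (cbox a b) (\<lambda>y. (gradsum \<phi> y)\<^sup>2) / (c * h ^ (m * DIM('a))))"
proof -
  define w where "w t = x + t *\<^sub>R (y - x)" for t :: real
  have w_in: "w t \<in> cbox a b" if "t \<in> cbox 0 1" for t
  proof -
    have "(1 - t) *\<^sub>R x + t *\<^sub>R y \<in> cbox a b"
      by (rule convexD[OF convex_box(1) x y]) (use that in auto)
    then show ?thesis by (simp add: w_def algebra_simps)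
  qed
  let ?G = "integral (cbox a b) (\<lambda>y. (gradsum \<phi> y)\<^sup>2)"
  let ?g = "\<lambda>t z. norm (y - x) * gradsum \<phi> (contr m h (w t) z)"
  have hm: "0 \<le> 1 - h ^ m" "1 - h ^ m \<le> 1" using h by (auto simp: power_le_one)
  have cw: "continuous_on S w" for S unfolding w_def by (intro continuous_intros)
  have cg: "continuous_on S (\<lambda>p. ?g (fst p) (snd p))" for S
    by (intro continuous_intros continuous_gradsum_comp[OF \<phi>] continuous_on_compose2[OF cw[of UNIV]]) auto
  have ptw: "norm (\<phi> (contr m h y z) - \<phi> (contr m h x z)) \<le> integral (cbox 0 1) (\<lambda>t. ?g t z)" for z
  proof -
    have "norm (\<phi> (contr m h (w 1) z) - \<phi> (contr m h (w 0) z)) \<le> integral (cbox 0 1) (\<lambda>t. ?g t z)"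
    proof (rule C1_fun_path_bound[OF \<phi>, where g = "\<lambda>t. contr m h (w t) z"
            and g' = "\<lambda>_. (1 - h ^ m) *\<^sub>R (y - x)"])
      show "((\<lambda>t. contr m h (w t) z) has_vector_derivative (1 - h ^ m) *\<^sub>R (y - x)) (at s within cbox 0 1)" for s
        unfolding contr_def w_def by (auto intro!: derivative_eq_intros)
      show "norm ((1 - h ^ m) *\<^sub>R (y - x)) \<le> norm (y - x)"
        using hm by (simp add: mult_left_le_one_le)
    qed (auto intro!: continuous_intros)
    then show ?thesis by (simp add: w_def)
  qed
  have eq: "box_avg a b m h \<phi> y - box_avg a b m h \<phi> x
      = integral (cbox a b) (\<lambda>z. \<phi> (contr m h y z) - \<phi> (contr m h x z)) /\<^sub>R c"
    unfolding box_avg_def c_def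
    by (subst integral_diff)
       (auto intro!: integrable_continuous continuous_intros continuous_C1_comp[OF \<phi>] simp: scaleR_diff_right)
  have "norm (integral (cbox a b) (\<lambda>z. \<phi> (contr m h y z) - \<phi> (contr m h x z)))
      \<le> integral (cbox a b) (\<lambda>z. integral (cbox 0 1) (\<lambda>t. ?g t z))"
  proof (rule integral_norm_bound_integral)
    show "(\<lambda>z. \<phi> (contr m h y z) - \<phi> (contr m h x z)) integrable_on cbox a b"
      by (intro integrable_continuous continuous_intros continuous_C1_comp[OF \<phi>])
    show "(\<lambda>z. integral (cbox 0 1) (\<lambda>t. ?g t z)) integrable_on cbox a b"
      by (intro integrable_continuous integral_continuous_on_param)
         (auto simp: split_beta intro!: continuous_intros continuous_gradsum_comp[OF \<phi>] continuous_on_compose2[OF cw[of UNIV]])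
  qed (rule ptw)
  also have "\<dots> = integral (cbox 0 1) (\<lambda>t. integral (cbox a b) (\<lambda>z. ?g t z))"
    by (rule integral_swap_continuous[symmetric]) (use cg in \<open>auto simp: split_beta\<close>)
  also have "\<dots> \<le> integral (cbox 0 1) (\<lambda>t::real. c * (norm (y - x) * sqrt (?G / (c * h ^ (m * DIM('a))))))"
  proof (rule integral_le)
    show "(\<lambda>t. integral (cbox a b) (\<lambda>z. ?g t z)) integrable_on cbox 0 1"
      by (intro integrable_continuous integral_continuous_on_param)
        (use cg in \<open>auto simp: split_beta\<close>)
    fix t :: real assume "t \<in> cbox 0 1"
    note wt = w_in[OF this]
    have "(integral (cbox a b) (\<lambda>z. gradsum \<phi> (contr m h (w t) z)) / c)\<^sup>2 \<le> ?G / (c * h ^ (m * DIM('a)))"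
      using order_trans[OF gradsum_avg_sq_le(1)[OF \<phi> h wt] divide_right_mono[OF gradsum_avg_sq_le(2)[OF \<phi> h wt]]]
        content_pos by (simp add: mult.commute)
    then have "integral (cbox a b) (\<lambda>z. gradsum \<phi> (contr m h (w t) z)) / c \<le> sqrt (?G / (c * h ^ (m * DIM('a))))"
      by (rule real_le_rsqrt)
    then have "integral (cbox a b) (\<lambda>z. gradsum \<phi> (contr m h (w t) z)) \<le> c * sqrt (?G / (c * h ^ (m * DIM('a))))"
      using content_pos by (simp add: pos_divide_le_eq mult.commute)
    from mult_left_mono[OF this, of "norm (y - x)"]
    show "integral (cbox a b) (\<lambda>z. ?g t z) \<le> c * (norm (y - x) * sqrt (?G / (c * h ^ (m * DIM('a)))))"
      by (simp add: mult.left_commute)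
  qed (rule integrable_const)
  finally have "norm (integral (cbox a b) (\<lambda>z. \<phi> (contr m h y z) - \<phi> (contr m h x z)))
     \<le> c * (norm (y - x) * sqrt (?G / (c * h ^ (m * DIM('a)))))"
    by simp
  then show ?thesis
    unfolding eq using content_pos by (simp add: field_simps)
qed

text \<open>Following \<open>contr m s x z\<close> from s = 0 to h and averaging over z bounds the
  error by D * m times the integral of \<open>P s x\<close>, the averaged gradient
  \<open>H s x\<close> weighted by the velocity factor \<open>s ^ (m - 1)\<close>. The q-th power of
  \<open>H\<close> is split into q - 2 factors bounded uniformly and a square \<open>J\<close> that
  is integrated over \<open>x\<close>. The hypothesis \<open>mq\<close> says that the velocity
  factor compensates the singularity of the first part.\<close>

lemma box_avg_error:
  fixes q :: real
  assumes \<phi>: "C1_fun \<phi>" and h: "0 < h" "h \<le> 1/2" and q: "q > 2"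
    and mq: "q \<le> real m * (q - real DIM('a) * (q - 2) / 2)"
  shows "integral (cbox a b) (\<lambda>x. norm (\<phi> x - box_avg a b m h \<phi> x) powr q)
     \<le> (D * m) powr q * 2 ^ DIM('a) * (1 / c) powr ((q - 2) / 2) * h powr q
       * integral (cbox a b) (\<lambda>y. (gradsum \<phi> y)\<^sup>2) powr (q / 2)"
proof -
  let ?\<Omega> = "cbox a b"
  define G where "G = integral ?\<Omega> (\<lambda>y. (gradsum \<phi> y)\<^sup>2)"
  let ?e = "\<lambda>x. norm (\<phi> x - box_avg a b m h \<phi> x) powr q"
  let ?g = "(G / c) powr ((q - 2) / 2)"
  let ?C = "(D * m) powr q * h powr q * (?g / (c * h))"
  let ?w = "\<lambda>s x z. real m * s ^ (m - 1) * D * gradsum \<phi> (contr m s x z)"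
  define H where "H s x = integral ?\<Omega> (\<lambda>z. gradsum \<phi> (contr m s x z)) / c" for s x
  define J where "J s x = integral ?\<Omega> (\<lambda>z. (gradsum \<phi> (contr m s x z))\<^sup>2)" for s x
  define P where "P s x = s ^ (m - 1) * H s x" for s x
  have c0: "c > 0" by (rule content_pos)
  have D0: "D \<ge> 0" by (simp add: D_def)
  have G0: "G \<ge> 0"
    unfolding G_def by (intro integral_nonneg integrable_continuous continuous_intros continuous_gradsum[OF \<phi>]) auto
  have cg: "continuous_on S (\<lambda>t. gradsum \<phi> (contr m (f t) (g t) (k t)))"
    if "continuous_on S f" "continuous_on S g" "continuous_on S k"
    for S :: "'b::topological_space set" and f g k
    using that by (intro continuous_gradsum_comp[OF \<phi>] continuous_intros)
  have cH: "continuous_on S (\<lambda>t. H (fst t) (snd t))" for S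
    unfolding H_def by (intro continuous_intros integral_continuous_on_param)
      (use c0 in \<open>auto simp: split_beta intro!: cg continuous_intros\<close>)
  have cJ: "continuous_on S (\<lambda>t. J (fst t) (snd t))" for S
    unfolding J_def by (intro continuous_intros integral_continuous_on_param)
      (auto simp: split_beta intro!: cg continuous_intros)
  have cH1: "continuous_on S (\<lambda>s. H s x)" for S x
    by (rule continuous_on_compose2[OF cH[of UNIV], of S "\<lambda>s. (s, x)", simplified]) (intro continuous_intros)
  have cJ1: "continuous_on S (\<lambda>s. J s x)" for S x
    by (rule continuous_on_compose2[OF cJ[of UNIV], of S "\<lambda>s. (s, x)", simplified]) (intro continuous_intros)
  have H0: "H s x \<ge> 0" for s x
    unfolding H_def using c0
    by (intro divide_nonneg_pos integral_nonneg integrable_continuous cg continuous_intros) auto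
  have J0: "J s x \<ge> 0" for s x
    unfolding J_def by (intro integral_nonneg integrable_continuous continuous_intros cg) auto
  have cP: "continuous_on S (\<lambda>s. P s x)" for S x
    unfolding P_def by (intro continuous_intros cH1)
  have ptw1: "norm (\<phi> (contr m h x z) - \<phi> x)
      \<le> integral (cbox 0 h) (\<lambda>s. ?w s x z)"
    if x: "x \<in> ?\<Omega>" and z: "z \<in> ?\<Omega>" for x z
  proof -
    have "norm (\<phi> (contr m h x z) - \<phi> (contr m 0 x z))
      \<le> integral (cbox 0 h) (\<lambda>s. (real m * s ^ (m - 1) * D) * gradsum \<phi> (contr m s x z))"
    proof (rule C1_fun_path_bound[OF \<phi>, where g = "\<lambda>s. contr m s x z"
            and g' = "\<lambda>s. (real m * s ^ (m - 1)) *\<^sub>R (z - x)"])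
      show "((\<lambda>s. contr m s x z) has_vector_derivative (real m * s ^ (m - 1)) *\<^sub>R (z - x)) (at s within cbox 0 h)" for s
      proof -
        have "((\<lambda>s. x + (s ^ m) *\<^sub>R (z - x)) has_vector_derivative (real m * s ^ (m - 1)) *\<^sub>R (z - x)) (at s within cbox 0 h)"
          by (auto intro!: derivative_eq_intros simp: has_real_derivative_iff_has_vector_derivative[symmetric])
        then show ?thesis by (simp add: contr_def algebra_simps)
      qed
      show "norm ((real m * s ^ (m - 1)) *\<^sub>R (z - x)) \<le> real m * s ^ (m - 1) * D" if "s \<in> cbox 0 h" for s
        using that norm_diff_le_D[OF x z] by (simp add: abs_mult mult_left_mono)
    qed (use h in \<open>auto intro!: continuous_intros\<close>)
    then show ?thesis using m by simp
  qed
  have ptw2: "norm (\<phi> x - box_avg a b m h \<phi> x) \<le> (D * m) * integral (cbox 0 h) (\<lambda>s. P s x)"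
    if x: "x \<in> ?\<Omega>" for x
  proof -
    have eq: "box_avg a b m h \<phi> x - \<phi> x = integral ?\<Omega> (\<lambda>z. \<phi> (contr m h x z) - \<phi> x) /\<^sub>R c"
      unfolding box_avg_def using c0
      by (subst integral_diff)
       (auto intro!: integrable_continuous continuous_intros continuous_C1_comp[OF \<phi>]
          simp: scaleR_diff_right c_def)
    have "norm (integral ?\<Omega> (\<lambda>z. \<phi> (contr m h x z) - \<phi> x))
      \<le> integral ?\<Omega> (\<lambda>z. integral (cbox 0 h) (\<lambda>s. ?w s x z))"
    proof (rule integral_norm_bound_integral)
      show "(\<lambda>z. \<phi> (contr m h x z) - \<phi> x) integrable_on ?\<Omega>"
        by (intro integrable_continuous continuous_intros continuous_C1_comp[OF \<phi>])
      show "(\<lambda>z. integral (cbox 0 h) (\<lambda>s. ?w s x z)) integrable_on ?\<Omega>"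
        by (intro integrable_continuous integral_continuous_on_param)
           (auto simp: split_beta intro!: continuous_intros cg)
    qed (rule ptw1[OF x])
    also have "\<dots> = integral (cbox 0 h) (\<lambda>s. integral ?\<Omega> (\<lambda>z. ?w s x z))"
      by (rule integral_swap_continuous[symmetric]) (auto simp: split_beta intro!: continuous_intros cg)
    also have "\<dots> = integral (cbox 0 h) (\<lambda>s. (c * D * m) * P s x)"
      using c0 by (simp add: P_def H_def mult_ac)
    also have "\<dots> = (c * D * m) * integral (cbox 0 h) (\<lambda>s. P s x)"
      by simp
    finally have "norm (box_avg a b m h \<phi> x - \<phi> x) \<le> (D * m) * integral (cbox 0 h) (\<lambda>s. P s x)"
      unfolding eq using c0 by (simp add: field_simps)
    then show ?thesis by (simp add: norm_minus_commute)
  qed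
  have Pq: "P s x powr q \<le> ?g * (J s x / c)" if s: "s \<in> cbox 0 h" and x: "x \<in> ?\<Omega>" for s x
  proof (cases "s = 0")
    case True
    then show ?thesis using m q c0 J0 by (simp add: P_def power_0_left)
  next
    case False
    then have s: "0 < s" "s \<le> 1" using s h by auto
    have H2: "(H s x)\<^sup>2 \<le> J s x / c" and J: "J s x \<le> G / s ^ (m * DIM('a))"
      using gradsum_avg_sq_le[OF \<phi> s x] by (simp_all add: H_def J_def G_def)
    \<comment> \<open>The square on the right is kept for the integration in \<open>x\<close>; the
      other factor carries the remaining q - 2 powers and is estimated uniformly in
      \<open>x\<close>.\<close>
    have "H s x powr q = ((H s x)\<^sup>2) powr ((q - 2) / 2) * (H s x)\<^sup>2"
    proof (cases "H s x = 0")
      case False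
      then have "H s x > 0" using H0[of s x] by simp
      then show ?thesis
        using q by (simp add: powr_powr powr_add[symmetric] diff_divide_distrib flip: powr_numeral)
    qed (use q in simp)
    also have "\<dots> \<le> (G / (s ^ (m * DIM('a))) / c) powr ((q - 2) / 2) * (J s x / c)"
      using q c0 order_trans[OF H2 divide_right_mono[OF J, of c]] H2
      by (intro mult_mono powr_mono2) auto
    also have "(G / (s ^ (m * DIM('a))) / c) powr ((q - 2) / 2)
        = ?g * s powr (- (m * DIM('a) * ((q - 2) / 2)))"
    proof -
      have "G / (s ^ (m * DIM('a))) / c = (G / c) * s powr (- (m * DIM('a)))"
        using s by (simp add: powr_minus powr_realpow[symmetric] field_simps)
      then have "(G / (s ^ (m * DIM('a))) / c) powr ((q - 2) / 2)
          = ((G / c) * s powr (- (m * DIM('a)))) powr ((q - 2) / 2)"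
        by (rule arg_cong)
      also have "\<dots> = ?g * (s powr (- (m * DIM('a)))) powr ((q - 2) / 2)"
        using G0 c0 s by (subst powr_mult) simp_all
      finally show ?thesis
        by (simp only: powr_powr) simp
    qed
    finally have Hq: "H s x powr q \<le> ?g * s powr (- (m * DIM('a) * ((q - 2) / 2))) * (J s x / c)" .
    have "P s x powr q = s powr ((m - 1) * q) * H s x powr q"
      unfolding P_def using s H0 m
      by (simp add: powr_mult powr_powr of_nat_diff flip: powr_realpow)
    also have "\<dots> \<le> s powr ((m - 1) * q) * (?g * s powr (- (m * DIM('a) * ((q - 2) / 2))) * (J s x / c))"
      using Hq by (intro mult_left_mono) auto
    also have "\<dots> = s powr ((m - 1) * q - m * DIM('a) * ((q - 2) / 2)) * (?g * (J s x / c))"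
      by (simp only: diff_conv_add_uminus powr_add mult_ac)
    also have "\<dots> \<le> 1 * (?g * (J s x / c))"
    proof (rule mult_right_mono)
      \<comment> \<open>Multiplied out, \<open>mq\<close> is exactly the nonnegativity of this
        exponent.\<close>
      have "0 \<le> (m - 1) * q - m * DIM('a) * ((q - 2) / 2)"
      proof -
        have "m * (q - DIM('a) * (q - 2) / 2) = m * q - m * DIM('a) * ((q - 2) / 2)"
          by (simp add: field_simps)
        moreover have "real (m - 1) * q = real m * q - q"
          using m by (simp add: of_nat_diff left_diff_distrib)
        ultimately show ?thesis using mq by linarith
      qed
      then show "s powr ((m - 1) * q - m * DIM('a) * ((q - 2) / 2)) \<le> 1"
        using s by (simp add: powr_le1)
    qed (use J0 c0 in auto)
    finally show ?thesis by simp
  qed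
  have ptw3: "?e x
      \<le> ?C * integral (cbox 0 h) (\<lambda>s. J s x)"
    if x: "x \<in> ?\<Omega>" for x
  proof -
    have P0: "P s x \<ge> 0" if "s \<in> cbox 0 h" for s
      using H0 that by (auto simp: P_def)
    have IP: "integral (cbox 0 h) (\<lambda>s. P s x) \<ge> 0"
      using P0 by (intro integral_nonneg integrable_continuous cP)
    have "?e x \<le> ((D * m) * integral (cbox 0 h) (\<lambda>s. P s x)) powr q"
      using ptw2[OF x] q by (intro powr_mono2) auto
    also have "\<dots> = (D * m) powr q * h powr q * (integral (cbox 0 h) (\<lambda>s. P s x) / h) powr q"
    proof -
      have "(D * m) * integral (cbox 0 h) (\<lambda>s. P s x) = (D * m) * h * (integral (cbox 0 h) (\<lambda>s. P s x) / h)"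
        using h by simp
      then show ?thesis
        using D0 h IP by (simp only: powr_mult)
    qed
    finally have 1: "?e x
      \<le> (D * m) powr q * h powr q * (integral (cbox 0 h) (\<lambda>s. P s x) / h) powr q" .
    \<comment> \<open>Jensen's inequality in the variable \<open>s\<close>. Normalising by the
      length h is what produces the small factor \<open>h powr q\<close> of the final bound.\<close>
    have "(integral (cbox 0 h) (\<lambda>s. P s x) / h) powr q \<le> integral (cbox 0 h) (\<lambda>s. P s x powr q) / h"
      using integral_power_mean[of q 0 h "\<lambda>s. P s x"] h q P0 cP by simp
    also have "\<dots> \<le> integral (cbox 0 h) (\<lambda>s. ?g / c * J s x) / h"
      using Pq x q P0 h
      by (intro divide_right_mono integral_le integrable_continuous continuous_intros cJ1 continuous_on_powr' cP) auto
    also have "\<dots> = ?g / (c * h) * integral (cbox 0 h) (\<lambda>s. J s x)"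
      by simp
    finally have "(D * m) powr q * h powr q * (integral (cbox 0 h) (\<lambda>s. P s x) / h) powr q
      \<le> (D * m) powr q * h powr q * (?g / (c * h) * integral (cbox 0 h) (\<lambda>s. J s x))"
      by (rule mult_left_mono) simp
    with 1 show ?thesis
      by (simp only: mult.assoc)
  qed
  have "integral ?\<Omega> ?e
    \<le> integral ?\<Omega> (\<lambda>x. ?C * integral (cbox 0 h) (\<lambda>s. J s x))"
  proof (rule integral_le)
    show "?e integrable_on ?\<Omega>"
      unfolding box_avg_def using q
      by (intro integrable_continuous continuous_on_powr' continuous_intros C1_fun_continuous[OF \<phi>]
          integral_continuous_on_param) (auto simp: split_beta intro!: continuous_intros continuous_C1_comp[OF \<phi>])
    show "(\<lambda>x. ?C * integral (cbox 0 h) (\<lambda>s. J s x)) integrable_on ?\<Omega>"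
      by (intro integrable_continuous continuous_intros integral_continuous_on_param)
        (auto simp: split_beta intro!: continuous_on_compose2[OF cJ[of UNIV], of _ "\<lambda>p. (snd p, fst p)", simplified] continuous_intros)
  qed (rule ptw3)
  also have "\<dots> = ?C * integral ?\<Omega> (\<lambda>x. integral (cbox 0 h) (\<lambda>s. J s x))"
    by simp
  finally have main: "integral ?\<Omega> ?e
    \<le> ?C * integral ?\<Omega> (\<lambda>x. integral (cbox 0 h) (\<lambda>s. J s x))" .
  have "integral ?\<Omega> (\<lambda>x. integral (cbox 0 h) (\<lambda>s. J s x)) = integral (cbox 0 h) (\<lambda>s. integral ?\<Omega> (\<lambda>x. J s x))"
    by (rule integral_swap_continuous) 
      (auto simp: split_beta intro!: continuous_on_compose2[OF cJ[of UNIV], of _ "\<lambda>p. (snd p, fst p)", simplified] continuous_intros)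
  also have "\<dots> \<le> integral (cbox 0 h) (\<lambda>s. c * (2 ^ DIM('a) * G))"
  proof (rule integral_le)
    show "(\<lambda>s. integral ?\<Omega> (\<lambda>x. J s x)) integrable_on cbox 0 h"
      by (intro integrable_continuous integral_continuous_on_param) (use cJ in \<open>auto simp: split_beta\<close>)
    fix s assume "s \<in> cbox 0 h"
    then have s: "0 \<le> s" "s \<le> 1 / 2" using h by auto
    then have sm: "s ^ m \<le> 1 / 2"
      using power_decreasing[of 1 m s] m by auto
    have sm0: "0 \<le> s ^ m" using s by simp
    \<comment> \<open>With the order exchanged, \<open>x\<close> varies and \<open>z\<close> is the
      fixed centre. The contraction ratio is now \<open>1 - s ^ m\<close>, at least 1/2, so the
      singularity in \<open>s\<close> is gone and the Jacobian costs only the factor 2 ^ d.\<close>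
    have "integral ?\<Omega> (\<lambda>x. J s x) = integral ?\<Omega> (\<lambda>z. integral ?\<Omega> (\<lambda>x. (gradsum \<phi> (contr m s x z))\<^sup>2))"
      unfolding J_def
      by (rule integral_swap_continuous) (auto simp: split_beta intro!: continuous_intros cg)
    also have "\<dots> \<le> integral ?\<Omega> (\<lambda>z. 2 ^ DIM('a) * G)"
    proof (rule integral_le)
      show "(\<lambda>z. integral ?\<Omega> (\<lambda>x. (gradsum \<phi> (contr m s x z))\<^sup>2)) integrable_on ?\<Omega>"
        by (intro integrable_continuous integral_continuous_on_param)
          (auto simp: split_beta intro!: continuous_intros cg)
      fix z assume z: "z \<in> ?\<Omega>"
      have "integral ?\<Omega> (\<lambda>x. (gradsum \<phi> (contr m s x z))\<^sup>2)
        = integral ?\<Omega> (\<lambda>x. (gradsum \<phi> ((1 - (1 - s ^ m)) *\<^sub>R z + (1 - s ^ m) *\<^sub>R x))\<^sup>2)"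
        by (simp add: contr_def add.commute)
      also have "\<dots> \<le> G / (1 - s ^ m) ^ DIM('a)"
        unfolding G_def using z sm sm0
        by (intro integral_contract_le[where g = "\<lambda>y. (gradsum \<phi> y)\<^sup>2"])
          (auto intro!: continuous_intros continuous_gradsum[OF \<phi>])
      also have "\<dots> \<le> G / (1 / 2) ^ DIM('a)"
        using sm G0 by (intro divide_left_mono power_mono mult_pos_pos zero_less_power) auto
      also have "\<dots> = 2 ^ DIM('a) * G" by (simp add: power_divide)
      finally show "integral ?\<Omega> (\<lambda>x. (gradsum \<phi> (contr m s x z))\<^sup>2) \<le> 2 ^ DIM('a) * G" .
    qed (rule integrable_const)
    also have "\<dots> = c * (2 ^ DIM('a) * G)" by (simp add: c_def)
    finally show "integral ?\<Omega> (\<lambda>x. J s x) \<le> c * (2 ^ DIM('a) * G)" .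
  qed (rule integrable_const)
  also have "\<dots> = h * (c * (2 ^ DIM('a) * G))" using h by simp
  finally have "?C * integral ?\<Omega> (\<lambda>x. integral (cbox 0 h) (\<lambda>s. J s x))
     \<le> ?C * (h * (c * (2 ^ DIM('a) * G)))"
    by (rule mult_left_mono) (use c0 h in simp)
  with main have "integral ?\<Omega> ?e
    \<le> ?C * (h * (c * (2 ^ DIM('a) * G)))"
    by (rule order_trans)
  also have "\<dots> = (D * m) powr q * 2 ^ DIM('a) * h powr q * (?g * G)"
    using c0 h by simp
  also have "?g * G = (1 / c) powr ((q - 2) / 2) * G powr (q / 2)"
  proof -
    have "?g = (1 / c) powr ((q - 2) / 2) * G powr ((q - 2) / 2)"
      using G0 c0 by (simp add: powr_mult[symmetric])
    moreover have "G * G powr ((q - 2) / 2) = G powr (q / 2)"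
      using powr_mult_base[OF G0, of "(q - 2) / 2"] by (simp add: add_divide_distrib[symmetric] diff_divide_distrib)
    ultimately show ?thesis by (simp add: mult_ac)
  qed
  finally show ?thesis by (simp add: G_def mult_ac)
qed

end


section \<open>Sobolev inequality and Rellich compactness for C1 functions\<close>

lemma powr_add_le:
  fixes x y q :: real
  assumes "0 \<le> x" "0 \<le> y" "0 \<le> q"
  shows "(x + y) powr q \<le> 2 powr q * (x powr q + y powr q)"
proof -
  have "(x + y) powr q \<le> (2 * max x y) powr q"
    using assms by (intro powr_mono2) auto
  also have "\<dots> = 2 powr q * max x y powr q"
    using assms by (subst powr_mult) auto
  also have "max x y powr q \<le> x powr q + y powr q"
    by (auto simp: max_def)
  finally show ?thesis by (simp add: mult_left_mono)
qed

lemma powr_add3_le: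
  fixes X Y Z q :: real
  assumes nn: "0 \<le> X" "0 \<le> Y" "0 \<le> Z" and q: "0 \<le> q"
  shows "(X + Y + Z) powr q \<le> 4 powr q * (X powr q + Y powr q + Z powr q)"
proof -
  have "((X + Y) + Z) powr q \<le> 2 powr q * ((X + Y) powr q + Z powr q)"
    using q nn by (intro powr_add_le) auto
  also have "\<dots> \<le> 2 powr q * (2 powr q * (X powr q + Y powr q) + 2 powr q * Z powr q)"
  proof (intro mult_left_mono add_mono)
    show "(X + Y) powr q \<le> 2 powr q * (X powr q + Y powr q)"
      using q nn by (intro powr_add_le) auto
    show "Z powr q \<le> 2 powr q * Z powr q"
      using mult_right_mono[of 1 "2 powr q" "Z powr q"] q by (simp add: ge_one_powr_ge_zero)
  qed auto
  also have "\<dots> = 4 powr q * (X powr q + Y powr q + Z powr q)"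
    using powr_mult[of 2 2 q] by (simp add: algebra_simps)
  finally show ?thesis .
qed

text \<open>The quantity \<delta> is positive exactly for subcritical q, and then a large multiple
  of it exceeds q. Taking the maximum with 2 makes the velocity factor \<open>s ^ (m - 1)\<close>
  vanish at s = 0.\<close>

lemma subcritical_exponent:
  fixes q :: real and d :: nat
  assumes "q > 2" "q * (real d - 2) < 2 * real d"
  obtains m :: nat where "m \<ge> 2" "q \<le> real m * (q - real d * (q - 2) / 2)"
proof -
  define \<delta> where "\<delta> = q - real d * (q - 2) / 2"
  have \<delta>: "\<delta> > 0" using assms by (simp add: \<delta>_def algebra_simps)
  obtain n :: nat where "q / \<delta> < n" using reals_Archimedean2 by blast
  then have "q < real n * \<delta>" using \<delta> by (simp add: pos_divide_less_eq)
  also have "\<dots> \<le> real (max 2 n) * \<delta>" using \<delta> by (intro mult_right_mono) auto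
  finally have "q \<le> real (max 2 n) * \<delta>" by simp
  then show ?thesis using that[of "max 2 n"] by (simp add: \<delta>_def)
qed

lemma continuous_box_avg:
  assumes "C1_fun \<phi>"
  shows "continuous_on S (box_avg a b m h \<phi>)"
  unfolding box_avg_def [abs_def]
  by (intro continuous_intros integral_continuous_on_param)
     (auto simp: split_beta intro!: continuous_intros continuous_C1_comp[OF assms])

text \<open>With the fixed step h = 1/2, \<phi> is split into its average, bounded uniformly by the
  L2 norm, and the averaging error, bounded by the gradient. The summand 1 in \<open>K\<close> makes
  positivity immediate.\<close>

theorem Sobolev_C1_box:
  fixes a b :: "'a::euclidean_space" and q :: real
  assumes ne: "box a b \<noteq> {}" and q: "q > 2" "q * (real DIM('a) - 2) < 2 * real DIM('a)"
  obtains K where "K > 0" "\<And>\<phi>. C1_fun \<phi> \<Longrightarrow>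
     integral (cbox a b) (\<lambda>x. norm (\<phi> x) powr q)
      \<le> K * (integral (cbox a b) (\<lambda>x. (norm (\<phi> x))\<^sup>2) + integral (cbox a b) (\<lambda>x. (gradsum \<phi> x)\<^sup>2)) powr (q / 2)"
proof -
  obtain m where m: "m \<ge> 2" and mq: "q \<le> real m * (q - real DIM('a) * (q - 2) / 2)"
    using subcritical_exponent[OF q] .
  define c where "c = measure lborel (cbox a b)"
  define D where "D = norm (b - a)"
  have c0: "c > 0" using content_pos[OF ne m] by (simp add: c_def)
  define K1 where "K1 = (D * m) powr q * 2 ^ DIM('a) * (1 / c) powr ((q - 2) / 2) * (1/2) powr q"
  define K2 where "K2 = c * (1 / (c * (1/2) ^ (m * DIM('a)))) powr (q / 2)"
  define K where "K = 2 powr q * (K1 + K2) + 1"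
  have K1: "K1 \<ge> 0" and K2: "K2 \<ge> 0" using c0 by (simp_all add: K1_def K2_def)
  show ?thesis
  proof (rule that)
    show "K > 0" using K1 K2 by (simp add: K_def add_nonneg_pos)
    fix \<phi> :: "'a \<Rightarrow> complex" assume \<phi>: "C1_fun \<phi>"
    define F where "F = integral (cbox a b) (\<lambda>x. (norm (\<phi> x))\<^sup>2)"
    define G where "G = integral (cbox a b) (\<lambda>x. (gradsum \<phi> x)\<^sup>2)"
    have F0: "F \<ge> 0" and G0: "G \<ge> 0"
      unfolding F_def G_def
      by (auto intro!: integral_nonneg integrable_continuous continuous_intros continuous_gradsum C1_fun_continuous \<phi>)
    let ?S = "box_avg a b m (1/2) \<phi>"
    have S: "norm (?S x) powr q \<le> K2 / c * F powr (q / 2)" if "x \<in> cbox a b" for x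
    proof -
      have "norm (?S x) powr q = ((norm (?S x))\<^sup>2) powr (q / 2)"
        using q by (cases "?S x = 0") (auto simp: powr_powr simp flip: powr_numeral)
      also have "\<dots> \<le> (F / (c * (1/2) ^ (m * DIM('a)))) powr (q / 2)"
        using box_avg_bound[OF ne m \<phi>, of "1/2" x] that q by (intro powr_mono2) (auto simp: F_def c_def)
      also have "\<dots> = (1 / (c * (1/2) ^ (m * DIM('a))) * F) powr (q / 2)" by simp
      also have "\<dots> = K2 / c * F powr (q / 2)"
        using c0 F0 by (subst powr_mult) (auto simp: K2_def)
      finally show ?thesis .
    qed
    have cd: "(\<lambda>x. norm (\<phi> x - ?S x) powr q) integrable_on cbox a b"
      using q by (intro integrable_continuous continuous_on_powr' continuous_intros continuous_box_avg C1_fun_continuous \<phi>) auto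
    have "integral (cbox a b) (\<lambda>x. norm (\<phi> x) powr q)
       \<le> integral (cbox a b) (\<lambda>x. 2 powr q * (norm (\<phi> x - ?S x) powr q + K2 / c * F powr (q / 2)))"
    proof (rule integral_le)
      show "(\<lambda>x. norm (\<phi> x) powr q) integrable_on cbox a b"
        using q by (intro integrable_continuous continuous_on_powr' continuous_intros C1_fun_continuous \<phi>) auto
      show "(\<lambda>x. 2 powr q * (norm (\<phi> x - ?S x) powr q + K2 / c * F powr (q / 2))) integrable_on cbox a b"
        using q by (intro integrable_continuous continuous_on_powr' continuous_intros continuous_box_avg C1_fun_continuous \<phi>) auto
      fix x assume x: "x \<in> cbox a b"
      have "norm (\<phi> x) powr q \<le> (norm (\<phi> x - ?S x) + norm (?S x)) powr q"
        using q norm_triangle_ineq[of "\<phi> x - ?S x" "?S x"] by (intro powr_mono2) auto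
      also have "\<dots> \<le> 2 powr q * (norm (\<phi> x - ?S x) powr q + norm (?S x) powr q)"
        using q by (intro powr_add_le) auto
      also have "\<dots> \<le> 2 powr q * (norm (\<phi> x - ?S x) powr q + K2 / c * F powr (q / 2))"
        using S[OF x] by (intro mult_left_mono add_left_mono) auto
      finally show "norm (\<phi> x) powr q \<le> 2 powr q * (norm (\<phi> x - ?S x) powr q + K2 / c * F powr (q / 2))" .
    qed
    also have "\<dots> = 2 powr q * (integral (cbox a b) (\<lambda>x. norm (\<phi> x - ?S x) powr q) + K2 * F powr (q / 2))"
      using cd c0 by (subst integral_mult_right, subst integral_add) (auto simp: integrable_const c_def)
    also have "\<dots> \<le> 2 powr q * (K1 * G powr (q / 2) + K2 * F powr (q / 2))"
      using box_avg_error[OF ne m \<phi>, of "1/2" q] q mq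
      by (intro mult_left_mono add_right_mono) (auto simp: K1_def G_def c_def D_def)
    also have "\<dots> \<le> 2 powr q * (K1 * (F + G) powr (q / 2) + K2 * (F + G) powr (q / 2))"
      using F0 G0 q K1 K2 by (intro mult_left_mono add_mono powr_mono2) auto
    also have "\<dots> \<le> K * (F + G) powr (q / 2)"
    proof -
      have "2 powr q * (K1 * (F + G) powr (q / 2) + K2 * (F + G) powr (q / 2)) = (K - 1) * (F + G) powr (q / 2)"
        unfolding K_def by (simp only: distrib_left distrib_right add_diff_cancel mult.assoc)
      then show ?thesis by (simp add: left_diff_distrib)
    qed
    finally show "integral (cbox a b) (\<lambda>x. norm (\<phi> x) powr q) \<le> K * (F + G) powr (q / 2)" .
  qed
qed

text \<open>Cantor's diagonal argument, with Bolzano-Weierstrass applied to one coordinate at each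
  stage.\<close>

lemma pointwise_convergent_subseq:
  fixes f :: "nat \<Rightarrow> nat \<Rightarrow> 'a::heine_borel"
  assumes bdd: "\<And>k. bounded (range (\<lambda>n. f n k))"
  obtains r :: "nat \<Rightarrow> nat" where "strict_mono r" "\<And>k. convergent (\<lambda>n. f (r n) k)"
proof -
  interpret subseqs "\<lambda>k s. convergent (\<lambda>n. f (s n) k)"
  proof
    fix k and s :: "nat \<Rightarrow> nat" assume "strict_mono s"
    have "bounded (range (\<lambda>n. f (s n) k))"
      by (rule bounded_subset[OF bdd[of k]]) auto
    from bounded_imp_convergent_subsequence[OF this] obtain l r
      where "strict_mono r" "((\<lambda>n. f (s n) k) \<circ> r) \<longlonglongrightarrow> l" by blast
    then show "\<exists>r'. strict_mono r' \<and> convergent (\<lambda>n. f ((s \<circ> r') n) k)"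
      by (auto simp: o_def convergent_def)
  qed
  have "convergent (\<lambda>n. f (diagseq n) k)" for k
  proof -
    \<comment> \<open>The diagonal sequence refines the stage that handles coordinate k only from
      index \<open>Suc k\<close> on; the initial segment is removed afterwards.\<close>
    have "convergent (\<lambda>n. f ((diagseq \<circ> (+) (Suc k)) n) k)"
    proof (rule diagseq_holds)
      fix r s :: "nat \<Rightarrow> nat" and n assume "strict_mono r" "convergent (\<lambda>i. f (s i) n)"
      then show "convergent (\<lambda>i. f ((s \<circ> r) i) n)"
        using convergent_subseq_convergent[of "\<lambda>i. f (s i) n" r] by (simp add: o_def)
    qed
    then have "convergent (\<lambda>n. f (diagseq (n + Suc k)) k)"
      by (simp add: o_def add.commute)
    then show ?thesis
      by (rule convergent_ignore_initial_segment[THEN iffD1])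
  qed
  then show ?thesis using that[OF subseq_diagseq] by blast
qed

text \<open>The Arzela-Ascoli argument: finitely many \<delta>-balls around points of
  \<open>T\<close> cover \<open>K\<close>. Moving to a centre costs at most e/4 for each of the two
  functions, and at the finitely many centres the values are eventually e/4-close.\<close>

lemma equi_Lipschitz_uniformly_Cauchy:
  fixes f :: "nat \<Rightarrow> 'a::metric_space \<Rightarrow> 'b::real_normed_vector"
  assumes K: "compact K" and dense: "K \<subseteq> closure T" and TK: "T \<subseteq> K"
    and conv: "\<And>t. t \<in> T \<Longrightarrow> convergent (\<lambda>n. f n t)"
    and lip: "\<And>n x y. x \<in> K \<Longrightarrow> y \<in> K \<Longrightarrow> norm (f n y - f n x) \<le> L * dist x y"
    and e: "e > 0"
  shows "\<exists>N. \<forall>i\<ge>N. \<forall>j\<ge>N. \<forall>x\<in>K. norm (f i x - f j x) < e"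
proof -
  \<comment> \<open>The term \<open>\<bar>L\<bar> + 1\<close> makes the division safe without any
    sign condition on \<open>L\<close>.\<close>
  define \<delta> where "\<delta> = e / (4 * (\<bar>L\<bar> + 1))"
  have \<delta>: "\<delta> > 0" using e by (simp add: \<delta>_def add_nonneg_pos)
  have L\<delta>: "L * d \<le> e / 4" if "d \<le> \<delta>" "0 \<le> d" for d
  proof -
    have "L * d \<le> (\<bar>L\<bar> + 1) * \<delta>" using that by (intro mult_mono) auto
    also have "\<dots> = e / 4"
    proof -
      have "\<bar>L\<bar> + 1 \<noteq> 0" by linarith
      then show ?thesis unfolding \<delta>_def by (metis mult.commute nonzero_mult_div_cancel_left times_divide_eq_right divide_divide_eq_left)
    qed
    finally show ?thesis .
  qed
  have "K \<subseteq> (\<Union>t\<in>T. ball t \<delta>)"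
  proof
    fix x assume "x \<in> K"
    then have "x \<in> closure T" using dense by blast
    then obtain t where "t \<in> T" "dist t x < \<delta>"
      using \<delta> unfolding closure_approachable by blast
    then show "x \<in> (\<Union>t\<in>T. ball t \<delta>)" by auto
  qed
  then obtain T' where T': "T' \<subseteq> T" "finite T'" "K \<subseteq> (\<Union>t\<in>T'. ball t \<delta>)"
    using compactE_image[OF K, of T "\<lambda>t. ball t \<delta>"] by auto
  have "\<forall>t\<in>T'. \<exists>N. \<forall>i\<ge>N. \<forall>j\<ge>N. norm (f i t - f j t) < e / 4"
  proof
    fix t assume "t \<in> T'"
    then have "Cauchy (\<lambda>n. f n t)" using conv T'(1) convergent_Cauchy by blast
    then show "\<exists>N. \<forall>i\<ge>N. \<forall>j\<ge>N. norm (f i t - f j t) < e / 4"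
      using e CauchyD[of "\<lambda>n. f n t" "e / 4"] by simp
  qed
  then obtain N where N: "\<And>t i j. t \<in> T' \<Longrightarrow> i \<ge> N t \<Longrightarrow> j \<ge> N t \<Longrightarrow> norm (f i t - f j t) < e / 4"
    by metis
  define N0 where "N0 = Max (insert 0 (N ` T'))"
  have N0: "N t \<le> N0" if "t \<in> T'" for t using that T'(2) by (simp add: N0_def)
  show ?thesis
  proof (intro exI allI impI ballI)
    fix i j x assume i: "N0 \<le> i" and j: "N0 \<le> j" and x: "x \<in> K"
    obtain t where t: "t \<in> T'" "dist t x < \<delta>" using T'(3) x by auto
    then have tK: "t \<in> K" using T'(1) TK by blast
    have a: "norm (f n x - f n t) \<le> e / 4" for n
      using lip[OF tK x, of n] L\<delta>[of "dist t x"] t(2) by auto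
    have "norm (f i t - f j t) < e / 4"
      using N[OF t(1)] N0[OF t(1)] i j by simp
    moreover have "norm (f i x - f j x) \<le> norm (f i x - f i t) + norm (f i t - f j t) + norm (f j x - f j t)"
      by (smt (verit, best) norm_minus_commute norm_triangle_sub norm_diff_triangle_ineq norm_diff_triangle_le)
    ultimately show "norm (f i x - f j x) < e"
      using a[of i] a[of j] e by linarith
  qed
qed

text \<open>At each level k the averages with step \<open>\<eta> k\<close> are equibounded and
  equi-Lipschitz in n, hence uniformly Cauchy along a subsequence. One diagonal subsequence serves
  all levels, and the averaging error is at most \<open>K1 * \<eta> k\<close> uniformly in n. Only
  the Cauchy property is claimed, so the limit function need not be constructed here.\<close>

theorem Rellich_C1_box:
  fixes a b :: "'a::euclidean_space" and q B :: real and \<phi> :: "nat \<Rightarrow> 'a \<Rightarrow> complex"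
  assumes ne: "box a b \<noteq> {}" and q: "q > 2" "q * (real DIM('a) - 2) < 2 * real DIM('a)"
    and \<phi>: "\<And>n. C1_fun (\<phi> n)"
    and B: "\<And>n. integral (cbox a b) (\<lambda>x. (norm (\<phi> n x))\<^sup>2) + integral (cbox a b) (\<lambda>x. (gradsum (\<phi> n) x)\<^sup>2) \<le> B"
  obtains r :: "nat \<Rightarrow> nat" where "strict_mono r"
    "\<And>e. e > 0 \<Longrightarrow> \<exists>N. \<forall>i\<ge>N. \<forall>j\<ge>N. integral (cbox a b) (\<lambda>x. norm (\<phi> (r i) x - \<phi> (r j) x) powr q) < e"
proof -
  obtain m where m: "m \<ge> 2" and mq: "q \<le> real m * (q - real DIM('a) * (q - 2) / 2)"
    using subcritical_exponent[OF q] .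
  define c where "c = measure lborel (cbox a b)"
  have c0: "c > 0" using content_pos[OF ne m] by (simp add: c_def)
  define F where "F n = integral (cbox a b) (\<lambda>x. (norm (\<phi> n x))\<^sup>2)" for n
  define G where "G n = integral (cbox a b) (\<lambda>x. (gradsum (\<phi> n) x)\<^sup>2)" for n
  have F0: "F n \<ge> 0" and G0: "G n \<ge> 0" for n
    unfolding F_def G_def
    by (auto intro!: integral_nonneg integrable_continuous continuous_intros continuous_gradsum C1_fun_continuous \<phi>)
  have FB: "F n \<le> B" and GB: "G n \<le> B" for n
    using B[of n] F0[of n] G0[of n] by (auto simp: F_def G_def)
  define \<eta> :: "nat \<Rightarrow> real" where "\<eta> k = 1 / (real k + 2)" for k
  have \<eta>: "0 < \<eta> k" "\<eta> k \<le> 1 / 2" "\<eta> k \<le> 1" for k by (auto simp: \<eta>_def)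
  define S where "S k n = box_avg a b m (\<eta> k) (\<phi> n)" for k n
  define L where "L k = sqrt (B / (c * \<eta> k ^ (m * DIM('a))))" for k
  have den: "c * \<eta> k ^ (m * DIM('a)) > 0" for k using c0 \<eta> by simp
  have Sb: "norm (S k n x) \<le> L k" if "x \<in> cbox a b" for k n x
  proof -
    have "(norm (S k n x))\<^sup>2 \<le> F n / (c * \<eta> k ^ (m * DIM('a)))"
      using box_avg_bound[OF ne m \<phi> \<eta>(1,3) that] by (simp add: S_def F_def c_def)
    also have "\<dots> \<le> B / (c * \<eta> k ^ (m * DIM('a)))"
      using FB[of n] den[of k] by (simp add: divide_right_mono)
    finally show ?thesis unfolding L_def by (rule real_le_rsqrt)
  qed
  have SL: "norm (S k n y - S k n x) \<le> L k * dist x y" if "x \<in> cbox a b" "y \<in> cbox a b" for k n x y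
  proof -
    have "norm (S k n y - S k n x) \<le> norm (y - x) * sqrt (G n / (c * \<eta> k ^ (m * DIM('a))))"
      using box_avg_Lipschitz[OF ne m \<phi> \<eta>(1,3) that] by (simp add: S_def G_def c_def)
    also have "\<dots> \<le> norm (y - x) * L k"
      unfolding L_def using GB[of n] den[of k] by (intro mult_left_mono real_sqrt_le_mono divide_right_mono) auto
    finally show ?thesis by (simp add: dist_norm norm_minus_commute mult.commute)
  qed
  obtain T where T: "countable T" "T \<subseteq> cbox a b" "cbox a b \<subseteq> closure T"
    using separable[of "cbox a b"] by blast
  have "T \<noteq> {}" using T(3) ne box_subset_cbox[of a b] by auto
  define t where "t k = from_nat_into T k" for k
  have tT: "t k \<in> T" and tab: "t k \<in> cbox a b" for k
    using from_nat_into[OF \<open>T \<noteq> {}\<close>] T(2) by (auto simp: t_def)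
  \<comment> \<open>Pairs of a level and a point of the dense set are coded as one natural number,
    so that a single diagonal argument treats them all.\<close>
  have "bounded (range (\<lambda>n. S (fst (prod_decode k)) n (t (snd (prod_decode k)))))" for k
    unfolding bounded_iff using Sb[OF tab] by blast
  then obtain r :: "nat \<Rightarrow> nat" where r: "strict_mono r"
    and rc: "\<And>k. convergent (\<lambda>n. S (fst (prod_decode k)) (r n) (t (snd (prod_decode k))))"
    using pointwise_convergent_subseq[of "\<lambda>n k. S (fst (prod_decode k)) n (t (snd (prod_decode k)))"] by auto
  have conv: "convergent (\<lambda>n. S k (r n) x)" if xT: "x \<in> T" for k x
  proof -
    obtain l where l: "x = t l"
      using from_nat_into_surj[OF T(1) xT] by (auto simp: t_def)
    show ?thesis using rc[of "prod_encode (k, l)"] by (simp add: l)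
  qed
  define K1 where "K1 = (norm (b - a) * real m) powr q * 2 ^ DIM('a) * (1 / c) powr ((q - 2) / 2) * \<bar>B\<bar> powr (q / 2)"
  have K1: "K1 \<ge> 0" by (simp add: K1_def)
  have cS: "continuous_on A (S k n)" for A k n unfolding S_def by (rule continuous_box_avg[OF \<phi>])
  have cI: "(\<lambda>x. norm (\<phi> n x - S k n x) powr q) integrable_on cbox a b" for n k
    using q by (intro integrable_continuous continuous_on_powr' continuous_intros cS C1_fun_continuous \<phi>) auto
  have err: "integral (cbox a b) (\<lambda>x. norm (\<phi> n x - S k n x) powr q) \<le> K1 * \<eta> k" for n k
  proof -
    have "integral (cbox a b) (\<lambda>x. norm (\<phi> n x - S k n x) powr q)
      \<le> (norm (b - a) * real m) powr q * 2 ^ DIM('a) * (1 / c) powr ((q - 2) / 2) * \<eta> k powr q * G n powr (q / 2)"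
      using box_avg_error[OF ne m \<phi> \<eta>(1,2) q(1) mq] by (simp add: S_def G_def c_def)
    also have "\<dots> \<le> (norm (b - a) * real m) powr q * 2 ^ DIM('a) * (1 / c) powr ((q - 2) / 2) * \<eta> k * \<bar>B\<bar> powr (q / 2)"
    proof (intro mult_mono order_refl)
      show "\<eta> k powr q \<le> \<eta> k" using powr_mono'[of 1 q "\<eta> k"] q \<eta>[of k] by simp
      show "G n powr (q / 2) \<le> \<bar>B\<bar> powr (q / 2)" using GB[of n] G0[of n] q by (intro powr_mono2) auto
    qed (use \<eta>[of k] in auto)
    finally show ?thesis by (simp add: K1_def mult_ac)
  qed
  show ?thesis
  proof (rule that[OF r])
    fix e :: real assume e: "e > 0"
    \<comment> \<open>The level k is fixed first, so that both averaging errors together use less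
      than e/2; \<open>d\<close> and \<open>N\<close> are then chosen for this level.\<close>
    define A where "A = 4 powr q * 2 * K1 + 1"
    have A: "A > 0" using K1 by (simp add: A_def add_nonneg_pos)
    obtain k :: nat where k: "2 * A / e < real k" using reals_Archimedean2 by blast
    have "A * \<eta> k < e / 2"
    proof -
      have "2 * A < (real k + 2) * e" using k e by (simp add: pos_divide_less_eq algebra_simps)
      then show ?thesis by (simp add: \<eta>_def field_simps)
    qed
    then have Ak: "4 powr q * (2 * (K1 * \<eta> k)) < e / 2"
      using \<eta>[of k] by (simp add: A_def algebra_simps)
    define d where "d = min 1 (e / (2 * 4 powr q * c))"
    have d: "d > 0" "d \<le> 1" "d \<le> e / (2 * 4 powr q * c)" using e c0 by (auto simp: d_def)
    have dq: "4 powr q * (c * d powr q) \<le> e / 2"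
    proof -
      have "d powr q \<le> d" using powr_mono'[of 1 q d] q d by simp
      also have "\<dots> \<le> e / (2 * 4 powr q * c)" by (rule d)
      finally show ?thesis using c0 by (simp add: field_simps)
    qed
    obtain N where N: "\<And>i j x. i \<ge> N \<Longrightarrow> j \<ge> N \<Longrightarrow> x \<in> cbox a b \<Longrightarrow> norm (S k (r i) x - S k (r j) x) < d"
      using equi_Lipschitz_uniformly_Cauchy[OF compact_cbox T(3,2), of "\<lambda>n. S k (r n)" "L k" d] conv SL d(1) by blast
    show "\<exists>N. \<forall>i\<ge>N. \<forall>j\<ge>N. integral (cbox a b) (\<lambda>x. norm (\<phi> (r i) x - \<phi> (r j) x) powr q) < e"
    proof (intro exI allI impI)
      fix i j assume ij: "N \<le> i" "N \<le> j"
      let ?X = "\<lambda>x. norm (\<phi> (r i) x - S k (r i) x) powr q"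
      let ?Y = "\<lambda>x. norm (\<phi> (r j) x - S k (r j) x) powr q"
      let ?D = "\<lambda>x. norm (\<phi> (r i) x - \<phi> (r j) x) powr q"
      have "integral (cbox a b) ?D
        \<le> integral (cbox a b) (\<lambda>x. 4 powr q * (?X x + ?Y x + d powr q))"
      proof (rule integral_le)
        show "?D integrable_on cbox a b"
          using q by (intro integrable_continuous continuous_on_powr' continuous_intros C1_fun_continuous \<phi>) auto
        show "(\<lambda>x. 4 powr q * (?X x + ?Y x + d powr q)) integrable_on cbox a b"
          using q by (intro integrable_continuous continuous_on_powr' continuous_intros cS C1_fun_continuous \<phi>) auto
        fix x assume x: "x \<in> cbox a b"
        define X Y Z where "X = norm (\<phi> (r i) x - S k (r i) x)" "Y = norm (\<phi> (r j) x - S k (r j) x)"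
          "Z = norm (S k (r i) x - S k (r j) x)"
        have nn: "X \<ge> 0" "Y \<ge> 0" "Z \<ge> 0" by (simp_all add: X_Y_Z_def)
        have "\<phi> (r i) x - \<phi> (r j) x = (\<phi> (r i) x - S k (r i) x) - (\<phi> (r j) x - S k (r j) x) + (S k (r i) x - S k (r j) x)"
          by simp
        then have "norm (\<phi> (r i) x - \<phi> (r j) x) \<le> (X + Y) + Z"
          unfolding X_Y_Z_def by (metis norm_triangle_ineq norm_triangle_ineq4 add_right_mono order_trans)
        then have "?D x \<le> ((X + Y) + Z) powr q"
          using q by (intro powr_mono2) auto
        also have "\<dots> \<le> 4 powr q * (X powr q + Y powr q + Z powr q)"
          using q nn by (intro powr_add3_le) auto
        also have "\<dots> \<le> 4 powr q * (X powr q + Y powr q + d powr q)"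
          using N[OF ij x] nn q by (intro mult_left_mono add_left_mono powr_mono2) (auto simp: X_Y_Z_def)
        finally show "?D x \<le> 4 powr q * (?X x + ?Y x + d powr q)" by (simp add: X_Y_Z_def)
      qed
      also have "\<dots> = 4 powr q * (integral (cbox a b) ?X
          + integral (cbox a b) ?Y + c * d powr q)"
        using cI[of "r i" k] cI[of "r j" k]
        by (subst integral_mult_right, subst integral_add)
           (auto simp: integral_add integrable_const c_def intro!: integrable_add)
      also have "\<dots> \<le> 4 powr q * (K1 * \<eta> k + K1 * \<eta> k + c * d powr q)"
        by (intro mult_left_mono add_mono err) (use c0 in auto)
      also have "\<dots> = 4 powr q * (2 * (K1 * \<eta> k)) + 4 powr q * (c * d powr q)"
        by (simp add: algebra_simps)
      also have "\<dots> < e" using Ak dq by linarith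
      finally show "integral (cbox a b) ?D < e" .
    qed
  qed
qed

section \<open>Weak derivatives\<close>

lemma C1_funI:
  assumes "\<And>x. (\<phi> has_derivative D x) (at x)" "\<And>b. b \<in> Basis \<Longrightarrow> continuous_on UNIV (\<lambda>x. D x b)"
  shows "C1_fun \<phi>" and "pderiv_dir \<phi> b = (\<lambda>x. D x b)"
proof -
  have "frechet_derivative \<phi> (at x) = D x" for x
    using frechet_derivative_at[OF assms(1)] by simp
  then have *: "pderiv_dir \<phi> b = (\<lambda>x. D x b)" for b by (simp add: pderiv_dir_def fun_eq_iff)
  show "pderiv_dir \<phi> b = (\<lambda>x. D x b)" by (rule *)
  show "C1_fun \<phi>"
    unfolding C1_fun_def * using assms differentiable_def by blast
qed

lemma C1_fun_const [simp]: "C1_fun (\<lambda>x. k)"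
  by (rule C1_funI(1)[where D = "\<lambda>x v. 0"]) auto

lemma
  fixes \<phi> \<psi> :: "'a::euclidean_space \<Rightarrow> complex"
  assumes \<phi>: "C1_fun \<phi>" and \<psi>: "C1_fun \<psi>"
  shows C1_fun_add: "C1_fun (\<lambda>x. \<phi> x + \<psi> x)"
    and C1_fun_mult: "C1_fun (\<lambda>x. \<phi> x * \<psi> x)"
    and pderiv_dir_mult: "pderiv_dir (\<lambda>x. \<phi> x * \<psi> x) b = (\<lambda>x. \<phi> x * pderiv_dir \<psi> b x + pderiv_dir \<phi> b x * \<psi> x)"
    and C1_fun_divide: "(\<And>x. \<psi> x \<noteq> 0) \<Longrightarrow> C1_fun (\<lambda>x. \<phi> x / \<psi> x)"
proof -
  note d = C1_fun_has_derivative[OF \<phi>] C1_fun_has_derivative[OF \<psi>]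
  note cp = continuous_pderiv_dir[OF \<phi>, unfolded pderiv_dir_def [abs_def]]
    continuous_pderiv_dir[OF \<psi>, unfolded pderiv_dir_def [abs_def]]
  note c = C1_fun_continuous[OF \<phi>] C1_fun_continuous[OF \<psi>]
  show "C1_fun (\<lambda>x. \<phi> x + \<psi> x)"
    by (rule C1_funI(1)[OF has_derivative_add[OF d]]) (intro continuous_intros cp)
  show "C1_fun (\<lambda>x. \<phi> x * \<psi> x)"
    by (rule C1_funI(1)[OF has_derivative_mult[OF d]]) (intro continuous_intros cp c)
  show "pderiv_dir (\<lambda>x. \<phi> x * \<psi> x) b = (\<lambda>x. \<phi> x * pderiv_dir \<psi> b x + pderiv_dir \<phi> b x * \<psi> x)"
    unfolding pderiv_dir_def [abs_def] frechet_derivative_at[OF has_derivative_mult[OF d], symmetric] ..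
  show "C1_fun (\<lambda>x. \<phi> x / \<psi> x)" if nz: "\<And>x. \<psi> x \<noteq> 0"
    by (rule C1_funI(1)[OF has_derivative_divide'[OF d nz]]) (intro continuous_intros cp c, use nz in auto)
qed

lemma C1_fun_prod:
  assumes "finite I" "\<And>i. i \<in> I \<Longrightarrow> C1_fun (\<phi> i)"
  shows "C1_fun (\<lambda>x. \<Prod>i\<in>I. \<phi> i x)"
  using assms by (induction I rule: finite_induct) (auto intro: C1_fun_mult)

lemma C1_fun_ridge:
  assumes f: "\<And>t. (f has_real_derivative f' t) (at t)" and f': "continuous_on UNIV f'"
  shows "C1_fun (\<lambda>x::'a::euclidean_space. complex_of_real (f (x \<bullet> v)))"
proof (rule C1_funI(1)[where D = "\<lambda>x w. complex_of_real ((w \<bullet> v) * f' (x \<bullet> v))"])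
  fix x :: 'a
  have "((\<lambda>x. f (x \<bullet> v)) has_derivative (\<lambda>w. f' (x \<bullet> v) * (w \<bullet> v))) (at x)"
    by (rule has_derivative_compose[of "\<lambda>x. x \<bullet> v", OF _ f[unfolded has_field_derivative_def]])
       (auto intro!: derivative_eq_intros)
  then show "((\<lambda>x. complex_of_real (f (x \<bullet> v))) has_derivative (\<lambda>w. complex_of_real ((w \<bullet> v) * f' (x \<bullet> v)))) (at x)"
    by (auto intro!: derivative_eq_intros simp: mult.commute)
qed (intro continuous_intros continuous_on_compose2[OF f'], auto)

text \<open>The squared positive part is a C1 function that is positive exactly on the positive
  half-line; products of such factors give the cutoffs. At 0 the difference quotient is bounded by
  the absolute value of the increment.\<close>

lemma has_real_derivative_max_sq:
  "((\<lambda>t::real. (max 0 t)\<^sup>2) has_real_derivative 2 * max 0 t) (at t)"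
proof -
  consider "t > 0" | "t < 0" | "t = 0" by linarith
  then show ?thesis
  proof cases
    case 1
    have "((\<lambda>t::real. t\<^sup>2) has_real_derivative 2 * t) (at t)"
      by (auto intro!: derivative_eq_intros)
    then have "((\<lambda>t::real. (max 0 t)\<^sup>2) has_real_derivative 2 * t) (at t)"
      by (rule has_field_derivative_transform_within_open[of _ _ _ "{0<..}"]) (use 1 in auto)
    then show ?thesis using 1 by (simp add: max_def)
  next
    case 2
    have "((\<lambda>t::real. 0) has_real_derivative 0) (at t)" by simp
    then have "((\<lambda>t::real. (max 0 t)\<^sup>2) has_real_derivative 0) (at t)"
      by (rule has_field_derivative_transform_within_open[of _ _ _ "{..<0}"]) (use 2 in auto)
    then show ?thesis using 2 by (simp add: max_def)
  next
    case 3
    have "(\<lambda>h::real. (max 0 (0 + h))\<^sup>2 / h - 0) \<midarrow>0\<rightarrow> 0"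
    proof (rule Lim_null_comparison[where g = "\<lambda>h. \<bar>h\<bar>"])
      show "\<forall>\<^sub>F h::real in at 0. norm ((max 0 (0 + h))\<^sup>2 / h - 0) \<le> \<bar>h\<bar>"
        by (auto simp: max_def power2_eq_square intro!: always_eventually)
    qed (auto intro!: tendsto_eq_intros)
    then show ?thesis using 3 by (simp add: DERIV_def)
  qed
qed

lemma has_real_derivative_max_sq_affine:
  "((\<lambda>t::real. (max 0 (\<sigma> * t + k))\<^sup>2) has_real_derivative 2 * max 0 (\<sigma> * t + k) * \<sigma>) (at t)"
  by (rule DERIV_chain2[OF has_real_derivative_max_sq]) (auto intro!: derivative_eq_intros)

text \<open>A nonnegative \<open>C\<^sup>1\<close> function that is positive exactly on \<open>box c d\<close>; hence \<open>r * w / (1 + r * w)\<close>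
  increases to the indicator of the box as \<open>r\<close> tends to infinity. The products by \<open>1\<close> and \<open>- 1\<close> put both factors
  into the affine form of \<open>has_real_derivative_max_sq_affine\<close>.\<close>
definition box_weight :: "'a::euclidean_space \<Rightarrow> 'a \<Rightarrow> 'a \<Rightarrow> real" where
  "box_weight c d x = (\<Prod>i\<in>Basis. (max 0 (1 * (x \<bullet> i) + - (c \<bullet> i)))\<^sup>2 * (max 0 (- 1 * (x \<bullet> i) + d \<bullet> i))\<^sup>2)"

lemma box_weight_nonneg: "box_weight c d x \<ge> 0"
  unfolding box_weight_def by (intro prod_nonneg) auto

lemma box_weight_pos_iff: "box_weight c d x \<noteq> 0 \<longleftrightarrow> x \<in> box c d"
  unfolding box_weight_def by (auto simp: mem_box max_def)

text \<open>The denominator is at least 1, so the quotient is C1 and vanishes wherever the weight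
  does; the support stays in the closed box and is compact.\<close>

lemma box_bump:
  assumes "cbox c d \<subseteq> \<Omega>" "r \<ge> 0"
  shows "(\<lambda>x. complex_of_real (r * box_weight c d x / (1 + r * box_weight c d x))) \<in> test_fns \<Omega>"
proof -
  have P: "C1_fun (\<lambda>x. complex_of_real (box_weight c d x))"
    unfolding box_weight_def of_real_prod of_real_mult
    by (intro C1_fun_prod C1_fun_mult C1_fun_ridge[OF has_real_derivative_max_sq_affine] continuous_intros) auto
  have pos: "1 + r * box_weight c d x > 0" for x
    using assms box_weight_nonneg[of c d x] by (simp add: add_pos_nonneg)
  have nz: "1 + complex_of_real r * complex_of_real (box_weight c d x) \<noteq> 0" for x
    using pos[of x] by (metis of_real_1 of_real_add of_real_eq_0_iff of_real_mult less_irrefl)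
  have "C1_fun (\<lambda>x. complex_of_real r * complex_of_real (box_weight c d x)
        / (1 + complex_of_real r * complex_of_real (box_weight c d x)))"
    by (intro C1_fun_divide C1_fun_add C1_fun_mult C1_fun_const P nz)
  then have 1: "C1_fun (\<lambda>x. complex_of_real (r * box_weight c d x / (1 + r * box_weight c d x)))"
    by simp
  have sub: "{x. complex_of_real (r * box_weight c d x / (1 + r * box_weight c d x)) \<noteq> 0} \<subseteq> cbox c d"
    (is "?S \<subseteq> _")
  proof
    fix x assume "x \<in> ?S"
    then have "box_weight c d x \<noteq> 0" by auto
    then show "x \<in> cbox c d" using box_weight_pos_iff box_subset_cbox by blast
  qed
  have "closure ?S \<subseteq> \<Omega>"
    using closure_minimal[OF sub closed_cbox] assms(1) by blast
  moreover have "compact (closure ?S)"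
    unfolding compact_closure by (rule bounded_subset[OF bounded_cbox sub])
  ultimately show ?thesis
    unfolding test_fns_def using 1 by blast
qed

text \<open>The fundamental lemma of the calculus of variations. The cutoffs increase to the
  indicator of any box whose closure lies in the domain, so by dominated convergence the integral of
  \<open>g\<close> over it vanishes. Lebesgue differentiation along small boxes then gives the value
  zero almost everywhere.\<close>

lemma AE_zero_if_test_integrals_zero:
  fixes g :: "'a::euclidean_space \<Rightarrow> complex"
  assumes g: "integrable (lebesgue_on (box a b)) g"
    and z: "\<And>\<phi>. \<phi> \<in> test_fns (box a b) \<Longrightarrow> (LINT x|lebesgue_on (box a b). g x * \<phi> x) = 0"
  shows "AE x in lebesgue_on (box a b). g x = 0"
proof -
  let ?M = "lebesgue_on (box a b)"
  have box: "box a b \<inter> space lebesgue \<in> sets lebesgue" by simp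
  \<comment> \<open>Extension by zero, because the differentiation theorem concerns functions on the
    whole space.\<close>
  define f where "f x = indicator (box a b) x *\<^sub>R g x" for x
  have f: "integrable lebesgue f"
    using g unfolding f_def by (subst (asm) integrable_restrict_space) auto
  have f_on: "f integrable_on S" if "S \<in> sets lebesgue" for S
  proof -
    have "set_integrable lebesgue S f"
      using f that by (simp add: set_integrable_def integrable_mult_indicator)
    then show ?thesis using set_lebesgue_integral_eq_integral(1) by blast
  qed
  have box0: "integral (cbox c d) f = 0" if sub: "cbox c d \<subseteq> box a b" for c d
  proof -
    define \<phi> where "\<phi> n x = complex_of_real (real n * box_weight c d x / (1 + real n * box_weight c d x))" for n x
    have \<phi>: "\<phi> n \<in> test_fns (box a b)" for n
      unfolding \<phi>_def using box_bump[OF sub, of "real n"] by simp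
    have meas: "\<phi> n \<in> borel_measurable ?M" for n
    proof -
      have "continuous_on (box a b) (\<phi> n)" using \<phi>[of n] by (auto simp: test_fns_def intro: C1_fun_continuous)
      then show ?thesis by (intro continuous_imp_measurable_on_sets_lebesgue) auto
    qed
    have ind: "(indicator (box c d) :: 'a \<Rightarrow> complex) \<in> borel_measurable ?M"
      by (intro measurable_restrict_space1 borel_measurable_indicator) simp
    have "(\<lambda>n. LINT x|?M. g x * \<phi> n x) \<longlonglongrightarrow> (LINT x|?M. g x * indicator (box c d) x)"
    proof (rule integral_dominated_convergence[where w = "\<lambda>x. norm (g x)"])
      show "AE x in ?M. (\<lambda>n. g x * \<phi> n x) \<longlonglongrightarrow> g x * indicator (box c d) x"
      proof (intro AE_I2 tendsto_intros)
        fix x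
        show "(\<lambda>n. \<phi> n x) \<longlonglongrightarrow> indicator (box c d) x"
        proof (cases "x \<in> box c d")
          case False
          then have "box_weight c d x = 0" using box_weight_pos_iff by blast
          then show ?thesis using False by (simp add: \<phi>_def)
        next
          case True
          then have w: "box_weight c d x > 0"
            using box_weight_pos_iff[of c d x] box_weight_nonneg[of c d x] by simp
          have "(\<lambda>n. 1 - 1 / (1 + real n * box_weight c d x)) \<longlonglongrightarrow> 1 - 0"
            using w by (intro tendsto_diff tendsto_const tendsto_divide_0[OF tendsto_const]
                filterlim_at_top_imp_at_infinity filterlim_tendsto_add_at_top[OF tendsto_const]
                filterlim_at_top_mult_tendsto_pos[OF tendsto_const w] filterlim_real_sequentially)
          moreover have "1 - 1 / (1 + real n * box_weight c d x) = real n * box_weight c d x / (1 + real n * box_weight c d x)" for n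
          proof -
            have "1 + real n * box_weight c d x > 0" using w by (intro add_pos_nonneg) auto
            then show ?thesis by (simp add: diff_divide_eq_iff)
          qed
          ultimately have "(\<lambda>n. real n * box_weight c d x / (1 + real n * box_weight c d x)) \<longlonglongrightarrow> 1"
            by simp
          from tendsto_of_real[OF this, where ?'a = complex] show ?thesis
            using True by (simp add: \<phi>_def)
        qed
      qed
      show "AE x in ?M. norm (g x * \<phi> n x) \<le> norm (g x)" for n
      proof (intro AE_I2)
        fix x
        have "real n * box_weight c d x \<ge> 0" by (simp add: box_weight_nonneg)
        then have "norm (\<phi> n x) \<le> 1" unfolding \<phi>_def norm_of_real by (simp add: divide_le_eq)
        then show "norm (g x * \<phi> n x) \<le> norm (g x)"
          by (simp add: norm_mult mult_left_le)
      qed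
    qed (use g meas ind in auto)
    then have "(LINT x|?M. g x * indicator (box c d) x) = 0"
      using z[OF \<phi>] by (simp add: LIMSEQ_const_iff)
    moreover have "(LINT x|?M. g x * indicator (box c d) x) = (LINT x|lebesgue. indicator (box c d) x *\<^sub>R f x)"
      unfolding f_def by (subst integral_restrict_space) (auto intro!: Bochner_Integration.integral_cong simp: indicator_def)
    moreover have "(LINT x|lebesgue. indicator (box c d) x *\<^sub>R f x) = integral (box c d) f"
      using set_lebesgue_integral_eq_integral(2)[of "box c d" f] f
      by (simp add: set_integrable_def set_lebesgue_integral_def integrable_mult_indicator)
    ultimately show ?thesis by (simp add: integral_open_interval)
  qed
  obtain N where N: "negligible N"
    and lim: "\<And>x e. x \<notin> N \<Longrightarrow> 0 < e \<Longrightarrow> \<exists>d>0. \<forall>h. 0 < h \<and> h < d \<longrightarrow>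
         norm (integral (cbox x (x + h *\<^sub>R One)) f /\<^sub>R h ^ DIM('a) - f x) < e"
    using integrable_ccontinuous_explicit[of f] f_on by (metis lmeasurable_cbox fmeasurableD)
  have zero: "f x = 0" if x: "x \<in> box a b" "x \<notin> N" for x
  proof (rule ccontr)
    assume nz: "f x \<noteq> 0"
    obtain d where d: "d > 0" "\<And>h. 0 < h \<Longrightarrow> h < d \<Longrightarrow>
         norm (integral (cbox x (x + h *\<^sub>R One)) f /\<^sub>R h ^ DIM('a) - f x) < norm (f x)"
      using lim[OF x(2), of "norm (f x)"] nz by auto
    obtain e where e: "e > 0" "cball x e \<subseteq> box a b"
      using x(1) open_box open_contains_cball by metis
    \<comment> \<open>The side length is below the threshold \<open>d\<close> from differentiation,
      and DIM times the side is at most \<open>e\<close>, so that the l1 estimate keeps the box with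
      corner \<open>x\<close> inside the ball.\<close>
    define h where "h = min (d / 2) (e / real DIM('a))"
    have h: "0 < h" "h < d" "h * real DIM('a) \<le> e"
      using d(1) e(1) by (auto simp: h_def min_def field_simps)
    have "cbox x (x + h *\<^sub>R One) \<subseteq> cball x e"
    proof
      fix y assume y: "y \<in> cbox x (x + h *\<^sub>R One)"
      have "norm (y - x) \<le> (\<Sum>i\<in>Basis. \<bar>(y - x) \<bullet> i\<bar>)" by (rule norm_le_l1)
      also have "\<dots> \<le> (\<Sum>i\<in>(Basis::'a set). h)"
        using y by (intro sum_mono) (auto simp: mem_box inner_diff_left inner_add_left)
      also have "\<dots> \<le> e" using h(3) by (simp add: mult.commute)
      finally show "y \<in> cball x e" by (simp add: dist_norm norm_minus_commute)
    qed
    then have "integral (cbox x (x + h *\<^sub>R One)) f = 0"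
      using e(2) by (intro box0) blast
    then show False using d(2)[OF h(1,2)] by simp
  qed
  have "AE x in lebesgue. x \<notin> N"
    using N by (simp add: negligible_iff_null_sets AE_not_in)
  then have "AE x in lebesgue. x \<in> box a b \<longrightarrow> g x = 0"
    by eventually_elim (use zero in \<open>auto simp: f_def\<close>)
  then show ?thesis by (subst AE_restrict_space_iff) auto
qed

section \<open>Integration by parts against test functions\<close>

lemma pderiv_dir_eq_0_outside_support:
  assumes "x \<notin> closure {x. \<phi> x \<noteq> 0}"
  shows "pderiv_dir \<phi> b x = 0"
proof -
  define C where "C = closure {x. \<phi> x \<noteq> 0}"
  have C: "0 = \<phi> y" if "y \<in> - C" for y
    using that closure_subset[of "{x. \<phi> x \<noteq> 0}"] unfolding C_def by (metis (mono_tags) ComplD mem_Collect_eq subsetD)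
  have "open (- C)" "x \<in> - C" using assms by (auto simp: C_def)
  with C have "(\<phi> has_derivative (\<lambda>_. 0)) (at x)"
    by (intro has_derivative_transform_within_open[OF has_derivative_const[of 0]])
  then show ?thesis
    by (simp add: pderiv_dir_def frechet_derivative_at[symmetric])
qed

lemma C1_compact_support_bounds:
  fixes \<phi> :: "'a::euclidean_space \<Rightarrow> complex"
  assumes \<phi>: "C1_fun \<phi>" and K: "compact (closure {x. \<phi> x \<noteq> 0})"
  obtains B where "B \<ge> 0" "\<And>x. norm (\<phi> x) \<le> B" "\<And>x. gradsum \<phi> x \<le> B"
proof -
  let ?K = "closure {x. \<phi> x \<noteq> 0}"
  obtain B1 where B1: "\<And>x. x \<in> ?K \<Longrightarrow> norm (\<phi> x) \<le> B1"
    using compact_imp_bounded[OF compact_continuous_image[OF C1_fun_continuous[OF \<phi>] K]]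
    by (auto simp: bounded_iff)
  obtain B2 where B2: "\<And>x. x \<in> ?K \<Longrightarrow> norm (gradsum \<phi> x) \<le> B2"
    using compact_imp_bounded[OF compact_continuous_image[OF continuous_gradsum[OF \<phi>] K]]
    by (auto simp: bounded_iff)
  show ?thesis
  proof (rule that[of "\<bar>B1\<bar> + \<bar>B2\<bar>"])
    fix x
    show "norm (\<phi> x) \<le> \<bar>B1\<bar> + \<bar>B2\<bar>"
    proof (cases "x \<in> ?K")
      case False
      then have "\<phi> x = 0" using closure_subset[of "{x. \<phi> x \<noteq> 0}"] by blast
      then show ?thesis by simp
    qed (use B1 in force)
    show "gradsum \<phi> x \<le> \<bar>B1\<bar> + \<bar>B2\<bar>"
    proof (cases "x \<in> ?K")
      case False
      then show ?thesis by (simp add: gradsum_def pderiv_dir_eq_0_outside_support)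
    qed (use B2 in force)
  qed auto
qed

text \<open>By translation invariance every difference quotient has integral zero. The quotients
  converge pointwise to the partial derivative and are dominated by a multiple of the indicator of a
  ball, so the limit has integral zero as well; iterated integrals are avoided.\<close>

lemma integral_pderiv_dir_eq_0:
  fixes \<phi> :: "'a::euclidean_space \<Rightarrow> complex"
  assumes \<phi>: "C1_fun \<phi>" and K: "compact (closure {x. \<phi> x \<noteq> 0})" and b: "b \<in> Basis"
  shows "(LINT x|lborel. pderiv_dir \<phi> b x) = 0"
proof -
  obtain B where B: "B \<ge> 0" "\<And>x. norm (\<phi> x) \<le> B" "\<And>x. gradsum \<phi> x \<le> B"
    using C1_compact_support_bounds[OF \<phi> K] by blast
  obtain R where "\<forall>x\<in>closure {x. \<phi> x \<noteq> 0}. norm x \<le> R"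
    using compact_imp_bounded[OF K] unfolding bounded_iff by blast
  then have R: "\<And>x. \<phi> x \<noteq> 0 \<Longrightarrow> norm x \<le> R"
    using closure_subset[of "{x. \<phi> x \<noteq> 0}"] by blast
  define t where "t n = 1 / (real n + 1)" for n :: nat
  have t: "0 < t n" "t n \<le> 1" for n by (auto simp: t_def)
  have meas [measurable]: "\<phi> \<in> borel_measurable borel"
    by (rule borel_measurable_continuous_onI) (rule C1_fun_continuous[OF \<phi>])
  have measp [measurable]: "pderiv_dir \<phi> b \<in> borel_measurable borel"
    by (rule borel_measurable_continuous_onI) (rule continuous_pderiv_dir[OF \<phi> b])
  \<comment> \<open>The radius \<open>R + 1\<close> leaves room for shifts of the support by
    \<open>t n\<close>, which is at most 1.\<close>
  have ind: "integrable lborel (\<lambda>x. k * indicator (cball (0::'a) (R + 1)) x)" for k :: real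
    by (intro integrable_mult_right integrable_real_indicator emeasure_bounded_finite) auto
  have int\<phi>: "integrable lborel \<phi>"
  proof (rule Bochner_Integration.integrable_bound[OF ind[of B]])
    show "AE x in lborel. norm (\<phi> x) \<le> norm (B * indicator (cball 0 (R + 1)) x :: real)"
      using B R by (intro AE_I2) (force simp: indicator_def)
  qed auto
  have diff: "norm (\<phi> (x + s *\<^sub>R b) - \<phi> x) \<le> s * B" if s: "s \<ge> 0" for s x
  proof -
    have "norm (\<phi> (x + s *\<^sub>R b) - \<phi> (x + 0 *\<^sub>R b)) \<le> integral (cbox 0 s) (\<lambda>t. 1 * gradsum \<phi> (x + t *\<^sub>R b))"
      using b s by (intro C1_fun_path_bound[OF \<phi>, where g = "\<lambda>t. x + t *\<^sub>R b" and g' = "\<lambda>_. b"])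
        (auto intro!: derivative_eq_intros continuous_intros)
    also have "\<dots> \<le> integral (cbox 0 s) (\<lambda>t. B)"
      using B(3) by (intro integral_le integrable_continuous continuous_intros continuous_gradsum_comp[OF \<phi>]) auto
    finally show ?thesis using s by simp
  qed
  have lim: "(\<lambda>n. LINT x|lborel. (\<phi> (x + t n *\<^sub>R b) - \<phi> x) / t n) \<longlonglongrightarrow> (LINT x|lborel. pderiv_dir \<phi> b x)"
  proof (rule integral_dominated_convergence[where w = "\<lambda>x. B * indicator (cball 0 (R + 1)) x"])
    show "AE x in lborel. (\<lambda>n. (\<phi> (x + t n *\<^sub>R b) - \<phi> x) / t n) \<longlonglongrightarrow> pderiv_dir \<phi> b x"
    proof (rule AE_I2)
      fix x
      have "((\<lambda>s. \<phi> (x + s *\<^sub>R b)) has_vector_derivative pderiv_dir \<phi> b x) (at 0)"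
      proof -
        have "((\<lambda>s. x + s *\<^sub>R b) has_vector_derivative b) (at 0)"
          by (auto intro!: derivative_eq_intros)
        then have "(\<phi> \<circ> (\<lambda>s. x + s *\<^sub>R b) has_vector_derivative frechet_derivative \<phi> (at (x + 0 *\<^sub>R b)) b) (at 0)"
          by (rule vector_derivative_diff_chain_within[OF _ has_derivative_at_withinI[OF C1_fun_has_derivative[OF \<phi>]]])
        then show ?thesis by (simp add: o_def pderiv_dir_def)
      qed
      then have *: "((\<lambda>s. (\<phi> (x + s *\<^sub>R b) - \<phi> x) /\<^sub>R s) \<longlongrightarrow> pderiv_dir \<phi> b x) (at 0)"
      proof -
        assume "((\<lambda>s. \<phi> (x + s *\<^sub>R b)) has_vector_derivative pderiv_dir \<phi> b x) (at 0)"
        then have 0: "(\<lambda>s. norm (\<phi> (x + s *\<^sub>R b) - \<phi> x - s *\<^sub>R pderiv_dir \<phi> b x) / norm s) \<midarrow>0\<rightarrow> 0"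
          unfolding has_vector_derivative_def has_derivative_at by simp
        have "((\<lambda>s. (\<phi> (x + s *\<^sub>R b) - \<phi> x) /\<^sub>R s - pderiv_dir \<phi> b x) \<longlongrightarrow> 0) (at 0)"
        proof (rule Lim_null_comparison[OF _ 0])
          have "norm ((\<phi> (x + s *\<^sub>R b) - \<phi> x) /\<^sub>R s - pderiv_dir \<phi> b x)
            \<le> norm (\<phi> (x + s *\<^sub>R b) - \<phi> x - s *\<^sub>R pderiv_dir \<phi> b x) / norm s" if "s \<noteq> 0" for s
          proof -
            have "(\<phi> (x + s *\<^sub>R b) - \<phi> x) /\<^sub>R s - pderiv_dir \<phi> b x
                = (\<phi> (x + s *\<^sub>R b) - \<phi> x - s *\<^sub>R pderiv_dir \<phi> b x) /\<^sub>R s"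
              using that by (simp add: scaleR_diff_right)
            then show ?thesis by (simp add: divide_inverse mult.commute)
          qed
          then show "\<forall>\<^sub>F s in at 0. norm ((\<phi> (x + s *\<^sub>R b) - \<phi> x) /\<^sub>R s - pderiv_dir \<phi> b x)
            \<le> norm (\<phi> (x + s *\<^sub>R b) - \<phi> x - s *\<^sub>R pderiv_dir \<phi> b x) / norm s"
            by (auto simp: eventually_at_filter)
        qed
        then show ?thesis by (rule LIM_zero_cancel)
      qed
      have "t \<longlonglongrightarrow> 0"
        using LIMSEQ_inverse_real_of_nat by (simp add: t_def [abs_def] inverse_eq_divide add.commute)
      then have "filterlim t (at 0) sequentially"
        unfolding filterlim_at using t by (auto intro!: always_eventually simp: less_imp_neq[symmetric])
      from filterlim_compose[OF * this]
      show "(\<lambda>n. (\<phi> (x + t n *\<^sub>R b) - \<phi> x) / t n) \<longlonglongrightarrow> pderiv_dir \<phi> b x"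
        by (simp add: scaleR_conv_of_real divide_inverse mult.commute)
    qed
    show "AE x in lborel. norm ((\<phi> (x + t n *\<^sub>R b) - \<phi> x) / t n) \<le> B * indicator (cball 0 (R + 1)) x" for n
    proof (rule AE_I2)
      fix x
      show "norm ((\<phi> (x + t n *\<^sub>R b) - \<phi> x) / t n) \<le> B * indicator (cball 0 (R + 1)) x"
      proof (cases "x \<in> cball 0 (R + 1)")
        case True
        then show ?thesis using diff[of "t n" x] t[of n]
          by (simp add: norm_divide divide_le_eq mult.commute)
      next
        case False
        then have x: "norm x > R + 1" by simp
        have "norm (x + t n *\<^sub>R b) \<ge> norm x - norm (t n *\<^sub>R b)"
          using norm_triangle_ineq4[of "x + t n *\<^sub>R b" "t n *\<^sub>R b"] by simp
        then have "norm (x + t n *\<^sub>R b) > R" using x t[of n] b by simp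
        then have "\<phi> (x + t n *\<^sub>R b) = 0" "\<phi> x = 0" using R x by fastforce+
        then show ?thesis using False by simp
      qed
    qed
  qed (use ind in auto)
  have "(LINT x|lborel. (\<phi> (x + t n *\<^sub>R b) - \<phi> x) / t n) = 0" for n
  proof -
    have i1: "integrable lborel (\<lambda>x. \<phi> (t n *\<^sub>R b + x))" 
    proof -
      have "integrable (distr lborel borel ((+) (t n *\<^sub>R b))) \<phi>"
        using int\<phi> by (simp only: lborel_distr_plus)
      then show ?thesis by (subst (asm) integrable_distr_eq) auto
    qed
    have "(LINT x|lborel. \<phi> (t n *\<^sub>R b + x)) = (LINT x|lborel. \<phi> x)"
      by (subst (2) lborel_distr_plus[of "t n *\<^sub>R b", symmetric]) (simp add: integral_distr)
    then show ?thesis using i1 int\<phi> by (simp add: add.commute)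
  qed
  with lim have "(\<lambda>n. 0) \<longlonglongrightarrow> (LINT x|lborel. pderiv_dir \<phi> b x)" by (simp only:)
  then show ?thesis by (simp only: LIMSEQ_const_iff)
qed

text \<open>The bridge between the Lebesgue integrals over the open box in the definitions and the
  gauge integrals over the closed box in the C1 estimates.\<close>

lemma continuous_box_integrable:
  fixes f :: "'a::euclidean_space \<Rightarrow> 'b::euclidean_space"
  assumes "continuous_on (cbox a b) f"
  shows "integrable (lebesgue_on (box a b)) f"
    and "(LINT x|lebesgue_on (box a b). f x) = integral (cbox a b) f"
proof -
  have "set_integrable lebesgue (cbox a b) f"
    using absolutely_integrable_continuous[OF assms] .
  then have "set_integrable lebesgue (box a b) f"
    by (rule set_integrable_subset) (auto simp: box_subset_cbox)
  then show 1: "integrable (lebesgue_on (box a b)) f"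
    by (simp add: integrable_restrict_space set_integrable_def)
  show "(LINT x|lebesgue_on (box a b). f x) = integral (cbox a b) f"
    by (subst lebesgue_integral_eq_integral[OF 1]) (auto simp: integral_open_interval)
qed

lemma test_fns_bounded:
  assumes "\<phi> \<in> test_fns \<Omega>"
  obtains B where "\<And>x. norm (\<phi> x) \<le> B"
  using assms C1_compact_support_bounds unfolding test_fns_def by blast

lemma C1_fun_measurable:
  assumes "C1_fun \<phi>" "S \<in> sets lebesgue"
  shows "\<phi> \<in> borel_measurable (lebesgue_on S)"
  by (intro continuous_imp_measurable_on_sets_lebesgue C1_fun_continuous assms)

lemma pderiv_dir_measurable:
  assumes "C1_fun \<phi>" "S \<in> sets lebesgue" "b \<in> Basis"
  shows "pderiv_dir \<phi> b \<in> borel_measurable (lebesgue_on S)"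
  by (intro continuous_imp_measurable_on_sets_lebesgue continuous_pderiv_dir assms)

lemma integrable_mult_bounded:
  fixes g h :: "'a \<Rightarrow> complex"
  assumes "integrable M g" "h \<in> borel_measurable M" "\<And>x. norm (h x) \<le> B"
  shows "integrable M (\<lambda>x. g x * h x)"
proof (rule Bochner_Integration.integrable_bound)
  show "integrable M (\<lambda>x. B *\<^sub>R g x)" using assms by simp
  show "AE x in M. norm (g x * h x) \<le> norm (B *\<^sub>R g x)"
  proof (rule AE_I2)
    fix x
    have "norm (g x) * norm (h x) \<le> norm (g x) * \<bar>B\<bar>"
      using assms(3)[of x] by (intro mult_left_mono) auto
    then show "norm (g x * h x) \<le> norm (B *\<^sub>R g x)"
      by (simp add: norm_mult mult.commute)
  qed
qed (use assms in auto)

lemma test_fns_C1: "\<phi> \<in> test_fns \<Omega> \<Longrightarrow> C1_fun \<phi>"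
  unfolding test_fns_def by blast

lemma test_fns_compact: "\<phi> \<in> test_fns \<Omega> \<Longrightarrow> compact (closure {x. \<phi> x \<noteq> 0})"
  unfolding test_fns_def by blast

lemma integrable_mult_test_fn:
  assumes "integrable (lebesgue_on (box a b)) g" "\<phi> \<in> test_fns (box a b)"
  shows "integrable (lebesgue_on (box a b)) (\<lambda>x. g x * \<phi> x)"
proof -
  obtain B where "\<And>x. norm (\<phi> x) \<le> B" using test_fns_bounded[OF assms(2)] by blast
  then show ?thesis
    by (rule integrable_mult_bounded[OF assms(1) C1_fun_measurable[OF test_fns_C1[OF assms(2)]], rotated]) simp
qed

lemma test_fns_pderiv_bounded:
  assumes "\<phi> \<in> test_fns \<Omega>" "b \<in> Basis"
  obtains B where "\<And>x. norm (pderiv_dir \<phi> b x) \<le> B"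
proof -
  obtain B where B: "\<And>x. gradsum \<phi> x \<le> B"
    using C1_compact_support_bounds[OF test_fns_C1[OF assms(1)] test_fns_compact[OF assms(1)]] by metis
  have "norm (pderiv_dir \<phi> b x) \<le> B" for x
    using member_le_sum[of b Basis "\<lambda>b. norm (pderiv_dir \<phi> b x)"] assms(2) B[of x]
    by (simp add: gradsum_def)
  then show ?thesis by (rule that)
qed

lemma integrable_mult_test_fn_pderiv:
  assumes "integrable (lebesgue_on (box a b)) g" "\<phi> \<in> test_fns (box a b)" "i \<in> Basis"
  shows "integrable (lebesgue_on (box a b)) (\<lambda>x. g x * pderiv_dir \<phi> i x)"
proof -
  obtain B where "\<And>x. norm (pderiv_dir \<phi> i x) \<le> B" using test_fns_pderiv_bounded[OF assms(2,3)] by blast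
  then show ?thesis
    by (rule integrable_mult_bounded[OF assms(1) pderiv_dir_measurable[OF test_fns_C1[OF assms(2)] _ assms(3)], rotated]) simp
qed

text \<open>The product with a test function has compact support inside the box even though \<phi>
  need not vanish at the boundary; the integral of its derivative is zero, and the product rule
  splits it.\<close>

lemma has_weak_deriv_C1:
  assumes \<phi>: "C1_fun \<phi>" and i: "i \<in> Basis"
  shows "has_weak_deriv (box a b) \<phi> i (pderiv_dir \<phi> i)"
  unfolding has_weak_deriv_def
proof (intro conjI ballI)
  show "integrable (lebesgue_on (box a b)) (pderiv_dir \<phi> i)"
    by (intro continuous_box_integrable continuous_pderiv_dir \<phi> i)
  fix \<psi> :: "'a \<Rightarrow> complex"
  assume "\<psi> \<in> test_fns (box a b)"
  then have \<psi>: "C1_fun \<psi>" and K: "compact (closure {x. \<psi> x \<noteq> 0})" "closure {x. \<psi> x \<noteq> 0} \<subseteq> box a b"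
    by (auto simp: test_fns_def)
  define \<zeta> where "\<zeta> x = \<phi> x * \<psi> x" for x
  have \<zeta>: "C1_fun \<zeta>" unfolding \<zeta>_def [abs_def] by (rule C1_fun_mult[OF \<phi> \<psi>])
  have sub: "{x. \<zeta> x \<noteq> 0} \<subseteq> {x. \<psi> x \<noteq> 0}" by (auto simp: \<zeta>_def)
  have K\<zeta>: "compact (closure {x. \<zeta> x \<noteq> 0})"
    using K(1) bounded_subset[OF _ sub] by (simp add: compact_closure)
  have out: "pderiv_dir \<zeta> i x = 0" if "x \<notin> box a b" for x
    using that K(2) closure_mono[OF sub] by (intro pderiv_dir_eq_0_outside_support) blast
  have "pderiv_dir \<zeta> i \<in> borel_measurable lborel"
    using borel_measurable_continuous_onI[OF continuous_pderiv_dir[OF \<zeta> i]] by simp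
  then have "(LINT x|lebesgue. pderiv_dir \<zeta> i x) = 0"
    using integral_pderiv_dir_eq_0[OF \<zeta> K\<zeta> i] by (simp add: integral_completion)
  moreover have "(LINT x|lebesgue_on (box a b). pderiv_dir \<zeta> i x) = (LINT x|lebesgue. pderiv_dir \<zeta> i x)"
    using out by (subst integral_restrict_space) (auto intro!: Bochner_Integration.integral_cong simp: indicator_def)
  ultimately have "0 = (LINT x|lebesgue_on (box a b). pderiv_dir \<zeta> i x)" by simp
  also have "\<dots> = (LINT x|lebesgue_on (box a b). \<phi> x * pderiv_dir \<psi> i x + pderiv_dir \<phi> i x * \<psi> x)"
    by (simp only: \<zeta>_def [abs_def] pderiv_dir_mult[OF \<phi> \<psi>])
  also have "\<dots> = (LINT x|lebesgue_on (box a b). \<phi> x * pderiv_dir \<psi> i x) + (LINT x|lebesgue_on (box a b). pderiv_dir \<phi> i x * \<psi> x)"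
    by (intro Bochner_Integration.integral_add continuous_box_integrable continuous_intros
        continuous_pderiv_dir C1_fun_continuous \<phi> \<psi> i)
  finally show "(LINT x|lebesgue_on (box a b). \<phi> x * pderiv_dir \<psi> i x) = - (LINT x|lebesgue_on (box a b). pderiv_dir \<phi> i x * \<psi> x)"
    by (simp add: eq_neg_iff_add_eq_0)
qed

section \<open>Uniqueness and linearity of weak gradients\<close>

lemma has_weak_deriv_unique:
  assumes "has_weak_deriv (box a b) u i g" "has_weak_deriv (box a b) u i h"
  shows "AE x in lebesgue_on (box a b). g x = h x"
proof -
  have "AE x in lebesgue_on (box a b). g x - h x = 0"
  proof (rule AE_zero_if_test_integrals_zero)
    show "integrable (lebesgue_on (box a b)) (\<lambda>x. g x - h x)"
      using assms by (auto simp: has_weak_deriv_def)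
    fix \<phi> assume \<phi>: "\<phi> \<in> test_fns (box a b)"
    have "integrable (lebesgue_on (box a b)) (\<lambda>x. g x * \<phi> x)" "integrable (lebesgue_on (box a b)) (\<lambda>x. h x * \<phi> x)"
      using assms \<phi> by (auto simp: has_weak_deriv_def intro: integrable_mult_test_fn)
    moreover have "(LINT x|lebesgue_on (box a b). g x * \<phi> x) = (LINT x|lebesgue_on (box a b). h x * \<phi> x)"
      using assms \<phi> unfolding has_weak_deriv_def by (metis neg_equal_iff_equal)
    ultimately show "(LINT x|lebesgue_on (box a b). (g x - h x) * \<phi> x) = 0"
      by (simp add: left_diff_distrib)
  qed
  then show ?thesis by simp
qed

text \<open>Since \<open>wgrad\<close> is a Hilbert choice, uniqueness is what ties it to a weak
  derivative that is known explicitly.\<close>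

lemma wgrad_AE:
  assumes "has_weak_deriv (box a b) u i g"
  shows "AE x in lebesgue_on (box a b). wgrad (box a b) u i x = g x"
  unfolding wgrad_def by (rule has_weak_deriv_unique[OF someI[of "has_weak_deriv (box a b) u i"] assms]) (rule assms)

lemma has_weak_deriv_wgrad:
  assumes "has_weak_deriv \<Omega> u i g"
  shows "has_weak_deriv \<Omega> u i (wgrad \<Omega> u i)"
  unfolding wgrad_def by (rule someI[of "has_weak_deriv \<Omega> u i"]) (rule assms)

lemma in_L2_cong_AE:
  assumes "in_L2 \<Omega> g" "AE x in lebesgue_on \<Omega>. f x = g x" "f \<in> borel_measurable (lebesgue_on \<Omega>)"
  shows "in_L2 \<Omega> f"
  unfolding in_L2_def
proof
  show "integrable (lebesgue_on \<Omega>) (\<lambda>x. (norm (f x))\<^sup>2)"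
    by (rule integrable_cong_AE_imp[of _ "\<lambda>x. (norm (g x))\<^sup>2"])
       (use assms in \<open>auto simp: in_L2_def\<close>)
qed (rule assms(3))

text \<open>\<open>H1\<close> asks only that some weak derivative be square integrable; by
  uniqueness this passes to the chosen one.\<close>

lemma H1_wgrad:
  assumes "u \<in> H1 (box a b)" "i \<in> Basis"
  shows "has_weak_deriv (box a b) u i (wgrad (box a b) u i)" "in_L2 (box a b) (wgrad (box a b) u i)"
proof -
  obtain g where g: "has_weak_deriv (box a b) u i g" "in_L2 (box a b) g"
    using assms by (auto simp: H1_def)
  show 1: "has_weak_deriv (box a b) u i (wgrad (box a b) u i)"
    by (rule has_weak_deriv_wgrad[OF g(1)])
  show "in_L2 (box a b) (wgrad (box a b) u i)"
    using 1 by (intro in_L2_cong_AE[OF g(2) wgrad_AE[OF g(1)]]) (auto simp: has_weak_deriv_def)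
qed

lemma norm_add_sq_le: "(norm (x + y))\<^sup>2 \<le> 2 * (norm x)\<^sup>2 + 2 * (norm (y::'a::real_normed_vector))\<^sup>2"
proof -
  have "(norm (x + y))\<^sup>2 \<le> (norm x + norm y)\<^sup>2" by (intro power_mono norm_triangle_ineq) auto
  also have "\<dots> \<le> 2 * (norm x)\<^sup>2 + 2 * (norm y)\<^sup>2"
    using sum_squares_bound[of "norm x" "norm y"] by (simp add: power2_sum)
  finally show ?thesis .
qed

lemma in_L2_lincomb:
  assumes "in_L2 \<Omega> f" "in_L2 \<Omega> g"
  shows "in_L2 \<Omega> (\<lambda>x. c * f x + d * g x)"
  unfolding in_L2_def
proof
  show m: "(\<lambda>x. c * f x + d * g x) \<in> borel_measurable (lebesgue_on \<Omega>)"
    using assms by (auto simp: in_L2_def)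
  show "integrable (lebesgue_on \<Omega>) (\<lambda>x. (norm (c * f x + d * g x))\<^sup>2)"
  proof (rule Bochner_Integration.integrable_bound)
    show "integrable (lebesgue_on \<Omega>) (\<lambda>x. 2 * (norm c)\<^sup>2 * (norm (f x))\<^sup>2 + 2 * (norm d)\<^sup>2 * (norm (g x))\<^sup>2)"
      using assms by (auto simp: in_L2_def)
    show "AE x in lebesgue_on \<Omega>. norm ((norm (c * f x + d * g x))\<^sup>2) \<le> norm (2 * (norm c)\<^sup>2 * (norm (f x))\<^sup>2 + 2 * (norm d)\<^sup>2 * (norm (g x))\<^sup>2)"
    proof (rule AE_I2)
      fix x
      show "norm ((norm (c * f x + d * g x))\<^sup>2) \<le> norm (2 * (norm c)\<^sup>2 * (norm (f x))\<^sup>2 + 2 * (norm d)\<^sup>2 * (norm (g x))\<^sup>2)"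
        using norm_add_sq_le[of "c * f x" "d * g x"] by (simp add: norm_mult power_mult_distrib)
    qed
  qed (use m in auto)
qed

lemma in_L2_mult_integrable:
  assumes f: "in_L2 \<Omega> f" and g: "in_L2 \<Omega> g"
  shows "integrable (lebesgue_on \<Omega>) (\<lambda>x. norm (f x) * norm (g x))"
    and "integrable (lebesgue_on \<Omega>) (\<lambda>x. f x * g x)"
    and "integrable (lebesgue_on \<Omega>) (\<lambda>x. f x * cnj (g x))"
proof -
  have [measurable]: "f \<in> borel_measurable (lebesgue_on \<Omega>)" "g \<in> borel_measurable (lebesgue_on \<Omega>)"
    using assms by (auto simp: in_L2_def)
  have [measurable]: "(\<lambda>x. cnj (g x)) \<in> borel_measurable (lebesgue_on \<Omega>)"
    by (rule measurable_compose[OF _ borel_measurable_continuous_onI[OF continuous_on_cnj[OF continuous_on_id]]]) measurable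
  have s: "integrable (lebesgue_on \<Omega>) (\<lambda>x. (norm (f x))\<^sup>2 + (norm (g x))\<^sup>2)"
    using assms by (auto simp: in_L2_def)
  have *: "norm (f x) * norm (g x) \<le> (norm (f x))\<^sup>2 + (norm (g x))\<^sup>2" for x
    using sum_squares_bound[of "norm (f x)" "norm (g x)"] mult_nonneg_nonneg[OF norm_ge_zero[of "f x"] norm_ge_zero[of "g x"]]
    by linarith
  show "integrable (lebesgue_on \<Omega>) (\<lambda>x. norm (f x) * norm (g x))"
    by (rule Bochner_Integration.integrable_bound[OF s]) (use * in \<open>auto simp: norm_mult\<close>)
  show "integrable (lebesgue_on \<Omega>) (\<lambda>x. f x * g x)"
    by (rule Bochner_Integration.integrable_bound[OF s]) (use * in \<open>auto simp: norm_mult\<close>)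
  show "integrable (lebesgue_on \<Omega>) (\<lambda>x. f x * cnj (g x))"
    by (rule Bochner_Integration.integrable_bound[OF s]) (use * in \<open>auto simp: norm_mult\<close>)
qed

lemma in_L2_const: "in_L2 (box a b) (\<lambda>x. k)"
  unfolding in_L2_def by (auto intro!: continuous_box_integrable continuous_intros)

lemma in_L2_integrable:
  assumes "in_L2 (box a b) f"
  shows "integrable (lebesgue_on (box a b)) f"
  using in_L2_mult_integrable(2)[OF assms in_L2_const[of a b 1]] by simp

lemma L2_Cauchy_Schwarz:
  assumes f: "in_L2 \<Omega> f" and g: "in_L2 \<Omega> g"
  shows "(LINT x|lebesgue_on \<Omega>. norm (f x) * norm (g x))\<^sup>2 \<le> L2norm2 \<Omega> f * L2norm2 \<Omega> g"
    and "norm (L2ip \<Omega> f g) \<le> sqrt (L2norm2 \<Omega> f) * sqrt (L2norm2 \<Omega> g)"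
proof -
  let ?M = "lebesgue_on \<Omega>"
  have [measurable]: "f \<in> borel_measurable ?M" "g \<in> borel_measurable ?M"
    and if2: "integrable ?M (\<lambda>x. (norm (f x))\<^sup>2)" and ig2: "integrable ?M (\<lambda>x. (norm (g x))\<^sup>2)"
    using assms by (auto simp: in_L2_def)
  note fg = in_L2_mult_integrable(1)[OF f g]
  have "(\<integral>\<^sup>+x. ennreal (norm (f x)) * ennreal (norm (g x)) \<partial>?M)\<^sup>2
     \<le> (\<integral>\<^sup>+x. ennreal (norm (f x)) ^ 2 \<partial>?M) * (\<integral>\<^sup>+x. ennreal (norm (g x)) ^ 2 \<partial>?M)"
    by (rule Cauchy_Schwarz_nn_integral) auto
  then have "(ennreal (LINT x|?M. norm (f x) * norm (g x)))\<^sup>2 \<le> ennreal (L2norm2 \<Omega> f) * ennreal (L2norm2 \<Omega> g)"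
    unfolding L2norm2_def
    by (simp add: ennreal_mult[symmetric] ennreal_power nn_integral_eq_integral fg if2 ig2)
  then show 1: "(LINT x|?M. norm (f x) * norm (g x))\<^sup>2 \<le> L2norm2 \<Omega> f * L2norm2 \<Omega> g"
    by (simp add: ennreal_mult[symmetric] ennreal_power L2norm2_def)
  have "norm (L2ip \<Omega> f g) \<le> (LINT x|?M. norm (f x * cnj (g x)))"
    unfolding L2ip_def by (rule integral_norm_bound)
  also have "\<dots> = (LINT x|?M. norm (f x) * norm (g x))" by (simp add: norm_mult)
  also have "\<dots> \<le> sqrt (L2norm2 \<Omega> f * L2norm2 \<Omega> g)" using 1 by (rule real_le_rsqrt)
  finally show "norm (L2ip \<Omega> f g) \<le> sqrt (L2norm2 \<Omega> f) * sqrt (L2norm2 \<Omega> g)"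
    by (simp add: real_sqrt_mult)
qed

lemma has_weak_deriv_lincomb:
  assumes u: "in_L2 (box a b) u" "has_weak_deriv (box a b) u i g"
    and v: "in_L2 (box a b) v" "has_weak_deriv (box a b) v i h" and i: "i \<in> Basis"
  shows "has_weak_deriv (box a b) (\<lambda>x. c * u x + d * v x) i (\<lambda>x. c * g x + d * h x)"
  unfolding has_weak_deriv_def
proof (intro conjI ballI)
  let ?M = "lebesgue_on (box a b)"
  have gh: "integrable ?M g" "integrable ?M h" using u v by (auto simp: has_weak_deriv_def)
  then show "integrable ?M (\<lambda>x. c * g x + d * h x)" by auto
  fix \<phi> assume \<phi>: "\<phi> \<in> test_fns (box a b)"
  note i1 = integrable_mult_test_fn_pderiv[OF in_L2_integrable[OF u(1)] \<phi> i]
  note i2 = integrable_mult_test_fn_pderiv[OF in_L2_integrable[OF v(1)] \<phi> i]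
  note i3 = integrable_mult_test_fn[OF gh(1) \<phi>]
  note i4 = integrable_mult_test_fn[OF gh(2) \<phi>]
  have "(LINT x|?M. (c * u x + d * v x) * pderiv_dir \<phi> i x)
      = c * (LINT x|?M. u x * pderiv_dir \<phi> i x) + d * (LINT x|?M. v x * pderiv_dir \<phi> i x)"
    using i1 i2 by (simp add: distrib_right mult.assoc)
  also have "\<dots> = c * - (LINT x|?M. g x * \<phi> x) + d * - (LINT x|?M. h x * \<phi> x)"
    using u(2) v(2) \<phi> by (simp add: has_weak_deriv_def)
  also have "\<dots> = - (LINT x|?M. (c * g x + d * h x) * \<phi> x)"
    using i3 i4 by (simp add: distrib_right mult.assoc)
  finally show "(LINT x|?M. (c * u x + d * v x) * pderiv_dir \<phi> i x) = - (LINT x|?M. (c * g x + d * h x) * \<phi> x)" .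
qed

lemma H1_lincomb:
  assumes "u \<in> H1 (box a b)" "v \<in> H1 (box a b)"
  shows "(\<lambda>x. c * u x + d * v x) \<in> H1 (box a b)"
    and "i \<in> Basis \<Longrightarrow> AE x in lebesgue_on (box a b). wgrad (box a b) (\<lambda>x. c * u x + d * v x) i x
       = c * wgrad (box a b) u i x + d * wgrad (box a b) v i x"
proof -
  have L2: "in_L2 (box a b) u" "in_L2 (box a b) v" using assms by (auto simp: H1_def)
  note wd = has_weak_deriv_lincomb[OF L2(1) H1_wgrad(1)[OF assms(1)] L2(2) H1_wgrad(1)[OF assms(2)]]
  show "(\<lambda>x. c * u x + d * v x) \<in> H1 (box a b)"
    unfolding H1_def using L2 wd in_L2_lincomb[OF H1_wgrad(2)[OF assms(1)] H1_wgrad(2)[OF assms(2)]]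
    by (blast intro: in_L2_lincomb)
  show "AE x in lebesgue_on (box a b). wgrad (box a b) (\<lambda>x. c * u x + d * v x) i x
       = c * wgrad (box a b) u i x + d * wgrad (box a b) v i x" if "i \<in> Basis"
    by (rule wgrad_AE[OF wd]) (use that in auto)
qed

section \<open>Sesquilinear forms on $H^1$\<close>

text \<open>Estimates are carried out with the squared norm, which avoids square roots;
  \<open>H1dist\<close> is the root of its value at the difference.\<close>

definition H1sq :: "'a::euclidean_space set \<Rightarrow> ('a \<Rightarrow> complex) \<Rightarrow> real" where
  "H1sq \<Omega> u = L2norm2 \<Omega> u + grad_norm2 \<Omega> u"

lemma H1dist_eq: "H1dist \<Omega> u w = sqrt (H1sq \<Omega> (\<lambda>x. u x - w x))"
  by (simp add: H1dist_def H1sq_def)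

lemma grad_norm2_eq: "grad_norm2 \<Omega> u = (\<Sum>b\<in>Basis. L2norm2 \<Omega> (wgrad \<Omega> u b))"
  by (simp add: grad_norm2_def L2norm2_def)

lemma L2norm2_nonneg [simp]: "0 \<le> L2norm2 \<Omega> u"
  by (simp add: L2norm2_def)

lemma grad_norm2_nonneg [simp]: "0 \<le> grad_norm2 \<Omega> u"
  by (simp add: grad_norm2_eq sum_nonneg)

lemma H1sq_nonneg [simp]: "0 \<le> H1sq \<Omega> u"
  by (simp add: H1sq_def)

lemma L2norm2_le_H1sq: "L2norm2 \<Omega> u \<le> H1sq \<Omega> u"
  by (simp add: H1sq_def)

lemma grad_norm2_le_H1sq: "grad_norm2 \<Omega> u \<le> H1sq \<Omega> u"
  by (simp add: H1sq_def)

lemma L2norm2_wgrad_le: "b \<in> Basis \<Longrightarrow> L2norm2 \<Omega> (wgrad \<Omega> u b) \<le> grad_norm2 \<Omega> u"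
  unfolding grad_norm2_eq by (rule member_le_sum) auto

lemma in_L2_measurable: "in_L2 \<Omega> f \<Longrightarrow> f \<in> borel_measurable (lebesgue_on \<Omega>)"
  by (simp add: in_L2_def)

lemma in_L2_cnj: "in_L2 \<Omega> f \<Longrightarrow> in_L2 \<Omega> (\<lambda>x. cnj (f x))"
  unfolding in_L2_def
  by (auto intro: measurable_compose[OF _ borel_measurable_continuous_onI[OF continuous_on_cnj[OF continuous_on_id]]])

lemma in_L2_diff: "in_L2 \<Omega> f \<Longrightarrow> in_L2 \<Omega> g \<Longrightarrow> in_L2 \<Omega> (\<lambda>x. f x - g x)"
  using in_L2_lincomb[of \<Omega> f g 1 "-1"] by simp

lemma L2ip_lincomb_left:
  assumes "in_L2 \<Omega> u" "in_L2 \<Omega> v" "in_L2 \<Omega> w"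
  shows "L2ip \<Omega> (\<lambda>x. c * u x + d * v x) w = c * L2ip \<Omega> u w + d * L2ip \<Omega> v w"
  unfolding L2ip_def using in_L2_mult_integrable(3)[OF assms(1,3)] in_L2_mult_integrable(3)[OF assms(2,3)]
  by (simp add: distrib_right mult.assoc)

lemma L2ip_cnj: "L2ip \<Omega> f g = cnj (L2ip \<Omega> g f)"
proof -
  have "cnj (L2ip \<Omega> g f) = (LINT x|lebesgue_on \<Omega>. cnj (g x * cnj (f x)))"
    unfolding L2ip_def
    by (rule integral_bounded_linear'[OF bounded_linear_cnj bounded_linear_cnj, symmetric]) simp
  then show ?thesis by (simp add: L2ip_def mult.commute)
qed

lemma L2ip_self: "L2ip \<Omega> f f = complex_of_real (L2norm2 \<Omega> f)"
proof -
  have "L2ip \<Omega> f f = (LINT x|lebesgue_on \<Omega>. complex_of_real ((norm (f x))\<^sup>2))"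
    unfolding L2ip_def by (simp add: complex_norm_square[symmetric])
  then show ?thesis by (simp only: L2norm2_def integral_complex_of_real)
qed

lemma L2ip_cong_AE:
  assumes "AE x in lebesgue_on \<Omega>. f x = f' x" "f \<in> borel_measurable (lebesgue_on \<Omega>)" "f' \<in> borel_measurable (lebesgue_on \<Omega>)"
    and "g \<in> borel_measurable (lebesgue_on \<Omega>)"
  shows "L2ip \<Omega> f g = L2ip \<Omega> f' g"
proof -
  have [measurable]: "(\<lambda>x. cnj (g x)) \<in> borel_measurable (lebesgue_on \<Omega>)"
    using assms(4) by (rule measurable_compose[OF _ borel_measurable_continuous_onI[OF continuous_on_cnj[OF continuous_on_id]]])
  note [measurable] = assms(2-4)
  show ?thesis unfolding L2ip_def
    by (rule integral_cong_AE) (use assms(1) in auto)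
qed

lemma L2norm2_cong_AE:
  assumes "AE x in lebesgue_on \<Omega>. f x = f' x" "f \<in> borel_measurable (lebesgue_on \<Omega>)" "f' \<in> borel_measurable (lebesgue_on \<Omega>)"
  shows "L2norm2 \<Omega> f = L2norm2 \<Omega> f'"
proof -
  note [measurable] = assms(2-3)
  show ?thesis unfolding L2norm2_def
    by (rule integral_cong_AE) (use assms(1) in auto)
qed

lemma L2norm2_lincomb_le:
  assumes "in_L2 \<Omega> u" "in_L2 \<Omega> v"
  shows "L2norm2 \<Omega> (\<lambda>x. c * u x + d * v x) \<le> 2 * (norm c)\<^sup>2 * L2norm2 \<Omega> u + 2 * (norm d)\<^sup>2 * L2norm2 \<Omega> v"
proof -
  have "L2norm2 \<Omega> (\<lambda>x. c * u x + d * v x)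
     \<le> (LINT x|lebesgue_on \<Omega>. 2 * (norm c)\<^sup>2 * (norm (u x))\<^sup>2 + 2 * (norm d)\<^sup>2 * (norm (v x))\<^sup>2)"
    unfolding L2norm2_def
  proof (rule Bochner_Integration.integral_mono)
    show "(norm (c * u x + d * v x))\<^sup>2 \<le> 2 * (norm c)\<^sup>2 * (norm (u x))\<^sup>2 + 2 * (norm d)\<^sup>2 * (norm (v x))\<^sup>2" for x
      using norm_add_sq_le[of "c * u x" "d * v x"] by (simp add: norm_mult power_mult_distrib)
  qed (use assms in_L2_lincomb[OF assms] in \<open>auto simp: in_L2_def\<close>)
  also have "\<dots> = 2 * (norm c)\<^sup>2 * L2norm2 \<Omega> u + 2 * (norm d)\<^sup>2 * L2norm2 \<Omega> v"
    using assms by (simp add: in_L2_def L2norm2_def)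
  finally show ?thesis .
qed

lemma L2norm2_scale: "L2norm2 \<Omega> (\<lambda>x. c * u x) = (norm c)\<^sup>2 * L2norm2 \<Omega> u"
  by (simp add: L2norm2_def norm_mult power_mult_distrib)

lemma H1_in_L2: "u \<in> H1 \<Omega> \<Longrightarrow> in_L2 \<Omega> u"
  by (simp add: H1_def)

lemma H1_diff: "u \<in> H1 (box a b) \<Longrightarrow> v \<in> H1 (box a b) \<Longrightarrow> (\<lambda>x. u x - v x) \<in> H1 (box a b)"
  using H1_lincomb(1)[of u a b v 1 "-1"] by simp

lemma H1_scale: "u \<in> H1 (box a b) \<Longrightarrow> (\<lambda>x. c * u x) \<in> H1 (box a b)"
  using H1_lincomb(1)[of u a b u c 0] by simp

lemma wgrad_lincomb_facts:
  assumes "u \<in> H1 (box a b)" "v \<in> H1 (box a b)" "i \<in> Basis"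
  shows "in_L2 (box a b) (wgrad (box a b) (\<lambda>x. c * u x + d * v x) i)"
    "in_L2 (box a b) (\<lambda>x. c * wgrad (box a b) u i x + d * wgrad (box a b) v i x)"
    "AE x in lebesgue_on (box a b). wgrad (box a b) (\<lambda>x. c * u x + d * v x) i x = c * wgrad (box a b) u i x + d * wgrad (box a b) v i x"
  using H1_lincomb[OF assms(1,2)] H1_wgrad(2)[OF _ assms(3)] assms
  by (auto intro!: in_L2_lincomb)

lemma grad_ip_lincomb_left:
  assumes "u \<in> H1 (box a b)" "v \<in> H1 (box a b)" "w \<in> H1 (box a b)"
  shows "grad_ip (box a b) (\<lambda>x. c * u x + d * v x) w = c * grad_ip (box a b) u w + d * grad_ip (box a b) v w"
proof -
  have "L2ip (box a b) (wgrad (box a b) (\<lambda>x. c * u x + d * v x) i) (wgrad (box a b) w i)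
     = c * L2ip (box a b) (wgrad (box a b) u i) (wgrad (box a b) w i) + d * L2ip (box a b) (wgrad (box a b) v i) (wgrad (box a b) w i)"
    if i: "i \<in> Basis" for i
  proof -
    note wi = H1_wgrad(2)[OF assms(3) i]
    have "L2ip (box a b) (wgrad (box a b) (\<lambda>x. c * u x + d * v x) i) (wgrad (box a b) w i)
      = L2ip (box a b) (\<lambda>x. c * wgrad (box a b) u i x + d * wgrad (box a b) v i x) (wgrad (box a b) w i)"
      using wgrad_lincomb_facts[OF assms(1,2) i] wi by (intro L2ip_cong_AE in_L2_measurable)
    then show ?thesis
      using L2ip_lincomb_left[OF H1_wgrad(2)[OF assms(1) i] H1_wgrad(2)[OF assms(2) i] wi] by simp
  qed
  then show ?thesis
    unfolding grad_ip_def by (simp add: sum.distrib sum_distrib_left)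
qed

lemma grad_ip_cnj: "grad_ip \<Omega> f g = cnj (grad_ip \<Omega> g f)"
  unfolding grad_ip_def by (simp add: L2ip_cnj[symmetric])

lemma grad_ip_self: "grad_ip \<Omega> f f = complex_of_real (grad_norm2 \<Omega> f)"
  unfolding grad_ip_def grad_norm2_eq by (simp add: L2ip_self)

lemma grad_norm2_lincomb_le:
  assumes "u \<in> H1 (box a b)" "v \<in> H1 (box a b)"
  shows "grad_norm2 (box a b) (\<lambda>x. c * u x + d * v x) \<le> 2 * (norm c)\<^sup>2 * grad_norm2 (box a b) u + 2 * (norm d)\<^sup>2 * grad_norm2 (box a b) v"
proof -
  have "L2norm2 (box a b) (wgrad (box a b) (\<lambda>x. c * u x + d * v x) i)
    \<le> 2 * (norm c)\<^sup>2 * L2norm2 (box a b) (wgrad (box a b) u i) + 2 * (norm d)\<^sup>2 * L2norm2 (box a b) (wgrad (box a b) v i)"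
    if i: "i \<in> Basis" for i
  proof -
    have "L2norm2 (box a b) (wgrad (box a b) (\<lambda>x. c * u x + d * v x) i)
      = L2norm2 (box a b) (\<lambda>x. c * wgrad (box a b) u i x + d * wgrad (box a b) v i x)"
      using wgrad_lincomb_facts[OF assms i] by (intro L2norm2_cong_AE in_L2_measurable)
    then show ?thesis
      using L2norm2_lincomb_le[OF H1_wgrad(2)[OF assms(1) i] H1_wgrad(2)[OF assms(2) i]] by simp
  qed
  then have "grad_norm2 (box a b) (\<lambda>x. c * u x + d * v x)
    \<le> (\<Sum>i\<in>Basis. 2 * (norm c)\<^sup>2 * L2norm2 (box a b) (wgrad (box a b) u i) + 2 * (norm d)\<^sup>2 * L2norm2 (box a b) (wgrad (box a b) v i))"
    unfolding grad_norm2_eq by (intro sum_mono)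
  then show ?thesis
    by (simp add: grad_norm2_eq sum.distrib sum_distrib_left)
qed

text \<open>The factors 2 come from the elementary bound for the square of a sum, used in place of
  Minkowski's inequality. Such a weak triangle inequality is enough for the convergence arguments
  below.\<close>

lemma H1sq_lincomb_le:
  assumes "u \<in> H1 (box a b)" "v \<in> H1 (box a b)"
  shows "H1sq (box a b) (\<lambda>x. c * u x + d * v x) \<le> 2 * (norm c)\<^sup>2 * H1sq (box a b) u + 2 * (norm d)\<^sup>2 * H1sq (box a b) v"
  using grad_norm2_lincomb_le[OF assms, of c d] L2norm2_lincomb_le[OF H1_in_L2[OF assms(1)] H1_in_L2[OF assms(2)], of c d]
  by (simp add: H1sq_def distrib_left)

text \<open>Scaling, unlike addition, is needed with equality: the normalisation of the iterates and
  the eigenvalue bound depend on it. It follows from sesquilinearity, where the almost-everywhere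
  identity for \<open>wgrad\<close> is already absorbed.\<close>

lemma grad_norm2_scale:
  assumes "u \<in> H1 (box a b)"
  shows "grad_norm2 (box a b) (\<lambda>x. c * u x) = (norm c)\<^sup>2 * grad_norm2 (box a b) u"
proof -
  have "complex_of_real (grad_norm2 (box a b) (\<lambda>x. c * u x)) = grad_ip (box a b) (\<lambda>x. c * u x) (\<lambda>x. c * u x)"
    by (simp add: grad_ip_self)
  also have "\<dots> = c * grad_ip (box a b) u (\<lambda>x. c * u x)"
    using grad_ip_lincomb_left[OF assms assms H1_scale[OF assms], of c 0 c] by simp
  also have "grad_ip (box a b) u (\<lambda>x. c * u x) = cnj (c * grad_ip (box a b) u u)"
    using grad_ip_lincomb_left[OF assms assms assms, of c 0] by (subst grad_ip_cnj) simp
  also have "c * \<dots> = complex_of_real ((norm c)\<^sup>2 * grad_norm2 (box a b) u)"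
    by (simp add: grad_ip_self complex_norm_square[symmetric] mult.assoc[symmetric])
  finally show ?thesis by (simp only: of_real_eq_iff)
qed

lemma H1sq_scale:
  assumes "u \<in> H1 (box a b)"
  shows "H1sq (box a b) (\<lambda>x. c * u x) = (norm c)\<^sup>2 * H1sq (box a b) u"
  using grad_norm2_scale[OF assms] L2norm2_scale[of "box a b" c u] by (simp add: H1sq_def distrib_left)

lemma H1sq_triangle:
  assumes "u \<in> H1 (box a b)" "v \<in> H1 (box a b)" "w \<in> H1 (box a b)"
  shows "H1sq (box a b) (\<lambda>x. u x - w x)
     \<le> 2 * H1sq (box a b) (\<lambda>x. u x - v x) + 2 * H1sq (box a b) (\<lambda>x. v x - w x)"
  using H1sq_lincomb_le[OF H1_diff[OF assms(1,2)] H1_diff[OF assms(2,3)], of 1 1] by simp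

lemma H1sq_commute:
  assumes "u \<in> H1 (box a b)" "v \<in> H1 (box a b)"
  shows "H1sq (box a b) (\<lambda>x. u x - v x) = H1sq (box a b) (\<lambda>x. v x - u x)"
  using H1sq_scale[OF H1_diff[OF assms(2,1)], of "-1"] by simp

text \<open>Each partial derivative is estimated by the full H1 norm, hence the crude dimensional
  factor.\<close>

lemma norm_grad_ip_le:
  fixes a b :: "'a::euclidean_space"
  assumes "u \<in> H1 (box a b)" "v \<in> H1 (box a b)"
  shows "norm (grad_ip (box a b) u v) \<le> DIM('a) * (sqrt (H1sq (box a b) u) * sqrt (H1sq (box a b) v))"
proof -
  have "norm (L2ip (box a b) (wgrad (box a b) u i) (wgrad (box a b) v i)) \<le> sqrt (H1sq (box a b) u) * sqrt (H1sq (box a b) v)"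
    if i: "i \<in> Basis" for i
  proof -
    have "norm (L2ip (box a b) (wgrad (box a b) u i) (wgrad (box a b) v i))
      \<le> sqrt (L2norm2 (box a b) (wgrad (box a b) u i)) * sqrt (L2norm2 (box a b) (wgrad (box a b) v i))"
      by (rule L2_Cauchy_Schwarz(2)[OF H1_wgrad(2)[OF assms(1) i] H1_wgrad(2)[OF assms(2) i]])
    also have "\<dots> \<le> sqrt (H1sq (box a b) u) * sqrt (H1sq (box a b) v)"
      using order_trans[OF L2norm2_wgrad_le[OF i] grad_norm2_le_H1sq]
      by (intro mult_mono real_sqrt_le_mono) auto
    finally show ?thesis .
  qed
  then have "norm (grad_ip (box a b) u v) \<le> (\<Sum>i\<in>(Basis::'a set). sqrt (H1sq (box a b) u) * sqrt (H1sq (box a b) v))"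
    unfolding grad_ip_def by (intro sum_norm_le)
  then show ?thesis by simp
qed

text \<open>Fatou's lemma, which yields integrability of the limit together with the bound. It
  carries C1 inequalities to the closure and gives the tail estimate for completeness of L2.\<close>

lemma integral_limit_bound:
  fixes f :: "'a \<Rightarrow> real"
  assumes int: "\<And>n. integrable M (s n)" and nn: "\<And>n x. 0 \<le> s n x"
    and lim: "AE x in M. (\<lambda>n. s n x) \<longlonglongrightarrow> f x" and f: "f \<in> borel_measurable M" "\<And>x. 0 \<le> f x"
    and c: "\<And>n. (LINT x|M. s n x) \<le> c n" "c \<longlonglongrightarrow> L"
  shows "integrable M f \<and> (LINT x|M. f x) \<le> L"
proof -
  have L: "L \<ge> 0"
    using c(2) by (rule LIMSEQ_le_const) (meson c(1) nn Bochner_Integration.integral_nonneg order_trans)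
  have "AE x in M. ennreal (f x) = liminf (\<lambda>n. ennreal (s n x))"
    using lim
  proof eventually_elim
    case (elim x)
    show ?case using lim_imp_Liminf[OF _ tendsto_ennrealI[OF elim]] by simp
  qed
  then have "(\<integral>\<^sup>+x. ennreal (f x) \<partial>M) = (\<integral>\<^sup>+x. liminf (\<lambda>n. ennreal (s n x)) \<partial>M)"
    by (rule nn_integral_cong_AE)
  also have "\<dots> \<le> liminf (\<lambda>n. \<integral>\<^sup>+x. ennreal (s n x) \<partial>M)"
    using int by (intro nn_integral_liminf) auto
  also have "\<dots> = liminf (\<lambda>n. ennreal (LINT x|M. s n x))"
    using int nn by (simp add: nn_integral_eq_integral)
  also have "\<dots> \<le> liminf (\<lambda>n. ennreal (c n))"
    using c(1) by (intro Liminf_mono always_eventually allI ennreal_leI)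
  also have "\<dots> = ennreal L"
    using c(2) by (intro lim_imp_Liminf tendsto_ennrealI) auto
  finally have *: "(\<integral>\<^sup>+x. ennreal (f x) \<partial>M) \<le> ennreal L" .
  have i: "integrable M f"
    using f * by (intro integrableI_nonneg) (auto simp: top.extremum_strict order_le_less_trans[OF _ ennreal_less_top])
  then show ?thesis
    using * f(2) L by (simp add: nn_integral_eq_integral)
qed

section \<open>The space with boundary conditions\<close>

text \<open>The approximating class inside \<open>Xsp\<close>. All later arguments use only that it
  is a linear space of C1 functions, which holds for both boundary conditions.\<close>

definition Xcore :: "bcond \<Rightarrow> 'a::euclidean_space \<Rightarrow> 'a \<Rightarrow> ('a \<Rightarrow> complex) set" where
  "Xcore bc a b = (case bc of Dirichlet \<Rightarrow> test_fns (box a b) | Periodic \<Rightarrow> periodic_C1 a b)"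

lemma Xcore_C1: "\<phi> \<in> Xcore bc a b \<Longrightarrow> C1_fun \<phi>"
  unfolding Xcore_def by (cases bc) (simp_all add: test_fns_C1 periodic_C1_def)

lemma C1_fun_lincomb: "C1_fun \<phi> \<Longrightarrow> C1_fun \<psi> \<Longrightarrow> C1_fun (\<lambda>x. c * \<phi> x + d * \<psi> x)"
  by (intro C1_fun_add C1_fun_mult C1_fun_const)

lemma test_fns_lincomb:
  assumes "\<phi> \<in> test_fns \<Omega>" "\<psi> \<in> test_fns \<Omega>"
  shows "(\<lambda>x. c * \<phi> x + d * \<psi> x) \<in> test_fns \<Omega>"
proof -
  define A where "A = {x. \<phi> x \<noteq> 0}"
  define B where "B = {x. \<psi> x \<noteq> 0}"
  have sub: "{x. c * \<phi> x + d * \<psi> x \<noteq> 0} \<subseteq> A \<union> B" by (auto simp: A_def B_def)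
  have A: "bounded A" "closure A \<subseteq> \<Omega>" and B: "bounded B" "closure B \<subseteq> \<Omega>"
    using assms unfolding test_fns_def A_def B_def compact_closure by blast+
  have "bounded {x. c * \<phi> x + d * \<psi> x \<noteq> 0}"
    using sub A(1) B(1) bounded_Un bounded_subset by metis
  moreover have "closure {x. c * \<phi> x + d * \<psi> x \<noteq> 0} \<subseteq> \<Omega>"
    using closure_mono[OF sub] A(2) B(2) unfolding closure_Un by blast
  ultimately show ?thesis
    using C1_fun_lincomb[OF test_fns_C1[OF assms(1)] test_fns_C1[OF assms(2)]]
    unfolding test_fns_def compact_closure by blast
qed

lemma Xcore_lincomb:
  assumes "\<phi> \<in> Xcore bc a b" "\<psi> \<in> Xcore bc a b"
  shows "(\<lambda>x. c * \<phi> x + d * \<psi> x) \<in> Xcore bc a b"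
  using assms unfolding Xcore_def
  by (cases bc) (auto simp: test_fns_lincomb periodic_C1_def C1_fun_lincomb)

lemma C1_fun_in_L2:
  assumes "C1_fun \<phi>"
  shows "in_L2 (box a b) \<phi>" and "i \<in> Basis \<Longrightarrow> in_L2 (box a b) (pderiv_dir \<phi> i)"
proof -
  show "in_L2 (box a b) \<phi>"
    unfolding in_L2_def
    by (intro conjI C1_fun_measurable continuous_box_integrable continuous_intros C1_fun_continuous assms) auto
  show "in_L2 (box a b) (pderiv_dir \<phi> i)" if "i \<in> Basis"
    unfolding in_L2_def
    by (intro conjI pderiv_dir_measurable continuous_box_integrable continuous_intros continuous_pderiv_dir assms that) auto
qed

lemma C1_fun_in_H1: "C1_fun \<phi> \<Longrightarrow> \<phi> \<in> H1 (box a b)"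
  unfolding H1_def using C1_fun_in_L2 has_weak_deriv_C1 by blast

text \<open>Cauchy-Schwarz for finite sums compares the sum of the partial derivatives with the
  Euclidean norm at the cost of the dimension; classical and weak gradients agree almost
  everywhere.\<close>

lemma C1_fun_norms:
  fixes \<phi> :: "'a::euclidean_space \<Rightarrow> complex"
  assumes "C1_fun \<phi>"
  shows "integral (cbox a b) (\<lambda>x. (norm (\<phi> x))\<^sup>2) + integral (cbox a b) (\<lambda>x. (gradsum \<phi> x)\<^sup>2)
     \<le> DIM('a) * H1sq (box a b) \<phi>"
proof -
  let ?M = "lebesgue_on (box a b)"
  have 1: "integral (cbox a b) (\<lambda>x. (norm (\<phi> x))\<^sup>2) = L2norm2 (box a b) \<phi>"
    unfolding L2norm2_def
    by (intro continuous_box_integrable(2)[symmetric] continuous_intros C1_fun_continuous assms)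
  have ip: "integrable ?M (\<lambda>x. (norm (pderiv_dir \<phi> i x))\<^sup>2)" if "i \<in> Basis" for i
    using C1_fun_in_L2(2)[OF assms that] by (simp add: in_L2_def)
  have "integral (cbox a b) (\<lambda>x. (gradsum \<phi> x)\<^sup>2) = (LINT x|?M. (gradsum \<phi> x)\<^sup>2)"
    by (intro continuous_box_integrable(2)[symmetric] continuous_intros continuous_gradsum assms)
  also have "\<dots> \<le> (LINT x|?M. DIM('a) * (\<Sum>i\<in>Basis. (norm (pderiv_dir \<phi> i x))\<^sup>2))"
  proof (rule Bochner_Integration.integral_mono)
    show "integrable ?M (\<lambda>x. (gradsum \<phi> x)\<^sup>2)"
      by (intro continuous_box_integrable continuous_intros continuous_gradsum assms)
    show "integrable ?M (\<lambda>x. DIM('a) * (\<Sum>i\<in>Basis. (norm (pderiv_dir \<phi> i x))\<^sup>2))"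
      using ip by auto
    show "(gradsum \<phi> x)\<^sup>2 \<le> DIM('a) * (\<Sum>i\<in>Basis. (norm (pderiv_dir \<phi> i x))\<^sup>2)" for x
      unfolding gradsum_def
      using sum_squared_le_sum_of_squares[of "\<lambda>i. norm (pderiv_dir \<phi> i x)" Basis] by (simp add: mult.commute)
  qed
  also have "\<dots> = DIM('a) * (\<Sum>i\<in>Basis. L2norm2 (box a b) (pderiv_dir \<phi> i))"
    using ip by (simp add: L2norm2_def)
  also have "(\<Sum>i\<in>Basis. L2norm2 (box a b) (pderiv_dir \<phi> i)) = grad_norm2 (box a b) \<phi>"
    unfolding grad_norm2_eq
  proof (intro sum.cong refl)
    fix i :: 'a assume i: "i \<in> Basis"
    show "L2norm2 (box a b) (pderiv_dir \<phi> i) = L2norm2 (box a b) (wgrad (box a b) \<phi> i)"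
      using wgrad_AE[OF has_weak_deriv_C1[OF assms i, of a b]] C1_fun_in_L2(2)[OF assms i, of a b]
        H1_wgrad(2)[OF C1_fun_in_H1[OF assms] i, of a b]
      by (intro L2norm2_cong_AE in_L2_measurable) (auto elim: eventually_mono)
  qed
  finally have 2: "integral (cbox a b) (\<lambda>x. (gradsum \<phi> x)\<^sup>2) \<le> DIM('a) * grad_norm2 (box a b) \<phi>" .
  have "1 * L2norm2 (box a b) \<phi> \<le> DIM('a) * L2norm2 (box a b) \<phi>"
    using DIM_positive[where 'a = 'a] by (intro mult_right_mono) (auto simp: Suc_le_eq)
  then show ?thesis
    using 1 2 by (simp add: H1sq_def distrib_left)
qed

lemma Xsp_H1: "u \<in> Xsp bc a b \<Longrightarrow> u \<in> H1 (box a b)"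
  by (simp add: Xsp_def)

lemma Xsp_approx:
  assumes "u \<in> Xsp bc a b" "e > 0"
  obtains \<phi> where "\<phi> \<in> Xcore bc a b" "H1sq (box a b) (\<lambda>x. u x - \<phi> x) < e"
proof -
  obtain \<phi> where \<phi>: "\<And>k. \<phi> k \<in> Xcore bc a b" "(\<lambda>k. H1dist (box a b) u (\<phi> k)) \<longlonglongrightarrow> 0"
    using assms(1) unfolding Xsp_def Xcore_def by blast
  have "\<forall>\<^sub>F k in sequentially. H1dist (box a b) u (\<phi> k) < sqrt e"
    using \<phi>(2) assms(2) by (intro order_tendstoD(2)) auto
  then obtain k where "H1dist (box a b) u (\<phi> k) < sqrt e"
    by (auto simp: eventually_sequentially)
  then show ?thesis using that[OF \<phi>(1)] by (simp add: H1dist_eq)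
qed

lemma Xsp_approx_seq:
  assumes "\<And>n. u n \<in> Xsp bc a b"
  obtains \<phi> :: "nat \<Rightarrow> 'a::euclidean_space \<Rightarrow> complex"
  where "\<And>n. \<phi> n \<in> Xcore bc a b" "\<And>n. H1sq (box a b) (\<lambda>x. u n x - \<phi> n x) < 1 / (real n + 1)"
proof -
  have "\<exists>\<phi>. \<phi> \<in> Xcore bc a b \<and> H1sq (box a b) (\<lambda>x. u n x - \<phi> x) < 1 / (real n + 1)" for n
    by (rule Xsp_approx[OF assms, of "1 / (real n + 1)" n]) auto
  then show ?thesis using that by metis
qed

lemma inverse_Suc_tendsto_0: "(\<lambda>n. k / (real n + 1)) \<longlonglongrightarrow> 0"
proof -
  have "(\<lambda>n. k * inverse (real (Suc n))) \<longlonglongrightarrow> k * 0"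
    by (intro tendsto_intros LIMSEQ_inverse_real_of_nat)
  then show ?thesis by (simp add: divide_inverse add.commute)
qed

lemma XspI:
  assumes "u \<in> H1 (box a b)" "\<And>n. \<phi> n \<in> Xcore bc a b" "(\<lambda>n. H1sq (box a b) (\<lambda>x. u x - \<phi> n x)) \<longlonglongrightarrow> 0"
  shows "u \<in> Xsp bc a b"
  unfolding Xsp_def Xcore_def[symmetric] mem_Collect_eq
  using assms tendsto_real_sqrt[OF assms(3)] by (auto simp: H1dist_eq)

lemma Xcore_Xsp: "\<phi> \<in> Xcore bc a b \<Longrightarrow> \<phi> \<in> Xsp bc a b"
  using H1sq_scale[OF C1_fun_in_H1[OF Xcore_C1, of \<phi> bc a b], where c = 0]
  by (intro XspI[of _ _ _ "\<lambda>_. \<phi>"] C1_fun_in_H1[OF Xcore_C1]) auto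

lemma Xsp_lincomb:
  assumes u: "u \<in> Xsp bc a b" and v: "v \<in> Xsp bc a b"
  shows "(\<lambda>x. c * u x + d * v x) \<in> Xsp bc a b"
proof -
  obtain \<phi> where \<phi>: "\<And>n. \<phi> n \<in> Xcore bc a b" "\<And>n. H1sq (box a b) (\<lambda>x. u x - \<phi> n x) < 1 / (real n + 1)"
    using Xsp_approx_seq[of "\<lambda>_. u"] u by metis
  obtain \<psi> where \<psi>: "\<And>n. \<psi> n \<in> Xcore bc a b" "\<And>n. H1sq (box a b) (\<lambda>x. v x - \<psi> n x) < 1 / (real n + 1)"
    using Xsp_approx_seq[of "\<lambda>_. v"] v by metis
  let ?K = "2 * (norm c)\<^sup>2 + 2 * (norm d)\<^sup>2"
  show ?thesis
  proof (rule XspI)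
    show "(\<lambda>x. c * u x + d * v x) \<in> H1 (box a b)"
      by (intro H1_lincomb Xsp_H1[OF u] Xsp_H1[OF v])
    show "(\<lambda>x. c * \<phi> n x + d * \<psi> n x) \<in> Xcore bc a b" for n
      by (intro Xcore_lincomb \<phi> \<psi>)
    show "(\<lambda>n. H1sq (box a b) (\<lambda>x. c * u x + d * v x - (c * \<phi> n x + d * \<psi> n x))) \<longlonglongrightarrow> 0"
    proof (rule Lim_null_comparison[OF _ inverse_Suc_tendsto_0[of ?K]], intro always_eventually allI)
      fix n
      have eq: "c * u x + d * v x - (c * \<phi> n x + d * \<psi> n x) = c * (u x - \<phi> n x) + d * (v x - \<psi> n x)" for x
        by (simp add: algebra_simps)
      have "H1sq (box a b) (\<lambda>x. c * (u x - \<phi> n x) + d * (v x - \<psi> n x))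
        \<le> 2 * (norm c)\<^sup>2 * H1sq (box a b) (\<lambda>x. u x - \<phi> n x) + 2 * (norm d)\<^sup>2 * H1sq (box a b) (\<lambda>x. v x - \<psi> n x)"
        by (intro H1sq_lincomb_le H1_diff Xsp_H1[OF u] Xsp_H1[OF v] C1_fun_in_H1 Xcore_C1[OF \<phi>(1)] Xcore_C1[OF \<psi>(1)])
      also have "\<dots> \<le> 2 * (norm c)\<^sup>2 * (1 / (real n + 1)) + 2 * (norm d)\<^sup>2 * (1 / (real n + 1))"
        using less_imp_le[OF \<phi>(2)[of n]] less_imp_le[OF \<psi>(2)[of n]] by (intro add_mono mult_left_mono) auto
      also have "\<dots> = ?K / (real n + 1)" by (simp add: add_divide_distrib)
      finally show "norm (H1sq (box a b) (\<lambda>x. c * u x + d * v x - (c * \<phi> n x + d * \<psi> n x))) \<le> ?K / (real n + 1)"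
        unfolding eq by simp
    qed
  qed
qed

lemma Xsp_diff: "u \<in> Xsp bc a b \<Longrightarrow> v \<in> Xsp bc a b \<Longrightarrow> (\<lambda>x. u x - v x) \<in> Xsp bc a b"
  using Xsp_lincomb[of u bc a b v 1 "-1"] by simp

lemma Xsp_scale: "u \<in> Xsp bc a b \<Longrightarrow> (\<lambda>x. c * u x) \<in> Xsp bc a b"
  using Xsp_lincomb[of u bc a b u c 0] by simp

section \<open>Sobolev inequality and Rellich compactness for the closure\<close>

lemma measurable_norm_powr:
  fixes f :: "'a \<Rightarrow> complex"
  shows "f \<in> borel_measurable M \<Longrightarrow> (\<lambda>x. norm (f x) powr q) \<in> borel_measurable M"
  by measurable

text \<open>A subsequence of C1 approximants converges almost everywhere, and Fatou's lemma passes
  the C1 inequality to the limit, including the integrability of the q-th power.\<close>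

theorem Xsp_Sobolev:
  fixes a b :: "'a::euclidean_space" and q :: real
  assumes ne: "box a b \<noteq> {}" and q: "q > 2" "q * (real DIM('a) - 2) < 2 * real DIM('a)"
  obtains K where "K > 0" "\<And>u. u \<in> Xsp bc a b \<Longrightarrow> integrable (lebesgue_on (box a b)) (\<lambda>x. norm (u x) powr q)"
    "\<And>u. u \<in> Xsp bc a b \<Longrightarrow> (LINT x|lebesgue_on (box a b). norm (u x) powr q) \<le> K * H1sq (box a b) u powr (q / 2)"
proof -
  let ?M = "lebesgue_on (box a b)"
  obtain K where K: "K > 0" "\<And>\<phi>. C1_fun \<phi> \<Longrightarrow> integral (cbox a b) (\<lambda>x. norm (\<phi> x) powr q)
      \<le> K * (integral (cbox a b) (\<lambda>x. (norm (\<phi> x))\<^sup>2) + integral (cbox a b) (\<lambda>x. (gradsum \<phi> x)\<^sup>2)) powr (q / 2)"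
    using Sobolev_C1_box[OF ne q] by blast
  \<comment> \<open>The summand \<open>2 * 0\<close> is the limit of the approximation error
    \<open>2 * (1 / (real (r n) + 1))\<close> inside the bound.\<close>
  have main: "integrable ?M (\<lambda>x. norm (u x) powr q) \<and>
      (LINT x|?M. norm (u x) powr q) \<le> K * (DIM('a) * (2 * H1sq (box a b) u + 2 * 0)) powr (q / 2)"
    if u: "u \<in> Xsp bc a b" for u
  proof -
    obtain \<phi> where \<phi>: "\<And>n. \<phi> n \<in> Xcore bc a b" "\<And>n. H1sq (box a b) (\<lambda>x. u x - \<phi> n x) < 1 / (real n + 1)"
      using Xsp_approx_seq[of "\<lambda>_. u"] u by metis
    note C1 = Xcore_C1[OF \<phi>(1)]
    have uH: "u \<in> H1 (box a b)" by (rule Xsp_H1[OF u])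
    have d: "in_L2 (box a b) (\<lambda>x. u x - \<phi> n x)" for n
      by (intro in_L2_diff H1_in_L2[OF uH] C1_fun_in_L2 C1)
    have "(\<lambda>n. L2norm2 (box a b) (\<lambda>x. u x - \<phi> n x)) \<longlonglongrightarrow> 0"
      by (rule Lim_null_comparison[OF _ inverse_Suc_tendsto_0[of 1]])
        (auto intro!: always_eventually order_trans[OF L2norm2_le_H1sq] less_imp_le[OF \<phi>(2)])
    then have "(\<lambda>n. LINT x|?M. norm ((norm (u x - \<phi> n x))\<^sup>2)) \<longlonglongrightarrow> 0"
      by (simp add: L2norm2_def)
    from tendsto_L1_AE_subseq[OF _ this] d obtain r :: "nat \<Rightarrow> nat" where r: "strict_mono r"
      and AE: "AE x in ?M. (\<lambda>n. (norm (u x - \<phi> (r n) x))\<^sup>2) \<longlonglongrightarrow> 0"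
      by (auto simp: in_L2_def)
    show ?thesis
    proof (rule integral_limit_bound)
      show "integrable ?M (\<lambda>x. norm (\<phi> (r n) x) powr q)" for n
        using q by (intro continuous_box_integrable continuous_on_powr' continuous_intros C1_fun_continuous C1) auto
      show "AE x in ?M. (\<lambda>n. norm (\<phi> (r n) x) powr q) \<longlonglongrightarrow> norm (u x) powr q"
        using AE
      proof eventually_elim
        case (elim x)
        have "(\<lambda>n. sqrt ((norm (u x - \<phi> (r n) x))\<^sup>2)) \<longlonglongrightarrow> sqrt 0"
          by (intro tendsto_real_sqrt elim)
        then have "(\<lambda>n. u x - \<phi> (r n) x) \<longlonglongrightarrow> 0"
          by (simp add: tendsto_norm_zero_iff)
        then have "(\<lambda>n. u x - (u x - \<phi> (r n) x)) \<longlonglongrightarrow> u x - 0"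
          by (intro tendsto_intros)
        then show ?case
          using q by (intro tendsto_powr' tendsto_norm tendsto_const) auto
      qed
      show "(\<lambda>x. norm (u x) powr q) \<in> borel_measurable ?M"
        by (intro measurable_norm_powr in_L2_measurable H1_in_L2[OF uH])
      show "(LINT x|?M. norm (\<phi> (r n) x) powr q) \<le> K * (DIM('a) * (2 * H1sq (box a b) u + 2 * (1 / (real (r n) + 1)))) powr (q / 2)" for n
      proof -
        have "(LINT x|?M. norm (\<phi> (r n) x) powr q) = integral (cbox a b) (\<lambda>x. norm (\<phi> (r n) x) powr q)"
          using q by (intro continuous_box_integrable continuous_on_powr' continuous_intros C1_fun_continuous C1) auto
        also have "\<dots> \<le> K * (integral (cbox a b) (\<lambda>x. (norm (\<phi> (r n) x))\<^sup>2) + integral (cbox a b) (\<lambda>x. (gradsum (\<phi> (r n)) x)\<^sup>2)) powr (q / 2)"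
          by (rule K(2)[OF C1])
        also have "\<dots> \<le> K * (DIM('a) * H1sq (box a b) (\<phi> (r n))) powr (q / 2)"
          using K(1) q C1_fun_norms[OF C1]
          by (intro mult_left_mono powr_mono2 add_nonneg_nonneg integral_nonneg integrable_continuous continuous_intros
             C1_fun_continuous C1 continuous_gradsum) auto
        also have "\<dots> \<le> K * (DIM('a) * (2 * H1sq (box a b) u + 2 * (1 / (real (r n) + 1)))) powr (q / 2)"
        proof -
          have "H1sq (box a b) (\<lambda>x. 1 * u x + (-1) * (u x - \<phi> (r n) x)) \<le> 2 * H1sq (box a b) u + 2 * H1sq (box a b) (\<lambda>x. u x - \<phi> (r n) x)"
            using H1sq_lincomb_le[OF uH H1_diff[OF uH C1_fun_in_H1[OF C1]], of 1 "-1"] by simp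
          then have "H1sq (box a b) (\<phi> (r n)) \<le> 2 * H1sq (box a b) u + 2 * (1 / (real (r n) + 1))"
            using \<phi>(2)[of "r n"] by simp
          then show ?thesis
            using K(1) q by (intro mult_left_mono powr_mono2) auto
        qed
        finally show ?thesis .
      qed
      have "(\<lambda>n. 1 / (real (r n) + 1)) \<longlonglongrightarrow> 0"
        using LIMSEQ_subseq_LIMSEQ[OF inverse_Suc_tendsto_0[of 1] r] by (simp add: o_def)
      then show "(\<lambda>n. K * (DIM('a) * (2 * H1sq (box a b) u + 2 * (1 / (real (r n) + 1)))) powr (q / 2))
         \<longlonglongrightarrow> K * (DIM('a) * (2 * H1sq (box a b) u + 2 * 0)) powr (q / 2)"
        by (intro tendsto_intros tendsto_powr' disjI2 conjI always_eventually allI) (use q in auto)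
    qed auto
  qed
  show ?thesis
  proof (rule that)
    show "K * (DIM('a) * 2) powr (q / 2) > 0" using K(1) by simp
    fix u assume u: "u \<in> Xsp bc a b"
    show "integrable ?M (\<lambda>x. norm (u x) powr q)" using main[OF u] by simp
    have "(DIM('a) * (2 * H1sq (box a b) u + 2 * 0)) powr (q / 2) = ((DIM('a) * 2) * H1sq (box a b) u) powr (q / 2)"
      by (simp add: mult.assoc)
    also have "\<dots> = (DIM('a) * 2) powr (q / 2) * H1sq (box a b) u powr (q / 2)"
      by (rule powr_mult)
    finally show "(LINT x|?M. norm (u x) powr q) \<le> K * (DIM('a) * 2) powr (q / 2) * H1sq (box a b) u powr (q / 2)"
      using main[OF u] by (simp only: mult.assoc)
  qed
qed

text \<open>Each \<open>u n\<close> is replaced by a C1 function at squared H1 distance below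
  1/(n+1). The C1 compactness theorem selects the subsequence, and the Sobolev inequality turns the
  replacement errors into vanishing L^q errors.\<close>

theorem Xsp_Rellich:
  fixes a b :: "'a::euclidean_space" and q B :: real
  assumes ne: "box a b \<noteq> {}" and q: "q > 2" "q * (real DIM('a) - 2) < 2 * real DIM('a)"
    and u: "\<And>n. u n \<in> Xsp bc a b" and B: "\<And>n. H1sq (box a b) (u n) \<le> B"
  obtains r :: "nat \<Rightarrow> nat" where "strict_mono r"
    "\<And>e. e > 0 \<Longrightarrow> \<exists>N. \<forall>i\<ge>N. \<forall>j\<ge>N. (LINT x|lebesgue_on (box a b). norm (u (r i) x - u (r j) x) powr q) < e"
proof -
  let ?M = "lebesgue_on (box a b)"
  obtain K where K: "K > 0" "\<And>u. u \<in> Xsp bc a b \<Longrightarrow> integrable ?M (\<lambda>x. norm (u x) powr q)"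
    "\<And>u. u \<in> Xsp bc a b \<Longrightarrow> (LINT x|?M. norm (u x) powr q) \<le> K * H1sq (box a b) u powr (q / 2)"
    using Xsp_Sobolev[OF ne q] by blast
  obtain \<phi> where \<phi>: "\<And>n. \<phi> n \<in> Xcore bc a b" "\<And>n. H1sq (box a b) (\<lambda>x. u n x - \<phi> n x) < 1 / (real n + 1)"
    using Xsp_approx_seq[of u, OF u] by metis
  note C1 = Xcore_C1[OF \<phi>(1)]
  have uX: "(\<lambda>x. u n x - \<phi> n x) \<in> Xsp bc a b" for n by (intro Xsp_diff u Xcore_Xsp \<phi>)
  have "H1sq (box a b) (\<phi> n) \<le> 2 * B + 2" for n
  proof -
    have "H1sq (box a b) (\<lambda>x. 1 * u n x + (-1) * (u n x - \<phi> n x)) \<le> 2 * H1sq (box a b) (u n) + 2 * H1sq (box a b) (\<lambda>x. u n x - \<phi> n x)"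
      using H1sq_lincomb_le[OF Xsp_H1[OF u[of n]] Xsp_H1[OF uX[of n]], of 1 "-1"] by simp
    then have "H1sq (box a b) (\<phi> n) \<le> 2 * H1sq (box a b) (u n) + 2 * H1sq (box a b) (\<lambda>x. u n x - \<phi> n x)"
      by simp
    moreover have "1 / (real n + 1) \<le> 1" by simp
    ultimately show ?thesis using \<phi>(2)[of n] B[of n] by linarith
  qed
  then have "DIM('a) * H1sq (box a b) (\<phi> n) \<le> DIM('a) * (2 * B + 2)" for n
    by (intro mult_left_mono) auto
  note bd = order_trans[OF C1_fun_norms[OF C1] this]
  obtain r :: "nat \<Rightarrow> nat" where r: "strict_mono r"
    and Cr: "\<And>e. e > 0 \<Longrightarrow> \<exists>N. \<forall>i\<ge>N. \<forall>j\<ge>N. integral (cbox a b) (\<lambda>x. norm (\<phi> (r i) x - \<phi> (r j) x) powr q) < e"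
    by (rule Rellich_C1_box[where \<phi> = \<phi>, OF ne q C1 bd]) (rule that)
  have err: "(LINT x|?M. norm (u (r n) x - \<phi> (r n) x) powr q) \<le> K / (real n + 1)" for n
  proof -
    have "(LINT x|?M. norm (u (r n) x - \<phi> (r n) x) powr q) \<le> K * H1sq (box a b) (\<lambda>x. u (r n) x - \<phi> (r n) x) powr (q / 2)"
      by (rule K(3)[OF uX])
    also have "\<dots> \<le> K * (1 / (real n + 1))"
    proof (rule mult_left_mono)
      \<comment> \<open>A strictly increasing index satisfies \<open>r n \<ge> n\<close>, so the
        errors still decay along the subsequence.\<close>
      have "1 / (real (r n) + 1) \<le> 1 / (real n + 1)"
        using seq_suble[OF r, of n] by (simp add: frac_le)
      then have h: "H1sq (box a b) (\<lambda>x. u (r n) x - \<phi> (r n) x) \<le> 1 / (real n + 1)"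
        using \<phi>(2)[of "r n"] by linarith
      have "H1sq (box a b) (\<lambda>x. u (r n) x - \<phi> (r n) x) powr (q / 2) \<le> (1 / (real n + 1)) powr (q / 2)"
        using h q by (intro powr_mono2) auto
      also have "\<dots> \<le> (1 / (real n + 1)) powr 1"
        using q by (intro powr_mono') auto
      finally show "H1sq (box a b) (\<lambda>x. u (r n) x - \<phi> (r n) x) powr (q / 2) \<le> 1 / (real n + 1)" by simp
    qed (use K in simp)
    finally show ?thesis by simp
  qed
  show ?thesis
  proof (rule that[OF r])
    fix e :: real assume e: "e > 0"
    define e' where "e' = e / (4 * 4 powr q)"
    have e': "e' > 0" using e by (simp add: e'_def)
    obtain N1 where N1: "\<And>i j. i \<ge> N1 \<Longrightarrow> j \<ge> N1 \<Longrightarrow> integral (cbox a b) (\<lambda>x. norm (\<phi> (r i) x - \<phi> (r j) x) powr q) < e'"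
      using Cr[OF e'] by blast
    obtain N2 where N2: "\<And>i. i \<ge> N2 \<Longrightarrow> K / (real i + 1) < e'"
      using order_tendstoD(2)[OF inverse_Suc_tendsto_0[of K] e'] by (auto simp: eventually_sequentially)
    show "\<exists>N. \<forall>i\<ge>N. \<forall>j\<ge>N. (LINT x|?M. norm (u (r i) x - u (r j) x) powr q) < e"
    proof (intro exI allI impI)
      fix i j assume "max N1 N2 \<le> i" "max N1 N2 \<le> j"
      then have ij: "N1 \<le> i" "N1 \<le> j" "N2 \<le> i" "N2 \<le> j" by auto
      let ?X = "\<lambda>x. norm (u (r i) x - \<phi> (r i) x) powr q"
      let ?Y = "\<lambda>x. norm (u (r j) x - \<phi> (r j) x) powr q"
      let ?Z = "\<lambda>x. norm (\<phi> (r i) x - \<phi> (r j) x) powr q"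
      let ?D = "\<lambda>x. norm (u (r i) x - u (r j) x) powr q"
      have int\<phi>: "integrable ?M ?Z"
        using q by (intro continuous_box_integrable continuous_on_powr' continuous_intros C1_fun_continuous C1) auto
      have eq\<phi>: "(LINT x|?M. ?Z x) = integral (cbox a b) ?Z"
        using q by (intro continuous_box_integrable continuous_on_powr' continuous_intros C1_fun_continuous C1) auto
      have "(LINT x|?M. ?D x)
        \<le> (LINT x|?M. 4 powr q * (?X x + ?Y x + ?Z x))"
      proof (rule Bochner_Integration.integral_mono)
        show "integrable ?M ?D"
          by (intro K(2) Xsp_diff u)
        show "integrable ?M (\<lambda>x. 4 powr q * (?X x + ?Y x + ?Z x))"
          by (intro integrable_mult_right Bochner_Integration.integrable_add K(2) uX int\<phi>)
        fix x
        have "u (r i) x - u (r j) x = (u (r i) x - \<phi> (r i) x) - (u (r j) x - \<phi> (r j) x) + (\<phi> (r i) x - \<phi> (r j) x)" by simp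
        then have "norm (u (r i) x - u (r j) x) \<le> norm (u (r i) x - \<phi> (r i) x) + norm (u (r j) x - \<phi> (r j) x) + norm (\<phi> (r i) x - \<phi> (r j) x)"
          by (metis norm_triangle_ineq norm_triangle_ineq4 add_right_mono order_trans)
        then have "?D x
           \<le> (norm (u (r i) x - \<phi> (r i) x) + norm (u (r j) x - \<phi> (r j) x) + norm (\<phi> (r i) x - \<phi> (r j) x)) powr q"
          using q by (intro powr_mono2) auto
        also have "\<dots> \<le> 4 powr q * (?X x + ?Y x + ?Z x)"
          using q by (intro powr_add3_le) auto
        finally show "?D x \<le> 4 powr q * (?X x + ?Y x + ?Z x)" .
      qed
      also have "\<dots> = 4 powr q * ((LINT x|?M. ?X x) + (LINT x|?M. ?Y x)
             + (LINT x|?M. ?Z x))"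
        using K(2)[OF uX] int\<phi> by simp
      also have "\<dots> \<le> 4 powr q * (e' + e' + e')"
        using order_trans[OF err less_imp_le[OF N2[OF ij(3)]]] order_trans[OF err less_imp_le[OF N2[OF ij(4)]]]
          less_imp_le[OF N1[OF ij(1,2)]]
        by (intro mult_left_mono add_mono) (auto simp: eq\<phi>)
      also have "\<dots> < e" using e by (simp add: e'_def)
      finally show "(LINT x|?M. ?D x) < e" .
    qed
  qed
qed

section \<open>Completeness of L2 and of the space with boundary conditions\<close>

text \<open>On a bounded box an L2 Cauchy sequence is Cauchy in L1 and hence has a subsequence that
  is Cauchy almost everywhere. Fatou's lemma along this subsequence bounds the L2 distance of the
  whole tail to its pointwise limit.\<close>

lemma L2_complete:
  fixes a b :: "'a::euclidean_space" and f :: "nat \<Rightarrow> 'a \<Rightarrow> complex"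
  assumes f: "\<And>n. in_L2 (box a b) (f n)"
    and C: "\<And>e. e > 0 \<Longrightarrow> \<exists>N. \<forall>i\<ge>N. \<forall>j\<ge>N. L2norm2 (box a b) (\<lambda>x. f i x - f j x) < e"
  obtains g where "in_L2 (box a b) g" "(\<lambda>n. L2norm2 (box a b) (\<lambda>x. f n x - g x)) \<longlonglongrightarrow> 0"
proof -
  let ?M = "lebesgue_on (box a b)"
  define v where "v = L2norm2 (box a b) (\<lambda>x::'a. 1)"
  have v: "v \<ge> 0" by (simp add: v_def)
  have L1: "(LINT x|?M. norm (f i x - f j x)) \<le> sqrt (L2norm2 (box a b) (\<lambda>x. f i x - f j x)) * sqrt v" for i j
  proof -
    have "(LINT x|?M. norm (f i x - f j x))\<^sup>2 \<le> L2norm2 (box a b) (\<lambda>x. f i x - f j x) * v"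
      using L2_Cauchy_Schwarz(1)[OF in_L2_diff[OF f f] in_L2_const[of a b 1], of i j] by (simp add: v_def)
    then show ?thesis by (simp add: real_le_rsqrt flip: real_sqrt_mult)
  qed
  obtain r :: "nat \<Rightarrow> nat" where r: "strict_mono r" and AE: "AE x in ?M. Cauchy (\<lambda>i. f (r i) x)"
  proof (rule cauchy_L1_AE_cauchy_subseq)
    show "integrable ?M (f n)" for n by (rule in_L2_integrable[OF f])
    fix e :: real assume e: "e > 0"
    \<comment> \<open>Cauchy-Schwarz against the constant 1 costs \<open>sqrt v\<close>; the
      additional 1 makes the final inequality strict and the division safe.\<close>
    define d where "d = (e / (sqrt v + 1))\<^sup>2"
    have sv: "sqrt v + 1 > 0" using v by (simp add: add_nonneg_pos)
    then have d: "d > 0" using e by (simp add: d_def)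
    obtain N where N: "\<And>i j. i \<ge> N \<Longrightarrow> j \<ge> N \<Longrightarrow> L2norm2 (box a b) (\<lambda>x. f i x - f j x) < d"
      using C[OF d] by blast
    show "\<exists>N. \<forall>i\<ge>N. \<forall>j\<ge>N. (LINT x|?M. norm (f i x - f j x)) < e"
    proof (intro exI allI impI)
      fix i j assume ij: "N \<le> i" "N \<le> j"
      have "sqrt (L2norm2 (box a b) (\<lambda>x. f i x - f j x)) \<le> sqrt d"
        using N[OF ij] by (intro real_sqrt_le_mono) simp
      also have "sqrt d = e / (sqrt v + 1)" using e sv by (simp add: d_def)
      finally have "(LINT x|?M. norm (f i x - f j x)) \<le> e / (sqrt v + 1) * sqrt v"
        using order_trans[OF L1 mult_right_mono] v by (metis real_sqrt_ge_zero)
      also have "\<dots> < e" using e sv by (simp add: divide_less_eq)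
      finally show "(LINT x|?M. norm (f i x - f j x)) < e" .
    qed
  qed
  define g where "g x = lim (\<lambda>i. f (r i) x)" for x
  have g: "g \<in> borel_measurable ?M"
    unfolding g_def [abs_def] by (intro borel_measurable_lim_metric in_L2_measurable f)
  have conv: "AE x in ?M. (\<lambda>i. f (r i) x) \<longlonglongrightarrow> g x"
    using AE by eventually_elim (simp add: g_def Cauchy_convergent convergent_LIMSEQ_iff[symmetric])
  have tail: "integrable ?M (\<lambda>x. (norm (f n x - g x))\<^sup>2) \<and> (LINT x|?M. (norm (f n x - g x))\<^sup>2) \<le> e"
    if n: "n \<ge> N" and N: "\<And>i j. i \<ge> N \<Longrightarrow> j \<ge> N \<Longrightarrow> L2norm2 (box a b) (\<lambda>x. f i x - f j x) < e" for n N e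
  proof (rule integral_limit_bound)
    have rN: "r (i + N) \<ge> N" for i using seq_suble[OF r, of "i + N"] by simp
    show "integrable ?M (\<lambda>x. (norm (f n x - f (r (i + N)) x))\<^sup>2)" for i
      using in_L2_diff[OF f f] by (auto simp: in_L2_def)
    show "AE x in ?M. (\<lambda>i. (norm (f n x - f (r (i + N)) x))\<^sup>2) \<longlonglongrightarrow> (norm (f n x - g x))\<^sup>2"
      using conv
    proof eventually_elim
      case (elim x)
      show ?case by (intro tendsto_intros LIMSEQ_ignore_initial_segment[OF elim])
    qed
    show "(\<lambda>x. (norm (f n x - g x))\<^sup>2) \<in> borel_measurable ?M"
      using g in_L2_measurable[OF f] by measurable
    show "(LINT x|?M. (norm (f n x - f (r (i + N)) x))\<^sup>2) \<le> e" for i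
      using less_imp_le[OF N[OF n rN]] by (simp add: L2norm2_def)
  qed auto
  obtain N1 where N1: "\<And>i j. i \<ge> N1 \<Longrightarrow> j \<ge> N1 \<Longrightarrow> L2norm2 (box a b) (\<lambda>x. f i x - f j x) < 1"
    using C[of 1] by auto
  have "in_L2 (box a b) (\<lambda>x. f N1 x - g x)"
    using tail[OF order_refl N1] g in_L2_measurable[OF f] unfolding in_L2_def by auto
  from in_L2_diff[OF f[of N1] this] have gL2: "in_L2 (box a b) g" by simp
  have "(\<lambda>n. L2norm2 (box a b) (\<lambda>x. f n x - g x)) \<longlonglongrightarrow> 0"
  proof (rule LIMSEQ_I)
    fix e :: real assume e: "e > 0"
    then obtain N where N: "\<And>i j. i \<ge> N \<Longrightarrow> j \<ge> N \<Longrightarrow> L2norm2 (box a b) (\<lambda>x. f i x - f j x) < e / 2"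
      using C[of "e / 2"] by auto
    have "norm (L2norm2 (box a b) (\<lambda>x. f n x - g x) - 0) < e" if "n \<ge> N" for n
      using tail[OF that N] e by (simp add: L2norm2_def)
    then show "\<exists>N. \<forall>n\<ge>N. norm (L2norm2 (box a b) (\<lambda>x. f n x - g x) - 0) < e" by blast
  qed
  with gL2 show ?thesis by (rule that)
qed

text \<open>Weak derivatives are defined with plain products, so the test function is conjugated to
  bring in the inner product and its Cauchy-Schwarz inequality.\<close>

lemma L2_integral_mult_tendsto:
  assumes f: "\<And>n. in_L2 \<Omega> (f n)" and g: "in_L2 \<Omega> g" and h: "in_L2 \<Omega> h"
    and lim: "(\<lambda>n. L2norm2 \<Omega> (\<lambda>x. f n x - g x)) \<longlonglongrightarrow> 0"
  shows "(\<lambda>n. LINT x|lebesgue_on \<Omega>. f n x * h x) \<longlonglongrightarrow> (LINT x|lebesgue_on \<Omega>. g x * h x)"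
proof (rule LIM_zero_cancel, rule Lim_null_comparison[OF always_eventually], intro allI)
  show "(\<lambda>n. sqrt (L2norm2 \<Omega> (\<lambda>x. f n x - g x)) * sqrt (L2norm2 \<Omega> h)) \<longlonglongrightarrow> 0"
    using tendsto_mult_right[OF tendsto_real_sqrt[OF lim], of "sqrt (L2norm2 \<Omega> h)"] by simp
  fix n
  have "(LINT x|lebesgue_on \<Omega>. f n x * h x) - (LINT x|lebesgue_on \<Omega>. g x * h x) = L2ip \<Omega> (\<lambda>x. f n x - g x) (\<lambda>x. cnj (h x))"
    unfolding L2ip_def using in_L2_mult_integrable(2)[OF f[of n] h] in_L2_mult_integrable(2)[OF g h]
    by (simp add: left_diff_distrib)
  then show "norm ((LINT x|lebesgue_on \<Omega>. f n x * h x) - (LINT x|lebesgue_on \<Omega>. g x * h x))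
    \<le> sqrt (L2norm2 \<Omega> (\<lambda>x. f n x - g x)) * sqrt (L2norm2 \<Omega> h)"
    using L2_Cauchy_Schwarz(2)[OF in_L2_diff[OF f[of n] g] in_L2_cnj[OF h]] by (simp add: L2norm2_def)
qed

lemma Cauchy_mono:
  fixes D D' :: "nat \<Rightarrow> nat \<Rightarrow> real"
  assumes "\<And>e. e > 0 \<Longrightarrow> \<exists>N. \<forall>i\<ge>N. \<forall>j\<ge>N. D i j < e" "\<And>i j. D' i j \<le> D i j" "e > 0"
  shows "\<exists>N. \<forall>i\<ge>N. \<forall>j\<ge>N. D' i j < e"
  using assms(1)[OF assms(3)] by (auto intro: order_le_less_trans[OF assms(2)])

text \<open>The functions and each of their partial derivatives converge separately in L2, and the
  defining identity of weak derivatives passes to the limit for every fixed test function; so the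
  limit of the derivatives is the derivative of the limit.\<close>

theorem Xsp_complete:
  fixes a b :: "'a::euclidean_space"
  assumes u: "\<And>n. u n \<in> Xsp bc a b"
    and C: "\<And>e. e > 0 \<Longrightarrow> \<exists>N. \<forall>i\<ge>N. \<forall>j\<ge>N. H1sq (box a b) (\<lambda>x. u i x - u j x) < e"
  obtains w where "w \<in> Xsp bc a b" "(\<lambda>n. H1sq (box a b) (\<lambda>x. u n x - w x)) \<longlonglongrightarrow> 0"
proof -
  let ?\<Omega> = "box a b"
  let ?M = "lebesgue_on (box a b)"
  note uH = Xsp_H1[OF u]
  have ud: "(\<lambda>x. u i x - u j x) \<in> H1 ?\<Omega>" for i j by (intro H1_diff uH)
  have CL: "\<exists>N. \<forall>i\<ge>N. \<forall>j\<ge>N. L2norm2 ?\<Omega> (\<lambda>x. u i x - u j x) < e" if "e > 0" for e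
    by (rule Cauchy_mono[OF C L2norm2_le_H1sq that])
  obtain w where w: "in_L2 ?\<Omega> w" and wlim: "(\<lambda>n. L2norm2 ?\<Omega> (\<lambda>x. u n x - w x)) \<longlonglongrightarrow> 0"
    by (rule L2_complete[where f = u and a = a and b = b], rule H1_in_L2[OF uH], erule CL, rule that)
  have ex: "\<exists>g. in_L2 ?\<Omega> g \<and> (\<lambda>n. L2norm2 ?\<Omega> (\<lambda>x. wgrad ?\<Omega> (u n) i x - g x)) \<longlonglongrightarrow> 0" if i: "i \<in> Basis" for i
  proof -
    have eq: "L2norm2 ?\<Omega> (\<lambda>x. wgrad ?\<Omega> (u n) i x - wgrad ?\<Omega> (u k) i x) = L2norm2 ?\<Omega> (wgrad ?\<Omega> (\<lambda>x. u n x - u k x) i)" for n k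
      using wgrad_lincomb_facts[OF uH[of n] uH[of k] i, of 1 "-1"]
      by (intro L2norm2_cong_AE in_L2_measurable) (auto elim: eventually_mono)
    have le: "L2norm2 ?\<Omega> (\<lambda>x. wgrad ?\<Omega> (u n) i x - wgrad ?\<Omega> (u k) i x) \<le> H1sq ?\<Omega> (\<lambda>x. u n x - u k x)" for n k
      unfolding eq by (rule order_trans[OF L2norm2_wgrad_le[OF i] grad_norm2_le_H1sq])
    have CL: "\<exists>N. \<forall>n\<ge>N. \<forall>k\<ge>N. L2norm2 ?\<Omega> (\<lambda>x. wgrad ?\<Omega> (u n) i x - wgrad ?\<Omega> (u k) i x) < e" if "e > 0" for e
      by (rule Cauchy_mono[OF C le that])
    show ?thesis
      by (rule L2_complete[where f = "\<lambda>n. wgrad ?\<Omega> (u n) i" and a = a and b = b], rule H1_wgrad(2)[OF uH i], erule CL, blast)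
  qed
  have "\<exists>g. \<forall>i\<in>Basis. in_L2 ?\<Omega> (g i) \<and> (\<lambda>n. L2norm2 ?\<Omega> (\<lambda>x. wgrad ?\<Omega> (u n) i x - g i x)) \<longlonglongrightarrow> 0"
    by (rule bchoice, rule ballI, rule ex)
  then obtain g where g: "\<And>i. i \<in> Basis \<Longrightarrow> in_L2 ?\<Omega> (g i)"
    and glim: "\<And>i. i \<in> Basis \<Longrightarrow> (\<lambda>n. L2norm2 ?\<Omega> (\<lambda>x. wgrad ?\<Omega> (u n) i x - g i x)) \<longlonglongrightarrow> 0"
    by blast
  have wd: "has_weak_deriv ?\<Omega> w i (g i)" if i: "i \<in> Basis" for i
    unfolding has_weak_deriv_def
  proof (intro conjI ballI)
    show "integrable ?M (g i)" by (rule in_L2_integrable[OF g[OF i]])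
    fix \<phi> assume \<phi>: "\<phi> \<in> test_fns ?\<Omega>"
    have L2: "in_L2 ?\<Omega> \<phi>" "in_L2 ?\<Omega> (pderiv_dir \<phi> i)"
      using C1_fun_in_L2[OF test_fns_C1[OF \<phi>]] i by auto
    have "(\<lambda>n. LINT x|?M. u n x * pderiv_dir \<phi> i x) \<longlonglongrightarrow> (LINT x|?M. w x * pderiv_dir \<phi> i x)"
      by (rule L2_integral_mult_tendsto[OF H1_in_L2[OF uH] w L2(2) wlim])
    moreover have "(\<lambda>n. - (LINT x|?M. wgrad ?\<Omega> (u n) i x * \<phi> x)) \<longlonglongrightarrow> - (LINT x|?M. g i x * \<phi> x)"
      by (intro tendsto_minus L2_integral_mult_tendsto[OF H1_wgrad(2)[OF uH i] g[OF i] L2(1) glim[OF i]])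
    moreover have "(LINT x|?M. u n x * pderiv_dir \<phi> i x) = - (LINT x|?M. wgrad ?\<Omega> (u n) i x * \<phi> x)" for n
      using H1_wgrad(1)[OF uH i] \<phi> unfolding has_weak_deriv_def by blast
    ultimately show "(LINT x|?M. w x * pderiv_dir \<phi> i x) = - (LINT x|?M. g i x * \<phi> x)"
      by (simp only: LIMSEQ_unique)
  qed
  have wH: "w \<in> H1 ?\<Omega>" unfolding H1_def using w wd g by blast
  have "L2norm2 ?\<Omega> (wgrad ?\<Omega> (\<lambda>x. u n x - w x) i) = L2norm2 ?\<Omega> (\<lambda>x. wgrad ?\<Omega> (u n) i x - g i x)" if i: "i \<in> Basis" for i n
  proof (rule L2norm2_cong_AE)
    show "AE x in ?M. wgrad ?\<Omega> (\<lambda>x. u n x - w x) i x = wgrad ?\<Omega> (u n) i x - g i x"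
      using wgrad_lincomb_facts(3)[OF uH[of n] wH i, of 1 "-1"] wgrad_AE[OF wd[OF i]]
      by eventually_elim simp
  qed (intro in_L2_measurable H1_wgrad(2) H1_diff uH wH i in_L2_diff g)+
  then have "H1sq ?\<Omega> (\<lambda>x. u n x - w x) = L2norm2 ?\<Omega> (\<lambda>x. u n x - w x) + (\<Sum>i\<in>Basis. L2norm2 ?\<Omega> (\<lambda>x. wgrad ?\<Omega> (u n) i x - g i x))" for n
    by (simp add: H1sq_def grad_norm2_eq)
  moreover have "(\<lambda>n. L2norm2 ?\<Omega> (\<lambda>x. u n x - w x) + (\<Sum>i\<in>Basis. L2norm2 ?\<Omega> (\<lambda>x. wgrad ?\<Omega> (u n) i x - g i x)))
      \<longlonglongrightarrow> 0 + (\<Sum>i\<in>(Basis::'a set). 0)"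
    by (intro tendsto_add tendsto_sum wlim glim)
  ultimately have lim: "(\<lambda>n. H1sq ?\<Omega> (\<lambda>x. u n x - w x)) \<longlonglongrightarrow> 0" by simp
  \<comment> \<open>The approximants belong to \<open>u n\<close>, since it is not yet known that
    \<open>w\<close> can be approximated; as \<open>u n\<close> tends to \<open>w\<close>, so do
    they.\<close>
  obtain \<phi> where \<phi>: "\<And>n. \<phi> n \<in> Xcore bc a b" "\<And>n. H1sq ?\<Omega> (\<lambda>x. u n x - \<phi> n x) < 1 / (real n + 1)"
    using Xsp_approx_seq[of u, OF u] by metis
  have "w \<in> Xsp bc a b"
  proof (rule XspI[OF wH \<phi>(1)])
    show "(\<lambda>n. H1sq ?\<Omega> (\<lambda>x. w x - \<phi> n x)) \<longlonglongrightarrow> 0"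
    proof (rule Lim_null_comparison[OF always_eventually], intro allI)
      show "(\<lambda>n. 2 * H1sq ?\<Omega> (\<lambda>x. u n x - w x) + 2 * (1 / (real n + 1))) \<longlonglongrightarrow> 0"
        using tendsto_add[OF tendsto_mult_right_zero[OF lim, of 2] tendsto_mult_right_zero[OF inverse_Suc_tendsto_0[of 1], of 2]] by simp
      fix n
      have \<phi>H: "\<phi> n \<in> H1 ?\<Omega>" by (intro C1_fun_in_H1 Xcore_C1[OF \<phi>(1)])
      show "norm (H1sq ?\<Omega> (\<lambda>x. w x - \<phi> n x)) \<le> 2 * H1sq ?\<Omega> (\<lambda>x. u n x - w x) + 2 * (1 / (real n + 1))"
        using H1sq_triangle[OF wH uH[of n] \<phi>H] H1sq_commute[OF uH[of n] wH] \<phi>(2)[of n] by simp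
    qed
  qed
  then show ?thesis using lim by (rule that)
qed

section \<open>The GFALM iteration\<close>

text \<open>Distinguishing whether \<open>t\<close> is below \<epsilon> s gives Young's inequality
  with simple constants. In the applications \<epsilon> multiplies bounded integrals and the large
  factor multiplies one that tends to zero.\<close>

lemma young_split:
  fixes s t \<epsilon> p :: real
  assumes "0 \<le> s" "0 \<le> t" "0 < \<epsilon>" "p > 1"
  shows "s powr p * t \<le> \<epsilon> * s powr (p + 1) + \<epsilon> powr (- p) * t powr (p + 1)"
proof (cases "t \<le> \<epsilon> * s")
  case True
  have "s powr p * t \<le> s powr p * (\<epsilon> * s)" using True by (intro mult_left_mono) auto
  also have "\<dots> = \<epsilon> * s powr (p + 1)" using assms by (cases "s = 0") (auto simp: powr_add)
  finally show ?thesis by (simp add: add_increasing2)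
next
  case False
  then have s: "s \<le> t / \<epsilon>" using assms by (simp add: field_simps)
  have "s powr p * t \<le> (t / \<epsilon>) powr p * t" using s assms by (intro mult_right_mono powr_mono2) auto
  also have "\<dots> = \<epsilon> powr (- p) * t powr (p + 1)"
    using assms by (cases "t = 0") (auto simp: powr_add powr_divide powr_minus field_simps)
  finally show ?thesis using assms by (simp add: add_increasing)
qed

text \<open>Replacing \<open>w\<close> and \<open>v\<close> by their maximum reduces the three
  factors to two.\<close>

lemma young_split3:
  fixes w v d \<epsilon> p :: real
  assumes nn: "0 \<le> w" "0 \<le> v" "0 \<le> d" and e: "0 < \<epsilon>" and p: "p > 1"
  shows "w powr (p - 1) * d * v \<le> \<epsilon> * (w powr (p + 1) + v powr (p + 1)) + \<epsilon> powr (- p) * d powr (p + 1)"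
proof -
  define m where "m = max w v"
  have m: "w \<le> m" "v \<le> m" "0 \<le> m" "m powr (p + 1) \<le> w powr (p + 1) + v powr (p + 1)"
    using nn by (auto simp: m_def max_def)
  have "w powr (p - 1) * d * v \<le> m powr (p - 1) * d * m"
    using m nn p by (intro mult_mono powr_mono2) auto
  also have "\<dots> = m powr p * d"
    using m(3) by (cases "m = 0") (auto simp: powr_diff)
  also have "\<dots> \<le> \<epsilon> * m powr (p + 1) + \<epsilon> powr (- p) * d powr (p + 1)"
    by (rule young_split[OF m(3) nn(3) e p])
  also have "\<dots> \<le> \<epsilon> * (w powr (p + 1) + v powr (p + 1)) + \<epsilon> powr (- p) * d powr (p + 1)"
    using m(4) e by simp
  finally show ?thesis .
qed

text \<open>Convexity: the graph of the power p lies above its tangent at \<open>A\<close>. As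
  before, Young's inequality provides the tangent bound.\<close>

lemma powr_tangent:
  fixes A B p :: real
  assumes "0 \<le> A" "0 \<le> B" "p > 1"
  shows "A powr p - B powr p \<le> p * A powr (p - 1) * (A - B)"
proof (cases "A = 0")
  case False
  then have A: "A > 0" using assms by simp
  have "1 / p + 1 / (p / (p - 1)) = 1" "p / (p - 1) > 1"
    using assms(3) by (auto simp: diff_divide_distrib)
  then have "B * A powr (p - 1) \<le> B powr p / p + (A powr (p - 1)) powr (p / (p - 1)) / (p / (p - 1))"
    using assms by (intro Youngs_inequality) simp_all
  also have "(A powr (p - 1)) powr (p / (p - 1)) = A powr p"
    using assms by (simp add: powr_powr)
  finally have "p * (B * A powr (p - 1)) \<le> p * (B powr p / p + A powr p / (p / (p - 1)))"
    using assms by (intro mult_left_mono) auto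
  also have "\<dots> = B powr p + (p - 1) * A powr p"
    using assms by (simp add: distrib_left)
  finally have "p * (B * A powr (p - 1)) \<le> B powr p + (p - 1) * A powr p" .
  moreover have "A powr p = A powr (p - 1) * A" using A by (simp add: powr_diff)
  ultimately show ?thesis by (simp add: algebra_simps)
qed (use assms in simp)

text \<open>By symmetry \<open>w\<close> is the smaller one. After splitting off the difference
  \<open>z - w\<close>, the remaining gap of the powers p - 1, times the norm of \<open>w\<close>,
  is at most the gap of the powers p, to which the tangent bound applies. This avoids the exponent p
  - 2, which may be negative.\<close>

lemma norm_power_nonlinearity_diff_le:
  fixes z w :: complex and p :: real
  assumes p: "p > 1"
  shows "norm (complex_of_real (norm z powr (p - 1)) * z - complex_of_real (norm w powr (p - 1)) * w)
    \<le> (p + 1) * (norm z + norm w) powr (p - 1) * norm (z - w)"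
proof -
  have *: "norm (complex_of_real (norm z powr (p - 1)) * z - complex_of_real (norm w powr (p - 1)) * w)
    \<le> (p + 1) * (norm z + norm w) powr (p - 1) * norm (z - w)" if le: "norm w \<le> norm z" for z w :: complex
  proof -
    let ?A = "norm z" and ?B = "norm w"
    have le': "?B powr (p - 1) \<le> ?A powr (p - 1)" using le p by (intro powr_mono2) auto
    have "complex_of_real (?A powr (p - 1)) * z - complex_of_real (?B powr (p - 1)) * w
       = complex_of_real (?A powr (p - 1)) * (z - w) + complex_of_real (?A powr (p - 1) - ?B powr (p - 1)) * w"
      by (simp add: algebra_simps)
    then have "norm (complex_of_real (?A powr (p - 1)) * z - complex_of_real (?B powr (p - 1)) * w)
       \<le> norm (complex_of_real (?A powr (p - 1)) * (z - w)) + norm (complex_of_real (?A powr (p - 1) - ?B powr (p - 1)) * w)"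
      by (metis norm_triangle_ineq)
    also have "\<dots> = ?A powr (p - 1) * norm (z - w) + (?A powr (p - 1) - ?B powr (p - 1)) * ?B"
      using le' unfolding norm_mult norm_of_real by simp
    also have "(?A powr (p - 1) - ?B powr (p - 1)) * ?B \<le> ?A powr p - ?B powr p"
    proof -
      have "?A powr (p - 1) * ?B \<le> ?A powr (p - 1) * ?A" using le by (intro mult_left_mono) auto
      moreover have "?A powr (p - 1) * ?A = ?A powr p" by (cases "z = 0") (auto simp: powr_diff)
      moreover have "?B powr (p - 1) * ?B = ?B powr p" by (cases "w = 0") (auto simp: powr_diff)
      ultimately show ?thesis by (simp add: left_diff_distrib)
    qed
    also have "?A powr p - ?B powr p \<le> p * ?A powr (p - 1) * (?A - ?B)"
      using p by (intro powr_tangent) auto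
    also have "\<dots> \<le> p * ?A powr (p - 1) * norm (z - w)"
      using p norm_triangle_ineq2[of z w] by (intro mult_left_mono) auto
    finally have "norm (complex_of_real (?A powr (p - 1)) * z - complex_of_real (?B powr (p - 1)) * w)
      \<le> (p + 1) * (?A powr (p - 1) * norm (z - w))" by (simp add: algebra_simps)
    also have "\<dots> \<le> (p + 1) * ((?A + ?B) powr (p - 1) * norm (z - w))"
      using p by (intro mult_left_mono mult_right_mono powr_mono2) auto
    finally show ?thesis by (simp add: mult.assoc)
  qed
  show ?thesis
  proof (cases "norm w \<le> norm z")
    case False
    then show ?thesis using *[of z w] by (simp add: norm_minus_commute add.commute)
  qed (rule *)
qed

text \<open>The hypotheses in the form in which they are used: subcriticality is multiplied out so
  that it reads the same in every dimension, and the condition on \<alpha> is a pointwise bound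
  almost everywhere.\<close>

locale gfalm =
  fixes bc :: bcond and a b :: "'a::euclidean_space" and V :: "'a \<Rightarrow> real" and \<omega> p \<tau> \<alpha> Cv :: real
  assumes ne: "box a b \<noteq> {}"
    and p1: "p > 1" and subcrit: "(p + 1) * (real DIM('a) - 2) < 2 * real DIM('a)"
    and V_meas: "V \<in> borel_measurable (lebesgue_on (box a b))"
    and V_bdd: "AE x in lebesgue_on (box a b). \<bar>V x\<bar> \<le> Cv"
    and V_nonneg: "AE x in lebesgue_on (box a b). 0 \<le> V x"
    and A2: "\<omega> > - lambda0 bc a b V"
    and alpha: "AE x in lebesgue_on (box a b). V x + \<omega> \<le> 2 * \<alpha> - 1"
    and tau: "\<tau> > 0"
begin

abbreviation "\<Omega> \<equiv> box a b"
abbreviation "M \<equiv> lebesgue_on (box a b)"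
abbreviation "X \<equiv> Xsp bc a b"
abbreviation "E \<equiv> H1sq (box a b)"
abbreviation "A \<equiv> A_form (box a b) V \<omega>"
abbreviation "Q \<equiv> Qf (box a b) V \<omega>"

definition "W (f :: 'a \<Rightarrow> complex) = (\<lambda>x. complex_of_real (V x + \<omega>) * f x)"
definition "Cw = \<bar>Cv\<bar> + \<bar>\<omega>\<bar>"
text \<open>With \<open>e = ut - u\<close> the step from \<open>u\<close> to \<open>ut\<close> reads \<open>K e v + A u v = Q u * Nl u v\<close> for all \<open>v\<close>.\<close>
definition "K e v = (1 / complex_of_real \<tau> + complex_of_real \<alpha>) * L2ip \<Omega> e v + grad_ip \<Omega> e v / 2"
definition "Nl u v = L2ip \<Omega> (\<lambda>x. complex_of_real (norm (u x) powr (p - 1)) * u x) v"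
definition "I (u :: 'a \<Rightarrow> complex) = (LINT x|M. norm (u x) powr (p + 1))"

section \<open>The quadratic form: boundedness, symmetry, coercivity\<close>

lemma Cw_nonneg: "Cw \<ge> 0" by (simp add: Cw_def)

lemma W_bound: "AE x in M. norm (W f x) \<le> Cw * norm (f x)"
  using V_bdd
proof eventually_elim
  case (elim x)
  have "\<bar>V x + \<omega>\<bar> \<le> Cw" using elim by (simp add: Cw_def)
  then show ?case unfolding W_def norm_mult norm_of_real by (rule mult_right_mono) simp
qed

lemma W_L2:
  assumes f: "in_L2 \<Omega> f"
  shows "in_L2 \<Omega> (W f)" and "L2norm2 \<Omega> (W f) \<le> Cw\<^sup>2 * L2norm2 \<Omega> f"
proof -
  have m: "W f \<in> borel_measurable M"
    unfolding W_def using V_meas in_L2_measurable[OF f] by measurable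
  have i: "integrable M (\<lambda>x. Cw\<^sup>2 * (norm (f x))\<^sup>2)" using f by (simp add: in_L2_def)
  have le: "AE x in M. (norm (W f x))\<^sup>2 \<le> Cw\<^sup>2 * (norm (f x))\<^sup>2"
    using W_bound[of f]
  proof eventually_elim
    case (elim x)
    show ?case using power_mono[OF elim norm_ge_zero, of 2] by (simp add: power_mult_distrib)
  qed
  have i2: "integrable M (\<lambda>x. (norm (W f x))\<^sup>2)"
    by (rule Bochner_Integration.integrable_bound[OF i]) (use m le in auto)
  show "in_L2 \<Omega> (W f)" unfolding in_L2_def using m i2 by simp
  have "L2norm2 \<Omega> (W f) \<le> (LINT x|M. Cw\<^sup>2 * (norm (f x))\<^sup>2)"
    unfolding L2norm2_def by (rule integral_mono_AE[OF i2 i le])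
  then show "L2norm2 \<Omega> (W f) \<le> Cw\<^sup>2 * L2norm2 \<Omega> f" by (simp add: L2norm2_def)
qed

lemma A_eq: "A u v = grad_ip \<Omega> u v / 2 + L2ip \<Omega> (W u) v"
  by (simp add: A_form_def W_def)

lemma X_H1: "u \<in> X \<Longrightarrow> u \<in> H1 \<Omega>"
  by (rule Xsp_H1)

lemma X_L2: "u \<in> X \<Longrightarrow> in_L2 \<Omega> u"
  by (rule H1_in_L2[OF X_H1])

lemma A_left:
  assumes "u \<in> X" "v \<in> X" "w \<in> X"
  shows "A (\<lambda>x. c * u x + d * v x) w = c * A u w + d * A v w"
proof -
  have "W (\<lambda>x. c * u x + d * v x) = (\<lambda>x. c * W u x + d * W v x)"
    by (simp add: W_def algebra_simps fun_eq_iff)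
  then show ?thesis
    using grad_ip_lincomb_left[OF assms[THEN X_H1], of c d]
      L2ip_lincomb_left[OF W_L2(1)[OF X_L2[OF assms(1)]] W_L2(1)[OF X_L2[OF assms(2)]] X_L2[OF assms(3)], of c d]
    by (simp add: A_eq algebra_simps add_divide_distrib)
qed

lemma A_cnj: "A u v = cnj (A v u)"
proof -
  have "L2ip \<Omega> (W u) v = L2ip \<Omega> u (W v)"
    unfolding L2ip_def W_def by (simp add: mult_ac)
  also have "\<dots> = cnj (L2ip \<Omega> (W v) u)" by (rule L2ip_cnj)
  finally show ?thesis using grad_ip_cnj[of \<Omega> u v] by (simp add: A_eq)
qed

lemma A_right:
  assumes "u \<in> X" "v \<in> X" "w \<in> X"
  shows "A w (\<lambda>x. c * u x + d * v x) = cnj c * A w u + cnj d * A w v"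
proof -
  have "A w (\<lambda>x. c * u x + d * v x) = cnj (A (\<lambda>x. c * u x + d * v x) w)" by (rule A_cnj)
  also have "\<dots> = cnj c * cnj (A u w) + cnj d * cnj (A v w)" by (simp add: A_left[OF assms])
  finally show ?thesis by (simp add: A_cnj[symmetric])
qed

lemma V_sq_integrable:
  assumes "in_L2 \<Omega> u" shows "integrable M (\<lambda>x. V x * (norm (u x))\<^sup>2)"
proof (rule Bochner_Integration.integrable_bound)
  show "integrable M (\<lambda>x. Cv * (norm (u x))\<^sup>2)" using assms by (simp add: in_L2_def)
  show "AE x in M. norm (V x * (norm (u x))\<^sup>2) \<le> norm (Cv * (norm (u x))\<^sup>2)"
    using V_bdd by eventually_elim (simp add: abs_mult mult_right_mono)
qed (use V_meas in_L2_measurable[OF assms] in measurable)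

lemma L2ip_W_self:
  assumes "in_L2 \<Omega> u"
  shows "L2ip \<Omega> (W u) u = complex_of_real ((LINT x|M. V x * (norm (u x))\<^sup>2) + \<omega> * L2norm2 \<Omega> u)"
proof -
  have "L2ip \<Omega> (W u) u = (LINT x|M. complex_of_real (V x * (norm (u x))\<^sup>2 + \<omega> * (norm (u x))\<^sup>2))"
    unfolding L2ip_def W_def
    by (intro Bochner_Integration.integral_cong refl)
       (simp add: complex_norm_square[symmetric] mult.assoc distrib_right flip: of_real_power)
  also have "\<dots> = complex_of_real (LINT x|M. V x * (norm (u x))\<^sup>2 + \<omega> * (norm (u x))\<^sup>2)"
    by (rule integral_complex_of_real)
  also have "(LINT x|M. V x * (norm (u x))\<^sup>2 + \<omega> * (norm (u x))\<^sup>2) = (LINT x|M. V x * (norm (u x))\<^sup>2) + \<omega> * L2norm2 \<Omega> u"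
    using V_sq_integrable[OF assms] assms by (simp add: in_L2_def L2norm2_def)
  finally show ?thesis .
qed

lemma A_self:
  assumes "u \<in> X" shows "A u u = complex_of_real (Q u)"
  unfolding A_eq L2ip_W_self[OF X_L2[OF assms]] grad_ip_self by (simp add: Qf_def)

lemma norm_L2ip_le: "u \<in> X \<Longrightarrow> v \<in> X \<Longrightarrow> norm (L2ip \<Omega> u v) \<le> sqrt (E u) * sqrt (E v)"
  by (rule order_trans[OF L2_Cauchy_Schwarz(2)[OF X_L2 X_L2]])
     (auto intro!: mult_mono real_sqrt_le_mono L2norm2_le_H1sq)

lemma norm_A_le:
  assumes "u \<in> X" "v \<in> X"
  shows "norm (A u v) \<le> (DIM('a) + Cw) * (sqrt (E u) * sqrt (E v))"
proof -
  have "norm (L2ip \<Omega> (W u) v) \<le> sqrt (L2norm2 \<Omega> (W u)) * sqrt (L2norm2 \<Omega> v)"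
    by (rule L2_Cauchy_Schwarz(2)[OF W_L2(1)[OF X_L2[OF assms(1)]] X_L2[OF assms(2)]])
  also have "\<dots> \<le> sqrt (Cw\<^sup>2 * E u) * sqrt (E v)"
    using W_L2(2)[OF X_L2[OF assms(1)]]
    by (intro mult_mono real_sqrt_le_mono order_trans[OF _ mult_left_mono[OF L2norm2_le_H1sq]] L2norm2_le_H1sq) auto
  also have "\<dots> = Cw * (sqrt (E u) * sqrt (E v))" by (simp add: real_sqrt_mult Cw_nonneg)
  finally have 1: "norm (L2ip \<Omega> (W u) v) \<le> Cw * (sqrt (E u) * sqrt (E v))" .
  have "norm (grad_ip \<Omega> u v / 2) \<le> norm (grad_ip \<Omega> u v)" by (simp add: norm_divide)
  also have "\<dots> \<le> DIM('a) * (sqrt (E u) * sqrt (E v))"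
    by (rule norm_grad_ip_le[OF assms[THEN X_H1]])
  finally show ?thesis
    using 1 norm_triangle_ineq[of "grad_ip \<Omega> u v / 2" "L2ip \<Omega> (W u) v"]
    unfolding A_eq distrib_right by linarith
qed

lemma norm_K_le:
  assumes "u \<in> X" "v \<in> X"
  shows "norm (K u v) \<le> (DIM('a) + (1 / \<tau> + \<bar>\<alpha>\<bar>)) * (sqrt (E u) * sqrt (E v))"
proof -
  have "norm (1 / complex_of_real \<tau> + complex_of_real \<alpha>) \<le> 1 / \<tau> + \<bar>\<alpha>\<bar>"
    using norm_triangle_ineq[of "1 / complex_of_real \<tau>" "complex_of_real \<alpha>"] tau by (simp add: norm_divide)
  then have 1: "norm ((1 / complex_of_real \<tau> + complex_of_real \<alpha>) * L2ip \<Omega> u v) \<le> (1 / \<tau> + \<bar>\<alpha>\<bar>) * (sqrt (E u) * sqrt (E v))"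
    unfolding norm_mult using norm_L2ip_le[OF assms] tau by (intro mult_mono) auto
  have "norm (grad_ip \<Omega> u v / 2) \<le> norm (grad_ip \<Omega> u v)" by (simp add: norm_divide)
  also have "\<dots> \<le> DIM('a) * (sqrt (E u) * sqrt (E v))"
    by (rule norm_grad_ip_le[OF assms[THEN X_H1]])
  finally show ?thesis
    using 1 norm_triangle_ineq[of "(1 / complex_of_real \<tau> + complex_of_real \<alpha>) * L2ip \<Omega> u v" "grad_ip \<Omega> u v / 2"]
    unfolding K_def distrib_right[of "real DIM('a)"] by linarith
qed

lemma V_form_scale:
  fixes u :: "'a \<Rightarrow> complex"
  shows "(LINT x|M. V x * (norm (c * u x))\<^sup>2) = (norm c)\<^sup>2 * (LINT x|M. V x * (norm (u x))\<^sup>2)"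
proof -
  have "(LINT x|M. V x * (norm (c * u x))\<^sup>2) = (LINT x|M. (norm c)\<^sup>2 * (V x * (norm (u x))\<^sup>2))"
    by (simp add: norm_mult power_mult_distrib mult.left_commute)
  then show ?thesis by (simp only: integral_mult_right_zero)
qed

lemma Q_scale:
  assumes "u \<in> X" shows "Q (\<lambda>x. c * u x) = (norm c)\<^sup>2 * Q u"
  by (simp add: Qf_def grad_norm2_scale[OF X_H1[OF assms]] L2norm2_scale V_form_scale algebra_simps
      del: norm_mult)

lemma V_form_nonneg: "0 \<le> (LINT x|M. V x * (norm (u x))\<^sup>2)"
  using V_nonneg by (intro integral_nonneg_AE) (auto elim: eventually_mono)

text \<open>Rescaling to unit L2 norm puts \<open>u\<close> into the set whose infimum is
  \<open>lambda0\<close>; V \<ge> 0 supplies the lower bound that makes this infimum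
  meaningful.\<close>

lemma lambda0_le:
  assumes u: "u \<in> X"
  shows "lambda0 bc a b V * L2norm2 \<Omega> u \<le> grad_norm2 \<Omega> u / 2 + (LINT x|M. V x * (norm (u x))\<^sup>2)"
proof (cases "L2norm2 \<Omega> u = 0")
  case True
  then show ?thesis using V_form_nonneg[of u] by simp
next
  case False
  define s where "s = L2norm2 \<Omega> u"
  have s: "s > 0" using False L2norm2_nonneg[of \<Omega> u] by (simp only: s_def less_le) simp
  define c where "c = complex_of_real (1 / sqrt s)"
  have c: "(norm c)\<^sup>2 = 1 / s" using s by (simp add: c_def power_divide norm_divide)
  define F where "F u = grad_norm2 \<Omega> u / 2 + (LINT x|M. V x * (norm (u x))\<^sup>2)" for u
  have Fs: "F (\<lambda>x. c * u x) = F u / s"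
    by (simp only: F_def grad_norm2_scale[OF X_H1[OF u]] V_form_scale c) (simp add: add_divide_distrib)
  have "lambda0 bc a b V \<le> F (\<lambda>x. c * u x)"
    unfolding lambda0_def F_def
  proof (rule cInf_lower)
    show "bdd_below {grad_norm2 \<Omega> u / 2 + (LINT x|M. V x * (norm (u x))\<^sup>2) |u. u \<in> X \<and> L2norm2 \<Omega> u = 1}"
      by (rule bdd_belowI[of _ 0]) (auto intro!: add_nonneg_nonneg V_form_nonneg)
    have "L2norm2 \<Omega> (\<lambda>x. c * u x) = 1" using s by (simp add: L2norm2_scale c s_def[symmetric])
    then show "grad_norm2 \<Omega> (\<lambda>x. c * u x) / 2 + (LINT x|M. V x * (norm (c * u x))\<^sup>2)
        \<in> {grad_norm2 \<Omega> u / 2 + (LINT x|M. V x * (norm (u x))\<^sup>2) |u. u \<in> X \<and> L2norm2 \<Omega> u = 1}"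
      using Xsp_scale[OF u, of c] by blast
  qed
  then show ?thesis using s by (simp add: Fs F_def[symmetric] s_def[symmetric] pos_le_divide_eq)
qed

text \<open>With \<delta> = \<omega> + \<open>lambda0\<close>, the first summand bounds the L2 norm
  and the bracket bounds the gradient in \<open>coercive\<close>.\<close>

definition "C0 = 1 / (\<omega> + lambda0 bc a b V) + (2 + 2 * \<bar>\<omega>\<bar> / (\<omega> + lambda0 bc a b V))"

lemma C0_pos: "C0 > 0"
proof -
  have "\<omega> + lambda0 bc a b V > 0" using A2 by simp
  then show ?thesis unfolding C0_def by (intro add_pos_pos add_pos_nonneg) auto
qed

text \<open>The eigenvalue bound controls the L2 norm by \<open>Q u / \<delta>\<close>. Solving the
  definition of \<open>Q\<close> for the gradient and dropping the nonnegative potential leaves only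
  a possibly negative \<omega> term, which the L2 bound absorbs.\<close>

lemma coercive:
  assumes u: "u \<in> X"
  shows "E u \<le> C0 * Q u"
proof -
  define \<delta> where "\<delta> = \<omega> + lambda0 bc a b V"
  have \<delta>: "\<delta> > 0" using A2 by (simp add: \<delta>_def)
  have "\<delta> * L2norm2 \<Omega> u \<le> Q u"
    using lambda0_le[OF u] by (simp add: \<delta>_def Qf_def distrib_right)
  then have L: "L2norm2 \<Omega> u \<le> Q u / \<delta>" using \<delta> by (simp add: pos_le_divide_eq mult.commute)
  have "- \<omega> * L2norm2 \<Omega> u \<le> \<bar>\<omega>\<bar> * L2norm2 \<Omega> u" by (intro mult_right_mono) auto
  also have "\<dots> \<le> \<bar>\<omega>\<bar> * (Q u / \<delta>)" using L by (intro mult_left_mono) auto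
  finally have "grad_norm2 \<Omega> u \<le> 2 * Q u + 2 * (\<bar>\<omega>\<bar> * (Q u / \<delta>))"
    using V_form_nonneg[of u] by (simp add: Qf_def)
  then have "E u \<le> Q u / \<delta> + (2 * Q u + 2 * (\<bar>\<omega>\<bar> * (Q u / \<delta>)))"
    using L by (simp add: H1sq_def)
  also have "\<dots> = C0 * Q u" by (simp add: C0_def \<delta>_def[symmetric] algebra_simps)
  finally show ?thesis .
qed

lemma Q_nonneg: "u \<in> X \<Longrightarrow> Q u \<ge> 0"
  using coercive[of u] C0_pos H1sq_nonneg[of \<Omega> u] by (meson order_trans zero_le_mult_iff not_less)

end

section \<open>The nonlinear term and the Sobolev constant\<close>

context gfalm
begin

lemma p_gt: "p + 1 > 2" using p1 by simp

text \<open>The choice operator gives the Sobolev constant a name that can occur in the constants of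
  later lemmas.\<close>

definition "KS = (SOME k. k > 0 \<and> (\<forall>u\<in>X. integrable M (\<lambda>x. norm (u x) powr (p + 1)) \<and> I u \<le> k * E u powr ((p + 1) / 2)))"

lemma KS_spec: "KS > 0 \<and> (\<forall>u\<in>X. integrable M (\<lambda>x. norm (u x) powr (p + 1)) \<and> I u \<le> KS * E u powr ((p + 1) / 2))"
  unfolding KS_def
proof (rule someI_ex)
  show "\<exists>k>0. \<forall>u\<in>X. integrable M (\<lambda>x. norm (u x) powr (p + 1)) \<and> I u \<le> k * E u powr ((p + 1) / 2)"
    by (rule Xsp_Sobolev[OF ne p_gt subcrit, of bc]) (auto simp: I_def)
qed

lemma KS_pos: "KS > 0" using KS_spec by simp

lemma X_powr_integrable: "u \<in> X \<Longrightarrow> integrable M (\<lambda>x. norm (u x) powr (p + 1))"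
  using KS_spec by simp

lemma I_le: "u \<in> X \<Longrightarrow> I u \<le> KS * E u powr ((p + 1) / 2)"
  using KS_spec by simp

lemma I_nonneg [simp]: "I u \<ge> 0"
  by (simp add: I_def)

lemma X_meas: "u \<in> X \<Longrightarrow> u \<in> borel_measurable M"
  by (rule in_L2_measurable[OF X_L2])

lemma norm_nl: "norm (complex_of_real (norm z powr (p - 1)) * z * cnj w) = norm z powr p * norm w"
proof -
  have "norm z powr (p - 1) * norm z = norm z powr p" by (cases "z = 0") (auto simp: powr_diff)
  then show ?thesis by (simp add: norm_mult)
qed

lemma nl_integrable:
  assumes u: "u \<in> X" and v: "v \<in> X"
  shows "integrable M (\<lambda>x. norm (u x) powr p * norm (v x))"
    and "integrable M (\<lambda>x. complex_of_real (norm (u x) powr (p - 1)) * u x * cnj (v x))"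
proof -
  note [measurable] = X_meas[OF u] X_meas[OF v]
  have [measurable]: "(\<lambda>x. cnj (v x)) \<in> borel_measurable M"
    using in_L2_measurable[OF in_L2_cnj[OF X_L2[OF v]]] .
  have i: "integrable M (\<lambda>x. norm (u x) powr (p + 1) + norm (v x) powr (p + 1))"
    by (intro Bochner_Integration.integrable_add X_powr_integrable u v)
  have le: "norm (u x) powr p * norm (v x) \<le> norm (u x) powr (p + 1) + norm (v x) powr (p + 1)" for x
    using young_split[of "norm (u x)" "norm (v x)" 1 p] p1 by simp
  show "integrable M (\<lambda>x. norm (u x) powr p * norm (v x))"
    by (rule Bochner_Integration.integrable_bound[OF i]) (use le in auto)
  show "integrable M (\<lambda>x. complex_of_real (norm (u x) powr (p - 1)) * u x * cnj (v x))"
    by (rule Bochner_Integration.integrable_bound[OF i]) (use le in \<open>auto simp: norm_nl\<close>)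
qed

lemma Nl_right:
  assumes u: "u \<in> X" and v: "v \<in> X" and w: "w \<in> X"
  shows "Nl u (\<lambda>x. c * v x + d * w x) = cnj c * Nl u v + cnj d * Nl u w"
  unfolding Nl_def L2ip_def using nl_integrable(2)[OF u v] nl_integrable(2)[OF u w]
  by (simp add: distrib_left mult.left_commute[of _ "cnj c"] mult.left_commute[of _ "cnj d"])

lemma Nl_self: "Nl u u = complex_of_real (I u)"
proof -
  have "complex_of_real (norm z powr (p - 1)) * z * cnj z = complex_of_real (norm z powr (p + 1))" for z :: complex
  proof (cases "z = 0")
    case False
    have "norm z powr (p - 1) * (norm z)\<^sup>2 = norm z powr (p - 1 + 2)"
      using False powr_numeral[of "norm z" "num.Bit0 num.One"] by (simp only: powr_add) simp
    then have "complex_of_real (norm z powr (p - 1)) * complex_of_real ((norm z)\<^sup>2) = complex_of_real (norm z powr (p + 1))"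
      unfolding of_real_mult[symmetric] by (simp add: add.commute)
    then show ?thesis by (simp only: complex_norm_square mult.assoc)
  qed simp
  then show ?thesis by (simp only: Nl_def L2ip_def I_def integral_complex_of_real)
qed

lemma norm_Nl_le:
  assumes u: "u \<in> X" and v: "v \<in> X"
  shows "norm (Nl u v) \<le> (LINT x|M. norm (u x) powr p * norm (v x))"
  using integral_norm_bound[of M "\<lambda>x. complex_of_real (norm (u x) powr (p - 1)) * u x * cnj (v x)"]
  by (simp add: Nl_def L2ip_def norm_nl)

lemma Nl_small:
  assumes u: "u \<in> X" and v: "v \<in> X" and e: "\<epsilon> > 0"
  shows "norm (Nl u v) \<le> \<epsilon> * I u + \<epsilon> powr (- p) * I v"
proof -
  have "(LINT x|M. norm (u x) powr p * norm (v x)) \<le> (LINT x|M. \<epsilon> * norm (u x) powr (p + 1) + \<epsilon> powr (- p) * norm (v x) powr (p + 1))"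
    using e p1 by (intro Bochner_Integration.integral_mono nl_integrable u v Bochner_Integration.integrable_add
        integrable_mult_right X_powr_integrable young_split) auto
  also have "\<dots> = \<epsilon> * I u + \<epsilon> powr (- p) * I v"
    using X_powr_integrable[OF u] X_powr_integrable[OF v] by (simp add: I_def)
  finally show ?thesis using norm_Nl_le[OF u v] by linarith
qed

text \<open>Hoelder's inequality is needed here with constant exactly 1, since the descent compares
  \<open>2 * N - 1\<close> with the square of \<open>N\<close>. Young's inequality is applied
  pointwise after dividing \<open>v\<close> by its norm \<open>N\<close>; the weights p/(p+1) and
  1/(p+1) then add up to 1. If \<open>I v = 0\<close> this scaling is impossible, and letting
  \<epsilon> tend to zero in \<open>Nl_small\<close> gives the claim.\<close>

lemma Nl_Hoelder:
  assumes u: "u \<in> X" and v: "v \<in> X" and Iu: "I u = 1"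
  shows "norm (Nl u v) \<le> I v powr (1 / (p + 1))"
proof (cases "I v = 0")
  case True
  have "norm (Nl u v) \<le> 0 + \<epsilon>" if "\<epsilon> > 0" for \<epsilon>
    using Nl_small[OF u v that] Iu True by simp
  then have "norm (Nl u v) \<le> 0" by (rule field_le_epsilon)
  then show ?thesis by simp
next
  case False
  then have Iv: "I v > 0" using I_nonneg[of v] by (simp only: less_le) simp
  define N where "N = I v powr (1 / (p + 1))"
  have N: "N > 0" using Iv by (simp add: N_def)
  have Nq: "N powr (p + 1) = I v" using Iv p1 by (simp add: N_def powr_powr)
  have exps: "(p + 1) / p > 1" "1 / ((p + 1) / p) + 1 / (p + 1) = 1"
    using p1 add_divide_distrib[of p 1 "p + 1"] by (simp_all add: pos_less_divide_eq)
  have ptw: "norm (u x) powr p * norm (v x)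
      \<le> N * (p / (p + 1)) * norm (u x) powr (p + 1) + N / ((p + 1) * I v) * norm (v x) powr (p + 1)" for x
  proof -
    have "norm (u x) powr p * (norm (v x) / N)
       \<le> (norm (u x) powr p) powr ((p + 1) / p) / ((p + 1) / p) + (norm (v x) / N) powr (p + 1) / (p + 1)"
      using exps p1 N by (intro Youngs_inequality) auto
    also have "\<dots> = (p / (p + 1)) * norm (u x) powr (p + 1) + norm (v x) powr (p + 1) / ((p + 1) * I v)"
      using p1 N by (simp add: powr_powr powr_divide Nq mult.commute)
    finally have "N * (norm (u x) powr p * (norm (v x) / N)) \<le> N * \<dots>"
      using N by (intro mult_left_mono) auto
    then show ?thesis using N by (simp add: distrib_left mult.assoc)
  qed
  have "norm (Nl u v) \<le> (LINT x|M. norm (u x) powr p * norm (v x))" by (rule norm_Nl_le[OF u v])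
  also have "\<dots> \<le> (LINT x|M. N * (p / (p + 1)) * norm (u x) powr (p + 1) + N / ((p + 1) * I v) * norm (v x) powr (p + 1))"
    by (intro Bochner_Integration.integral_mono nl_integrable u v Bochner_Integration.integrable_add
        integrable_mult_right X_powr_integrable ptw)
  also have "\<dots> = N * (p / (p + 1)) * I u + N / ((p + 1) * I v) * I v"
    using X_powr_integrable[OF u] X_powr_integrable[OF v] by (simp add: I_def)
  also have "\<dots> = N * (p / (p + 1) + 1 / (p + 1))"
    using Iu Iv by (simp add: distrib_left)
  also have "p / (p + 1) + 1 / (p + 1) = 1" using p1 by (simp add: add_divide_distrib[symmetric])
  finally show ?thesis by (simp add: N_def)
qed

text \<open>Continuity of the nonlinearity in its first argument with respect to the L^(p+1) norm:
  \<epsilon> multiplies quantities that stay bounded, and only the difference carries the large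
  factor.\<close>

lemma Nl_diff:
  assumes u: "u \<in> X" and w: "w \<in> X" and v: "v \<in> X" and e: "\<epsilon> > 0"
  shows "norm (Nl u v - Nl w v)
    \<le> (p + 1) * (\<epsilon> * (2 powr (p + 1) * (I u + I w) + I v) + \<epsilon> powr (- p) * I (\<lambda>x. u x - w x))"
proof -
  have uw: "(\<lambda>x. u x - w x) \<in> X" by (rule Xsp_diff[OF u w])
  let ?f = "\<lambda>x. complex_of_real (norm (u x) powr (p - 1)) * u x * cnj (v x) - complex_of_real (norm (w x) powr (p - 1)) * w x * cnj (v x)"
  let ?g = "\<lambda>x. (p + 1) * (\<epsilon> * (2 powr (p + 1) * (norm (u x) powr (p + 1) + norm (w x) powr (p + 1)) + norm (v x) powr (p + 1))
       + \<epsilon> powr (- p) * norm (u x - w x) powr (p + 1))"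
  have i: "integrable M ?f"
    by (intro Bochner_Integration.integrable_diff nl_integrable u v w)
  have "Nl u v - Nl w v = (LINT x|M. ?f x)"
    unfolding Nl_def L2ip_def using nl_integrable(2)[OF u v] nl_integrable(2)[OF w v] by simp
  also have "norm \<dots> \<le> (LINT x|M. norm (?f x))" by (rule integral_norm_bound)
  also have "\<dots> \<le> (LINT x|M. ?g x)"
  proof (rule Bochner_Integration.integral_mono)
    show "integrable M (\<lambda>x. norm (?f x))" using i by (rule integrable_norm)
    show "integrable M ?g"
      by (intro integrable_mult_right Bochner_Integration.integrable_add X_powr_integrable u v w X_powr_integrable[OF uw])
    fix x
    have "norm (?f x) = norm (complex_of_real (norm (u x) powr (p - 1)) * u x - complex_of_real (norm (w x) powr (p - 1)) * w x) * norm (v x)"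
      by (simp add: left_diff_distrib[symmetric] norm_mult)
    also have "\<dots> \<le> (p + 1) * (norm (u x) + norm (w x)) powr (p - 1) * norm (u x - w x) * norm (v x)"
      by (intro mult_right_mono norm_power_nonlinearity_diff_le p1) auto
    also have "\<dots> = (p + 1) * ((norm (u x) + norm (w x)) powr (p - 1) * norm (u x - w x) * norm (v x))"
      by (simp add: mult.assoc)
    also have "\<dots> \<le> (p + 1) * (\<epsilon> * ((norm (u x) + norm (w x)) powr (p + 1) + norm (v x) powr (p + 1)) + \<epsilon> powr (- p) * norm (u x - w x) powr (p + 1))"
      using p1 e by (intro mult_left_mono young_split3) auto
    also have "\<dots> \<le> ?g x"
      using p1 e by (intro mult_left_mono add_right_mono powr_add_le) auto
    finally show "norm (?f x) \<le> ?g x" .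
  qed
  also have "\<dots> = (p + 1) * (\<epsilon> * (2 powr (p + 1) * (I u + I w) + I v) + \<epsilon> powr (- p) * I (\<lambda>x. u x - w x))"
    using X_powr_integrable[OF u] X_powr_integrable[OF v] X_powr_integrable[OF w] X_powr_integrable[OF uw]
    by (simp add: I_def)
  finally show ?thesis .
qed

section \<open>One step of the scheme and its energy descent\<close>

lemma Lpnorm_eq: "Lpnorm \<Omega> (p + 1) u = I u powr (1 / (p + 1))"
  by (simp add: Lpnorm_def I_def)

lemma Lpnorm_1_iff: "Lpnorm \<Omega> (p + 1) u = 1 \<longleftrightarrow> I u = 1"
proof
  assume "Lpnorm \<Omega> (p + 1) u = 1"
  then have "(I u powr (1 / (p + 1))) powr (p + 1) = 1" by (simp add: Lpnorm_eq)
  then show "I u = 1" using p1 by (simp add: powr_powr)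
qed (simp add: Lpnorm_eq)

lemma lam_tilde_eq: "I u = 1 \<Longrightarrow> lam_tilde \<Omega> V \<omega> p u = Q u"
  using Lpnorm_1_iff[of u] by (simp add: lam_tilde_def)

text \<open>Adding and subtracting half the gradient form of \<open>u\<close> collects all implicit
  terms in \<open>K\<close> of the increment; the rest is the residual of the Euler-Lagrange
  equation at \<open>u\<close>. On the unit sphere the multiplier is \<open>Q u\<close>.\<close>

lemma step_equation:
  assumes u: "u \<in> X" and Iu: "I u = 1" and step: "gfalm_step bc a b V \<omega> p \<tau> \<alpha> u u'"
  obtains ut where "ut \<in> X" "u' = (\<lambda>x. ut x / complex_of_real (I ut powr (1 / (p + 1))))"
    "\<And>v. v \<in> X \<Longrightarrow> K (\<lambda>x. ut x - u x) v + A u v = complex_of_real (Q u) * Nl u v"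
proof -
  define F where "F x = complex_of_real (V x + \<omega> - Q u * norm (u x) powr (p - 1) - \<alpha>) * u x" for x
  obtain ut where ut: "ut \<in> X" "u' = (\<lambda>x. ut x / complex_of_real (I ut powr (1 / (p + 1))))"
    and eq: "\<And>v. v \<in> X \<Longrightarrow> L2ip \<Omega> (\<lambda>x. ut x - u x) v / complex_of_real \<tau>
       = - (grad_ip \<Omega> ut v / 2 + complex_of_real \<alpha> * L2ip \<Omega> ut v + L2ip \<Omega> F v)"
    using step unfolding gfalm_step_def lam_tilde_eq[OF Iu] Lpnorm_eq F_def [abs_def] by blast
  show ?thesis
  proof (rule that[OF ut])
    fix v assume v: "v \<in> X"
    have "L2ip \<Omega> F v = (LINT x|M. W u x * cnj (v x) - complex_of_real (Q u) * (complex_of_real (norm (u x) powr (p - 1)) * u x * cnj (v x))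
         - complex_of_real \<alpha> * (u x * cnj (v x)))"
      unfolding L2ip_def F_def W_def by (simp add: algebra_simps)
    also have "\<dots> = L2ip \<Omega> (W u) v - complex_of_real (Q u) * Nl u v - complex_of_real \<alpha> * L2ip \<Omega> u v"
      using nl_integrable(2)[OF u v] in_L2_mult_integrable(3)[OF X_L2[OF u] X_L2[OF v]]
        in_L2_mult_integrable(3)[OF W_L2(1)[OF X_L2[OF u]] X_L2[OF v]]
      by (simp add: L2ip_def Nl_def)
    finally have F: "L2ip \<Omega> F v = L2ip \<Omega> (W u) v - complex_of_real (Q u) * Nl u v - complex_of_real \<alpha> * L2ip \<Omega> u v" .
    have G: "grad_ip \<Omega> (\<lambda>x. ut x - u x) v = grad_ip \<Omega> ut v - grad_ip \<Omega> u v"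
      using grad_ip_lincomb_left[OF X_H1[OF ut(1)] X_H1[OF u] X_H1[OF v], of 1 "-1"] by simp
    have L: "L2ip \<Omega> (\<lambda>x. ut x - u x) v = L2ip \<Omega> ut v - L2ip \<Omega> u v"
      using L2ip_lincomb_left[OF X_L2[OF ut(1)] X_L2[OF u] X_L2[OF v], of 1 "-1"] by simp
    have "K (\<lambda>x. ut x - u x) v + A u v
      = L2ip \<Omega> (\<lambda>x. ut x - u x) v / complex_of_real \<tau> + complex_of_real \<alpha> * L2ip \<Omega> (\<lambda>x. ut x - u x) v
        + grad_ip \<Omega> (\<lambda>x. ut x - u x) v / 2 + A u v"
      unfolding K_def by (simp add: distrib_right)
    also have "\<dots> = complex_of_real (Q u) * Nl u v"
      unfolding eq[OF v] F unfolding G L A_eq by (simp add: algebra_simps diff_divide_distrib)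
    finally show "K (\<lambda>x. ut x - u x) v + A u v = complex_of_real (Q u) * Nl u v" .
  qed
qed

lemma K_self: "Re (K e e) = (1 / \<tau> + \<alpha>) * L2norm2 \<Omega> e + grad_norm2 \<Omega> e / 2"
proof -
  have "K e e = complex_of_real ((1 / \<tau> + \<alpha>) * L2norm2 \<Omega> e + grad_norm2 \<Omega> e / 2)"
    unfolding K_def L2ip_self grad_ip_self by simp
  then show ?thesis by simp
qed

text \<open>Half of the gradient term survives the subtraction. The bound V + \<omega> \<le> 2
  \<alpha> - 1 leaves one full L2 term, and the contribution of 1/\<tau> is nonnegative and dropped,
  which makes the estimate uniform in the time step.\<close>

lemma two_K_minus_Q:
  assumes e: "e \<in> X"
  shows "E e / 2 \<le> 2 * Re (K e e) - Q e"
proof -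
  have i: "integrable M (\<lambda>x. (norm (e x))\<^sup>2)" using X_L2[OF e] by (simp add: in_L2_def)
  have "(LINT x|M. V x * (norm (e x))\<^sup>2 + \<omega> * (norm (e x))\<^sup>2) \<le> (LINT x|M. (2 * \<alpha> - 1) * (norm (e x))\<^sup>2)"
  proof (rule integral_mono_AE)
    show "AE x in M. V x * (norm (e x))\<^sup>2 + \<omega> * (norm (e x))\<^sup>2 \<le> (2 * \<alpha> - 1) * (norm (e x))\<^sup>2"
      using alpha by eventually_elim (simp add: distrib_right[symmetric] mult_right_mono)
  qed (use i V_sq_integrable[OF X_L2[OF e]] in auto)
  then have le: "(LINT x|M. V x * (norm (e x))\<^sup>2) + \<omega> * L2norm2 \<Omega> e \<le> (2 * \<alpha> - 1) * L2norm2 \<Omega> e"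
    using i V_sq_integrable[OF X_L2[OF e]] by (simp add: L2norm2_def)
  have lin: "(L + G) / 2 \<le> R - (G / 2 + F + r)"
    if "0 \<le> t" "0 \<le> L" "R = 2 * t + 2 * s + G" "F + r \<le> 2 * s - L" for t s r F L G R :: real
    using that by (simp add: field_simps)
  show ?thesis
    unfolding Qf_def H1sq_def
  proof (rule lin)
    show "0 \<le> 1 / \<tau> * L2norm2 \<Omega> e" using tau by simp
    show "2 * Re (K e e) = 2 * (1 / \<tau> * L2norm2 \<Omega> e) + 2 * (\<alpha> * L2norm2 \<Omega> e) + grad_norm2 \<Omega> e"
      unfolding K_self by (simp add: distrib_left distrib_right)
    show "(LINT x|M. V x * (norm (e x))\<^sup>2) + \<omega> * L2norm2 \<Omega> e \<le> 2 * (\<alpha> * L2norm2 \<Omega> e) - L2norm2 \<Omega> e"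
      using le by (simp add: left_diff_distrib)
  qed simp
qed

text \<open>Arises by cancelling one factor \<open>N\<close> in the bound of its square by
  \<open>KS powr (2 / (p + 1)) * (C0 * (Q u * (2 * N)))\<close>.\<close>

definition "c2 = 2 * KS powr (2 / (p + 1)) * C0"

lemma c2_pos: "c2 > 0" using KS_pos C0_pos by (simp add: c2_def)

text \<open>Testing the step with \<open>e = ut - u\<close> and using Hoelder's inequality gives
  \<open>Q ut + E e / 2 \<le> Q u * (2 * N - 1) \<le> Q u * N\<^sup>2\<close> with \<open>N\<close> the \<open>L\<^bsup>p+1\<^esup>\<close> norm of \<open>ut\<close>;
  the normalisation divides by \<open>N\<^sup>2\<close>, and the Sobolev inequality bounds \<open>N\<close>.\<close>
lemma step_descent:
  assumes u: "u \<in> X" and Iu: "I u = 1" and step: "gfalm_step bc a b V \<omega> p \<tau> \<alpha> u u'"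
  obtains e where "u' \<in> X" "I u' = 1" "e \<in> X"
    "\<And>v. v \<in> X \<Longrightarrow> K e v + A u v = complex_of_real (Q u) * Nl u v"
    "E e \<le> 2 * (c2 * Q u)\<^sup>2 * (Q u - Q u')"
proof -
  obtain ut where ut: "ut \<in> X" and u': "u' = (\<lambda>x. ut x / complex_of_real (I ut powr (1 / (p + 1))))"
    and eq: "\<And>v. v \<in> X \<Longrightarrow> K (\<lambda>x. ut x - u x) v + A u v = complex_of_real (Q u) * Nl u v"
    using step_equation[OF u Iu step] by blast
  define e where "e x = ut x - u x" for x
  have e: "e \<in> X" unfolding e_def [abs_def] by (rule Xsp_diff[OF ut u])
  have eqe: "K e v + A u v = complex_of_real (Q u) * Nl u v" if "v \<in> X" for v
    using eq[OF that] by (simp add: e_def [abs_def])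
  define N where "N = I ut powr (1 / (p + 1))"
  \<comment> \<open>If \<open>E u\<close> were zero, the Sobolev inequality would contradict
    \<open>I u = 1\<close>.\<close>
  have lam: "Q u > 0"
  proof -
    have "E u \<noteq> 0" using I_le[OF u] Iu by auto
    then have "0 < C0 * Q u" using coercive[OF u] H1sq_nonneg[of \<Omega> u] by linarith
    then show ?thesis using C0_pos by (simp add: zero_less_mult_iff)
  qed
  \<comment> \<open>The constraint on the old iterate enters here:
    \<open>Nl u u = I u = 1\<close>.\<close>
  have "Nl u e = Nl u ut - 1"
    using Nl_right[OF u ut u, of 1 "-1"] by (simp add: e_def [abs_def] Nl_self Iu)
  then have "Re (K e e) + Re (A u e) = Q u * (Re (Nl u ut) - 1)"
    using arg_cong[OF eqe[OF e], of Re] by simp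
  moreover have "Q ut = Q u + 2 * Re (A u e) + Q e"
  proof -
    have ut_eq: "ut = (\<lambda>x. 1 * u x + 1 * e x)" by (simp add: e_def)
    have "complex_of_real (Q ut) = A ut ut" by (simp add: A_self[OF ut])
    also have "\<dots> = A u ut + A e ut" using A_left[OF u e ut, of 1 1] by (simp only: ut_eq[symmetric]) simp
    also have "\<dots> = A u u + A u e + (A e u + A e e)"
      using A_right[OF u e u, of 1 1] A_right[OF u e e, of 1 1] by (simp only: ut_eq[symmetric]) simp
    finally have "Re (complex_of_real (Q ut)) = Re (A u u + A u e + (A e u + A e e))" by simp
    moreover have "Re (A e u) = Re (A u e)" using A_cnj[of e u] by simp
    ultimately show ?thesis by (simp add: A_self[OF u] A_self[OF e])
  qed
  moreover have "Re (Nl u ut) \<le> N"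
    using Nl_Hoelder[OF u ut Iu] complex_Re_le_cmod[of "Nl u ut"] by (simp add: N_def)
  then have "Q u * (Re (Nl u ut) - 1) \<le> Q u * (N - 1)"
    using lam by (intro mult_left_mono) auto
  ultimately have main: "Q ut + E e / 2 \<le> Q u * (2 * N - 1)"
    using two_K_minus_Q[OF e] by (simp add: algebra_simps)
  \<comment> \<open>The energy estimate itself excludes \<open>ut = 0\<close>: its left side is
    nonnegative, so \<open>N\<close> is at least 1/2 and the normalisation is legitimate.\<close>
  have "0 \<le> Q u * (2 * N - 1)" using main Q_nonneg[OF ut] H1sq_nonneg[of \<Omega> e] by linarith
  then have N: "N > 0" using lam by (simp add: zero_le_mult_iff)
  have Iut: "I ut > 0"
    using N I_nonneg[of ut] unfolding N_def by (metis less_le powr_0 order_less_irrefl)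
  have Nq: "N powr (p + 1) = I ut" using Iut p1 by (simp add: N_def powr_powr)
  have "N\<^sup>2 = I ut powr (2 / (p + 1))"
    using Iut by (simp add: N_def powr_powr flip: powr_numeral)
  also have "\<dots> \<le> (KS * E ut powr ((p + 1) / 2)) powr (2 / (p + 1))"
    using I_le[OF ut] p1 by (intro powr_mono2) auto
  also have "\<dots> = KS powr (2 / (p + 1)) * E ut"
  proof -
    have "(p + 1) / 2 * (2 / (p + 1)) = 1" using p1 by simp
    then show ?thesis by (simp only: powr_mult powr_powr) simp
  qed
  also have "\<dots> \<le> KS powr (2 / (p + 1)) * (C0 * (Q u * (2 * N)))"
  proof (intro mult_left_mono)
    have "Q ut \<le> Q u * (2 * N)"
    proof -
      have "Q u * (2 * N - 1) = Q u * (2 * N) - Q u" by (simp add: right_diff_distrib)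
      then show ?thesis using main lam H1sq_nonneg[of \<Omega> e] by linarith
    qed
    then show "E ut \<le> C0 * (Q u * (2 * N))"
      using coercive[OF ut] C0_pos by (meson mult_left_mono less_imp_le order_trans)
  qed simp
  also have "\<dots> = (c2 * Q u) * N" by (simp add: c2_def)
  finally have Nle: "N \<le> c2 * Q u" using N by (simp add: power2_eq_square)
  have u'_eq: "u' = (\<lambda>x. complex_of_real (1 / N) * ut x)" by (simp add: u' N_def)
  have u'X: "u' \<in> X" unfolding u'_eq by (rule Xsp_scale[OF ut])
  have "I u' = (LINT x|M. (1 / I ut) * norm (ut x) powr (p + 1))"
    unfolding I_def u'_eq using N
    by (intro Bochner_Integration.integral_cong refl)
       (simp add: norm_mult norm_divide powr_mult powr_divide Nq I_def)
  also have "\<dots> = (1 / I ut) * I ut" unfolding I_def by (rule integral_mult_right_zero)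
  finally have Iu': "I u' = 1" using Iut by simp
  have Qu': "Q u' = Q ut / N\<^sup>2"
    unfolding u'_eq Q_scale[OF ut] using N by (simp add: norm_divide power_divide)
  \<comment> \<open>The square of \<open>N - 1\<close> is the slack. The right side is homogeneous
    of degree two in \<open>N\<close>, as needed to pass to the normalised iterate.\<close>
  have "2 * N - 1 \<le> N\<^sup>2" using zero_le_power2[of "N - 1"] by (simp add: power2_diff)
  then have "Q u * (2 * N - 1) \<le> Q u * N\<^sup>2" using lam by (intro mult_left_mono) auto
  with main have "Q ut + E e / 2 \<le> Q u * N\<^sup>2" by (rule order_trans)
  then have "E e \<le> 2 * (Q u * N\<^sup>2 - Q ut)" by (simp add: field_simps)
  also have "\<dots> = 2 * N\<^sup>2 * (Q u - Q u')" using N by (simp add: Qu' field_simps)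
  finally have Ee: "E e \<le> 2 * N\<^sup>2 * (Q u - Q u')" .
  have "0 \<le> 2 * N\<^sup>2 * (Q u - Q u')" using Ee H1sq_nonneg[of \<Omega> e] by linarith
  then have "Q u - Q u' \<ge> 0" using N by (simp add: zero_le_mult_iff)
  then have "2 * N\<^sup>2 * (Q u - Q u') \<le> 2 * (c2 * Q u)\<^sup>2 * (Q u - Q u')"
    using N Nle by (intro mult_right_mono mult_left_mono power_mono) auto
  with Ee have "E e \<le> 2 * (c2 * Q u)\<^sup>2 * (Q u - Q u')" by linarith
  then show ?thesis using that[OF u'X Iu' e eqe] by blast
qed

section \<open>Continuity in H1 and passage to the limit\<close>

lemma sqrt_E_tendsto:
  assumes "(\<lambda>n. E (d n)) \<longlonglongrightarrow> 0"
  shows "(\<lambda>n. k * (sqrt (E (d n)) * B)) \<longlonglongrightarrow> 0"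
proof -
  have "(\<lambda>n. sqrt (E (d n))) \<longlonglongrightarrow> 0" using tendsto_real_sqrt[OF assms] by simp
  then show ?thesis by (intro tendsto_mult_right_zero tendsto_mult_left_zero)
qed

lemma A_K_tendsto:
  assumes d: "\<And>n. d n \<in> X" and v: "v \<in> X" and lim: "(\<lambda>n. E (d n)) \<longlonglongrightarrow> 0"
  shows A_tendsto: "(\<lambda>n. A (d n) v) \<longlonglongrightarrow> 0" and K_tendsto: "(\<lambda>n. K (d n) v) \<longlonglongrightarrow> 0"
proof -
  show "(\<lambda>n. A (d n) v) \<longlonglongrightarrow> 0"
    by (rule Lim_null_comparison[OF always_eventually sqrt_E_tendsto[OF lim, of "DIM('a) + Cw" "sqrt (E v)"]])
       (intro allI norm_A_le d v)
  show "(\<lambda>n. K (d n) v) \<longlonglongrightarrow> 0"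
    by (rule Lim_null_comparison[OF always_eventually sqrt_E_tendsto[OF lim, of "DIM('a) + (1 / \<tau> + \<bar>\<alpha>\<bar>)" "sqrt (E v)"]])
       (intro allI norm_K_le d v)
qed

lemma I_tendsto:
  assumes d: "\<And>n. d n \<in> X" and lim: "(\<lambda>n. E (d n)) \<longlonglongrightarrow> 0"
  shows "(\<lambda>n. I (d n)) \<longlonglongrightarrow> 0"
proof (rule Lim_null_comparison[OF always_eventually], intro allI)
  show "norm (I (d n)) \<le> KS * E (d n) powr ((p + 1) / 2)" for n using I_le[OF d] by simp
  have "(\<lambda>n. E (d n) powr ((p + 1) / 2)) \<longlonglongrightarrow> 0 powr ((p + 1) / 2)"
    by (intro tendsto_powr' lim tendsto_const disjI2 conjI always_eventually allI) (use p1 in auto)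
  from tendsto_mult_left[OF this, of KS] show "(\<lambda>n. KS * E (d n) powr ((p + 1) / 2)) \<longlonglongrightarrow> 0"
    using p1 by simp
qed

lemma Nl_tendsto:
  assumes u: "\<And>n. u n \<in> X" and Iu: "\<And>n. I (u n) = 1" and w: "w \<in> X" and Iw: "I w = 1" and v: "v \<in> X"
    and lim: "(\<lambda>n. I (\<lambda>x. u n x - w x)) \<longlonglongrightarrow> 0"
  shows "(\<lambda>n. Nl (u n) v) \<longlonglongrightarrow> Nl w v"
proof (rule LIMSEQ_I)
  fix \<eta> :: real assume \<eta>: "\<eta> > 0"
  define B where "B = 2 powr (p + 1) * 2 + I v"
  have B: "B > 0" unfolding B_def by (intro add_pos_nonneg) auto
  define P where "P = p + 1"
  have P: "P > 0" using p1 by (simp add: P_def)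
  \<comment> \<open>\<epsilon> makes the bounded part of \<open>Nl_diff\<close> equal to \<eta>/2;
    \<delta>, which depends on \<epsilon>, does the same for the vanishing part.\<close>
  define \<epsilon> where "\<epsilon> = \<eta> / (2 * P * B)"
  have \<epsilon>: "\<epsilon> > 0" using \<eta> P B by (simp add: \<epsilon>_def)
  have half: "P * (\<epsilon> * B) = \<eta> / 2" using P B by (simp add: \<epsilon>_def)
  define \<delta> where "\<delta> = \<eta> / (2 * P * \<epsilon> powr (- p))"
  have \<delta>: "\<delta> > 0" using \<eta> P \<epsilon> by (simp add: \<delta>_def)
  have half': "P * (\<epsilon> powr (- p) * \<delta>) = \<eta> / 2" using P \<epsilon> by (simp add: \<delta>_def)
  obtain n0 where n0: "\<And>n. n \<ge> n0 \<Longrightarrow> I (\<lambda>x. u n x - w x) < \<delta>"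
    using order_tendstoD(2)[OF lim \<delta>] by (auto simp: eventually_sequentially)
  show "\<exists>n0. \<forall>n\<ge>n0. norm (Nl (u n) v - Nl w v) < \<eta>"
  proof (intro exI allI impI)
    fix n assume n: "n0 \<le> n"
    have "norm (Nl (u n) v - Nl w v) \<le> P * (\<epsilon> * B + \<epsilon> powr (- p) * I (\<lambda>x. u n x - w x))"
      using Nl_diff[OF u w v \<epsilon>, of n] by (simp add: Iu Iw B_def P_def)
    also have "\<dots> < P * (\<epsilon> * B + \<epsilon> powr (- p) * \<delta>)"
      using n0[OF n] \<epsilon> P by simp
    also have "\<dots> = \<eta>" using half half' by (simp add: distrib_left)
    finally show "norm (Nl (u n) v - Nl w v) < \<eta>" .
  qed
qed

text \<open>\<open>Q\<close> is expanded around \<open>w\<close> as a Hermitian form; the cross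
  terms and the quadratic term vanish by boundedness of the form.\<close>

lemma Q_tendsto:
  assumes u: "\<And>n. u n \<in> X" and w: "w \<in> X" and lim: "(\<lambda>n. E (\<lambda>x. u n x - w x)) \<longlonglongrightarrow> 0"
  shows "(\<lambda>n. Q (u n)) \<longlonglongrightarrow> Q w"
proof -
  define d where "d n x = u n x - w x" for n x
  have d: "d n \<in> X" for n unfolding d_def [abs_def] by (rule Xsp_diff[OF u w])
  have dlim: "(\<lambda>n. E (d n)) \<longlonglongrightarrow> 0" using lim by (simp add: d_def [abs_def])
  have eq: "complex_of_real (Q (u n)) = A (d n) w + cnj (A (d n) w) + A (d n) (d n) + A w w" for n
  proof -
    have un: "u n = (\<lambda>x. 1 * d n x + 1 * w x)" by (simp add: d_def)
    have "complex_of_real (Q (u n)) = A (u n) (u n)" by (simp add: A_self[OF u])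
    also have "\<dots> = A (d n) (u n) + A w (u n)" using A_left[OF d[of n] w u[of n], of 1 1] by (simp only: un[symmetric]) simp
    also have "\<dots> = A (d n) (d n) + A (d n) w + (A w (d n) + A w w)"
      using A_right[OF d[of n] w d[of n], of 1 1] A_right[OF d[of n] w w, of 1 1] by (simp only: un[symmetric]) simp
    also have "A w (d n) = cnj (A (d n) w)" by (rule A_cnj)
    finally show ?thesis by simp
  qed
  have "(\<lambda>n. A (d n) (d n)) \<longlonglongrightarrow> 0"
  proof (rule Lim_null_comparison[OF always_eventually], intro allI)
    show "norm (A (d n) (d n)) \<le> (DIM('a) + Cw) * E (d n)" for n
      using norm_A_le[OF d[of n] d[of n]] by simp
    show "(\<lambda>n. (DIM('a) + Cw) * E (d n)) \<longlonglongrightarrow> 0"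
      by (rule tendsto_mult_right_zero[OF dlim])
  qed
  then have "(\<lambda>n. A (d n) w + cnj (A (d n) w) + A (d n) (d n) + A w w) \<longlonglongrightarrow> 0 + cnj 0 + 0 + A w w"
    by (intro tendsto_intros A_tendsto[OF d w dlim])
  then have "(\<lambda>n. complex_of_real (Q (u n))) \<longlonglongrightarrow> complex_of_real (Q w)"
    by (simp add: eq A_self[OF w])
  then show ?thesis by (simp only: tendsto_of_real_iff)
qed

text \<open>Both claims rest on the same increments \<open>e n\<close>: their squared norms are
  bounded by the energy drops, which tend to zero because the energies decrease and are bounded
  below. The second claim is stated for an arbitrary subsequence, so that it covers every
  accumulation point.\<close>

theorem convergence:
  fixes u :: "nat \<Rightarrow> 'a \<Rightarrow> complex"
  assumes u0: "u 0 \<in> X" "I (u 0) = 1"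
    and step: "\<And>n. gfalm_step bc a b V \<omega> p \<tau> \<alpha> (u n) (u (Suc n))"
  shows "\<exists>r w. strict_mono r \<and> w \<in> X \<and> (\<lambda>j. E (\<lambda>x. u (r j) x - w x)) \<longlonglongrightarrow> 0"
    and "us \<in> X \<Longrightarrow> I us = 1 \<Longrightarrow> strict_mono r \<Longrightarrow> (\<lambda>j. E (\<lambda>x. u (r j) x - us x)) \<longlonglongrightarrow> 0
      \<Longrightarrow> (\<forall>v\<in>X. A us v = complex_of_real (Q us) * Nl us v) \<and> Q us = (INF n. Q (u n))"
proof -
  have inv: "u n \<in> X \<and> I (u n) = 1" for n
  proof (induction n)
    case (Suc n)
    then have un: "u n \<in> X" "I (u n) = 1" by auto
    show ?case by (rule step_descent[OF un step]) blast
  qed (use u0 in simp)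
  then have uX: "u n \<in> X" and Iu: "I (u n) = 1" for n by auto
  have "\<exists>e. e \<in> X \<and> (\<forall>v\<in>X. K e v + A (u n) v = complex_of_real (Q (u n)) * Nl (u n) v)
      \<and> E e \<le> 2 * (c2 * Q (u n))\<^sup>2 * (Q (u n) - Q (u (Suc n)))" for n
    by (rule step_descent[OF uX Iu step]) blast
  then obtain e where e: "\<And>n. e n \<in> X"
    and eq: "\<And>n v. v \<in> X \<Longrightarrow> K (e n) v + A (u n) v = complex_of_real (Q (u n)) * Nl (u n) v"
    and Ee: "\<And>n. E (e n) \<le> 2 * (c2 * Q (u n))\<^sup>2 * (Q (u n) - Q (u (Suc n)))"
    by metis
  \<comment> \<open>The one-step estimate bounds only a product. A rise of the energy would force
    its other factor to vanish, hence \<open>Q (u n) = 0\<close>, which is incompatible with the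
    constraint.\<close>
  have dec: "Q (u (Suc n)) \<le> Q (u n)" for n
  proof (rule ccontr)
    assume "\<not> Q (u (Suc n)) \<le> Q (u n)"
    then have neg: "Q (u n) - Q (u (Suc n)) < 0" by simp
    have "0 \<le> 2 * (c2 * Q (u n))\<^sup>2 * (Q (u n) - Q (u (Suc n)))" using Ee[of n] H1sq_nonneg[of \<Omega> "e n"] by linarith
    then have "(c2 * Q (u n))\<^sup>2 \<le> 0" using neg by (simp add: zero_le_mult_iff)
    then have "Q (u n) = 0" using c2_pos by simp
    then have "E (u n) \<le> 0" using coercive[OF uX, of n] by simp
    then have "E (u n) = 0" using H1sq_nonneg[of \<Omega> "u n"] by linarith
    then show False using I_le[OF uX, of n] Iu[of n] by simp
  qed
  have decseq: "decseq (\<lambda>n. Q (u n))" by (rule decseq_SucI) (rule dec)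
  have Q0: "Q (u n) \<le> Q (u 0)" for n using decseqD[OF decseq, of 0 n] by simp
  have Qlim: "(\<lambda>n. Q (u n)) \<longlonglongrightarrow> (INF n. Q (u n))"
    by (rule LIMSEQ_decseq_INF[OF _ decseq]) (rule bdd_belowI2[of _ 0], rule Q_nonneg[OF uX])
  have elim: "(\<lambda>n. E (e n)) \<longlonglongrightarrow> 0"
  proof (rule Lim_null_comparison[OF always_eventually], intro allI)
    fix n
    \<comment> \<open>Replacing the prefactor by its value at \<open>u 0\<close> leaves a constant
      times an energy drop.\<close>
    have "E (e n) \<le> 2 * (c2 * Q (u n))\<^sup>2 * (Q (u n) - Q (u (Suc n)))" by (rule Ee)
    also have "\<dots> \<le> 2 * (c2 * Q (u 0))\<^sup>2 * (Q (u n) - Q (u (Suc n)))"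
      using Q0[of n] Q_nonneg[OF uX, of n] c2_pos dec[of n]
      by (intro mult_right_mono mult_left_mono power_mono) auto
    finally show "norm (E (e n)) \<le> 2 * (c2 * Q (u 0))\<^sup>2 * (Q (u n) - Q (u (Suc n)))" by simp
    show "(\<lambda>n. 2 * (c2 * Q (u 0))\<^sup>2 * (Q (u n) - Q (u (Suc n)))) \<longlonglongrightarrow> 0"
      using tendsto_mult_right_zero[OF tendsto_diff[OF Qlim LIMSEQ_Suc[OF Qlim], simplified]] by simp
  qed
  show "\<exists>r w. strict_mono r \<and> w \<in> X \<and> (\<lambda>j. E (\<lambda>x. u (r j) x - w x)) \<longlonglongrightarrow> 0"
  proof -
    define B where "B = C0 * Q (u 0)"
    have EB: "E (u n) \<le> B" for n
      unfolding B_def by (rule order_trans[OF coercive[OF uX] mult_left_mono[OF Q0]]) (use C0_pos in simp)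
    obtain r :: "nat \<Rightarrow> nat" where r: "strict_mono r"
      and Cr: "\<And>\<eta>. \<eta> > 0 \<Longrightarrow> \<exists>N. \<forall>i\<ge>N. \<forall>j\<ge>N. I (\<lambda>x. u (r i) x - u (r j) x) < \<eta>"
      by (rule Xsp_Rellich[where u = u and bc = bc and B = B, OF ne p_gt subcrit uX EB]) (rule that, assumption, simp add: I_def)
    define CK where "CK = (DIM('a) + (1 / \<tau> + \<bar>\<alpha>\<bar>)) * sqrt (4 * B)"
    have CK: "CK \<ge> 0" using tau order_trans[OF H1sq_nonneg EB] by (simp add: CK_def)
    text \<open>Subtracting the equations for \<open>u i\<close> and \<open>u j\<close>, tested with \<open>u i - u j\<close>, turns convergence in
      \<open>L\<^bsup>p+1\<^esup>\<close> into convergence in \<open>H\<^sup>1\<close>; no weak compactness is needed.\<close>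
    have bound: "E (\<lambda>x. u i x - u j x) \<le> C0 * (2 * Q (u 0) * (\<epsilon> + \<epsilon> powr (- p) * I (\<lambda>x. u i x - u j x)) + CK * (sqrt (E (e i)) + sqrt (E (e j))))"
      if \<epsilon>: "\<epsilon> > 0" for i j \<epsilon>
    proof -
      define d where "d x = u i x - u j x" for x
      have d: "d \<in> X" unfolding d_def [abs_def] by (rule Xsp_diff[OF uX uX])
      \<comment> \<open>A crude bound, needed only to make \<open>CK\<close> independent of i and
        j.\<close>
      have "E d \<le> 2 * E (u i) + 2 * E (u j)"
        using H1sq_lincomb_le[OF X_H1[OF uX[of i]] X_H1[OF uX[of j]], of 1 "-1"] by (simp add: d_def [abs_def])
      then have Ed: "E d \<le> 4 * B" using EB[of i] EB[of j] by linarith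
      have Kd: "norm (K (e n) d) \<le> CK * sqrt (E (e n))" for n
      proof -
        have "norm (K (e n) d) \<le> (DIM('a) + (1 / \<tau> + \<bar>\<alpha>\<bar>)) * (sqrt (E (e n)) * sqrt (E d))"
          by (rule norm_K_le[OF e d])
        also have "\<dots> \<le> (DIM('a) + (1 / \<tau> + \<bar>\<alpha>\<bar>)) * (sqrt (E (e n)) * sqrt (4 * B))"
          using Ed tau by (intro mult_left_mono real_sqrt_le_mono) auto
        finally show ?thesis by (simp add: CK_def mult_ac)
      qed
      have Ad: "norm (A (u n) d) \<le> Q (u 0) * (\<epsilon> + \<epsilon> powr (- p) * I d) + CK * sqrt (E (e n))" for n
      proof -
        have "A (u n) d = complex_of_real (Q (u n)) * Nl (u n) d - K (e n) d"
          using eq[OF d, of n] by (simp add: eq_diff_eq add.commute)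
        then have "norm (A (u n) d) \<le> Q (u n) * norm (Nl (u n) d) + norm (K (e n) d)"
          using norm_triangle_ineq4[of "complex_of_real (Q (u n)) * Nl (u n) d" "K (e n) d"] Q_nonneg[OF uX, of n]
          by (simp add: norm_mult)
        also have "\<dots> \<le> Q (u 0) * (\<epsilon> + \<epsilon> powr (- p) * I d) + CK * sqrt (E (e n))"
          using Nl_small[OF uX d \<epsilon>, of n] Iu[of n] Q0[of n] Q_nonneg[OF uX, of 0] Kd[of n]
          by (intro add_mono mult_mono) auto
        finally show ?thesis .
      qed
      have "A d d = A (u i) d - A (u j) d"
        using A_left[OF uX[of i] uX[of j] d, of 1 "-1"] by (simp add: d_def [abs_def])
      then have "complex_of_real (Q d) = A (u i) d - A (u j) d"
        by (simp only: A_self[OF d])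
      then have "Q d \<le> norm (A (u i) d) + norm (A (u j) d)"
        by (metis norm_of_real norm_triangle_ineq4 abs_le_D1)
      also have "\<dots> \<le> 2 * Q (u 0) * (\<epsilon> + \<epsilon> powr (- p) * I d) + CK * (sqrt (E (e i)) + sqrt (E (e j)))"
        using Ad[of i] Ad[of j] by (simp add: algebra_simps)
      finally have "C0 * Q d \<le> C0 * (2 * Q (u 0) * (\<epsilon> + \<epsilon> powr (- p) * I d) + CK * (sqrt (E (e i)) + sqrt (E (e j))))"
        using C0_pos by (intro mult_left_mono) auto
      then show ?thesis using coercive[OF d] by (simp add: d_def [abs_def])
    qed
    have Cauchy: "\<exists>N. \<forall>i\<ge>N. \<forall>j\<ge>N. E (\<lambda>x. u (r i) x - u (r j) x) < \<eta>" if \<eta>: "\<eta> > 0" for \<eta>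
    proof -
      \<comment> \<open>The parameters are fixed in the order \<epsilon>, \<delta>,
        \<open>s\<close>, so that each of the three contributions to \<open>bound\<close> is at most
        \<eta>/4 and the total is strictly below \<eta>.\<close>
      define q where "q = 2 * C0 * Q (u 0) + 1"
      have q: "q > 0" "2 * C0 * Q (u 0) \<le> q"
        using C0_pos Q_nonneg[OF uX, of 0] by (auto simp: q_def intro!: add_nonneg_pos)
      define \<epsilon> where "\<epsilon> = \<eta> / (4 * q)"
      have \<epsilon>: "\<epsilon> > 0" "q * \<epsilon> = \<eta> / 4" using \<eta> q by (simp_all add: \<epsilon>_def)
      define \<delta> where "\<delta> = \<eta> / (4 * q * \<epsilon> powr (- p))"
      have \<delta>: "\<delta> > 0" "q * (\<epsilon> powr (- p) * \<delta>) = \<eta> / 4" using \<eta> q \<epsilon>(1) by (simp_all add: \<delta>_def)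
      have CC: "C0 * CK \<ge> 0" using C0_pos CK by simp
      define P where "P = C0 * CK + 1"
      have P: "P > 0" using CC by (simp add: P_def)
      define s where "s = \<eta> / (8 * P)"
      have s: "s > 0" "C0 * CK * (s + s) \<le> \<eta> / 4"
      proof -
        show "s > 0" using \<eta> P by (simp add: s_def)
        then have "C0 * CK * (s + s) \<le> P * (s + s)" by (intro mult_right_mono) (auto simp: P_def)
        also have "\<dots> = \<eta> / 4" using P by (simp add: s_def)
        finally show "C0 * CK * (s + s) \<le> \<eta> / 4" .
      qed
      have "(\<lambda>n. sqrt (E (e n))) \<longlonglongrightarrow> 0" using tendsto_real_sqrt[OF elim] by simp
      then obtain N1 where N1: "\<And>n. n \<ge> N1 \<Longrightarrow> sqrt (E (e n)) < s"
        using order_tendstoD(2)[OF _ s(1)] by (metis eventually_sequentially)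
      obtain N2 where N2: "\<And>i j. i \<ge> N2 \<Longrightarrow> j \<ge> N2 \<Longrightarrow> I (\<lambda>x. u (r i) x - u (r j) x) < \<delta>"
        using Cr[OF \<delta>(1)] by blast
      show ?thesis
      proof (intro exI allI impI)
        fix i j assume "max N1 N2 \<le> i" "max N1 N2 \<le> j"
        then have ij: "N1 \<le> i" "N1 \<le> j" "N2 \<le> i" "N2 \<le> j" by auto
        let ?I = "I (\<lambda>x. u (r i) x - u (r j) x)"
        have ri: "sqrt (E (e (r i))) < s" "sqrt (E (e (r j))) < s"
          using N1 ij seq_suble[OF r, of i] seq_suble[OF r, of j] by auto
        have "E (\<lambda>x. u (r i) x - u (r j) x) \<le> 2 * C0 * Q (u 0) * (\<epsilon> + \<epsilon> powr (- p) * ?I)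
           + C0 * CK * (sqrt (E (e (r i))) + sqrt (E (e (r j))))"
          using bound[OF \<epsilon>(1), of "r i" "r j"] by (simp add: distrib_left mult.assoc mult.left_commute[of C0])
        also have "\<dots> \<le> q * (\<epsilon> + \<epsilon> powr (- p) * \<delta>) + C0 * CK * (s + s)"
          using q ri \<epsilon> CC less_imp_le[OF N2[OF ij(3,4)]]
          by (intro add_mono mult_mono mult_left_mono) auto
        also have "\<dots> < \<eta>" using \<epsilon>(2) \<delta>(2) s(2) \<eta> by (simp add: distrib_left)
        finally show "E (\<lambda>x. u (r i) x - u (r j) x) < \<eta>" .
      qed
    qed
    obtain w where "w \<in> X" "(\<lambda>j. E (\<lambda>x. u (r j) x - w x)) \<longlonglongrightarrow> 0"
      by (rule Xsp_complete[where u = "\<lambda>j. u (r j)" and bc = bc and a = a and b = b], rule uX, erule Cauchy, rule that)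
    then show ?thesis using r by blast
  qed
  show "(\<forall>v\<in>X. A us v = complex_of_real (Q us) * Nl us v) \<and> Q us = (INF n. Q (u n))"
    if us: "us \<in> X" and Ius: "I us = 1" and r: "strict_mono r" and lim: "(\<lambda>j. E (\<lambda>x. u (r j) x - us x)) \<longlonglongrightarrow> 0"
  proof
    have dX: "(\<lambda>x. u (r j) x - us x) \<in> X" for j by (rule Xsp_diff[OF uX us])
    have Ql: "(\<lambda>j. Q (u (r j))) \<longlonglongrightarrow> Q us" by (rule Q_tendsto[OF uX us lim])
    moreover have "(\<lambda>j. Q (u (r j))) \<longlonglongrightarrow> (INF n. Q (u n))"
      using LIMSEQ_subseq_LIMSEQ[OF Qlim r] by (simp add: o_def)
    ultimately show "Q us = (INF n. Q (u n))" by (rule LIMSEQ_unique)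
    have er: "(\<lambda>j. E (e (r j))) \<longlonglongrightarrow> 0"
      using LIMSEQ_subseq_LIMSEQ[OF elim r] by (simp add: o_def)
    show "\<forall>v\<in>X. A us v = complex_of_real (Q us) * Nl us v"
    proof
      fix v assume v: "v \<in> X"
      \<comment> \<open>The limit is taken in the step equation itself: the \<open>K\<close> term
        vanishes with the increments, and the other two terms are continuous in the iterate.\<close>
      have "A (u (r j)) v = A (\<lambda>x. u (r j) x - us x) v + A us v" for j
        using A_left[OF uX[of "r j"] us v, of 1 "-1"] by simp
      then have "(\<lambda>j. K (e (r j)) v + A (u (r j)) v) \<longlonglongrightarrow> 0 + (0 + A us v)"
        using A_tendsto[OF dX v lim] K_tendsto[OF e v er] by (simp only:) (intro tendsto_intros)
      moreover have "(\<lambda>j. complex_of_real (Q (u (r j))) * Nl (u (r j)) v) \<longlonglongrightarrow> complex_of_real (Q us) * Nl us v"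
        by (intro tendsto_mult tendsto_of_real Ql Nl_tendsto[OF uX Iu us Ius v] I_tendsto[OF dX lim])
      ultimately have "0 + (0 + A us v) = complex_of_real (Q us) * Nl us v"
        unfolding eq[OF v] by (rule LIMSEQ_unique)
      then show "A us v = complex_of_real (Q us) * Nl us v" by simp
    qed
  qed
qed

end

theorem mainTheorem5:
  fixes bc :: bcond and a b :: "'a::euclidean_space"
    and V :: "'a \<Rightarrow> real" and \<omega> p \<tau> \<alpha> :: real
    and u :: "nat \<Rightarrow> 'a \<Rightarrow> complex"
  assumes box_ne: "box a b \<noteq> {}"
    and A1_p: "1 < p \<and> (DIM('a) \<ge> 3 \<longrightarrow> p < (real DIM('a) + 2) / (real DIM('a) - 2))"
    and V_meas: "V \<in> borel_measurable (lebesgue_on (box a b))"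
    and V_bdd: "\<exists>C. AE x in lebesgue_on (box a b). \<bar>V x\<bar> \<le> C"
    and V_nonneg: "AE x in lebesgue_on (box a b). 0 \<le> V x"
    and A2: "\<omega> > - lambda0 bc a b V"
    and alpha: "ereal \<alpha> \<ge> ereal (1/2) * max 0 (esssup (lebesgue_on (box a b)) (\<lambda>x. ereal (V x + \<omega>))) + ereal (1/2)"
    and p_extra: "DIM('a) \<ge> 3 \<longrightarrow> p \<le> real DIM('a) / (real DIM('a) - 2)"
    and tau: "\<tau> > 0"
    and u0: "u 0 \<in> Xsp bc a b" "Lpnorm (box a b) (p + 1) (u 0) = 1"
    and scheme: "\<And>n. gfalm_step bc a b V \<omega> p \<tau> \<alpha> (u n) (u (Suc n))"
  shows "(\<exists>r w. strict_mono r \<and> w \<in> Xsp bc a b \<and>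
            (\<lambda>j. H1dist (box a b) (u (r j)) w) \<longlonglongrightarrow> 0)
         \<and> (\<forall>us. us \<in> Xsp bc a b \<and> Lpnorm (box a b) (p + 1) us = 1 \<and>
                 (\<exists>r. strict_mono r \<and> (\<lambda>j. H1dist (box a b) (u (r j)) us) \<longlonglongrightarrow> 0)
              \<longrightarrow> (\<forall>v \<in> Xsp bc a b.
                     A_form (box a b) V \<omega> us v
                     = complex_of_real (lam_tilde (box a b) V \<omega> p us)
                       * L2ip (box a b) (\<lambda>x. complex_of_real (norm (us x) powr (p - 1)) * us x) v)
                  \<and> lam_tilde (box a b) V \<omega> p us = Qf (box a b) V \<omega> us
                  \<and> Qf (box a b) V \<omega> us = (INF n. Qf (box a b) V \<omega> (u n)))"
proof -
  obtain Cv where Cv: "AE x in lebesgue_on (box a b). \<bar>V x\<bar> \<le> Cv" using V_bdd by blast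
  \<comment> \<open>For dimension at least 3 this is (A1) multiplied by d - 2; in dimensions 1 and 2
    the left side is not positive.\<close>
  have sub: "(p + 1) * (real DIM('a) - 2) < 2 * real DIM('a)"
  proof (cases "DIM('a) \<ge> 3")
    case True
    then have d: "real DIM('a) - 2 > 0" by simp
    have "p < (real DIM('a) + 2) / (real DIM('a) - 2)" using A1_p True by blast
    then have "p * (real DIM('a) - 2) < real DIM('a) + 2" using d by (simp add: pos_less_divide_eq)
    then show ?thesis by (simp add: distrib_right)
  next
    case False
    then have "(p + 1) * (real DIM('a) - 2) \<le> 0" using A1_p by (intro mult_nonneg_nonpos) auto
    then show ?thesis using DIM_positive[where 'a = 'a] by (simp add: order_le_less_trans)
  qed
  have al: "AE x in lebesgue_on (box a b). V x + \<omega> \<le> 2 * \<alpha> - 1"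
    using esssup_AE[of "\<lambda>x. ereal (V x + \<omega>)" "lebesgue_on (box a b)"]
  proof eventually_elim
    case (elim x)
    \<comment> \<open>The essential supremum is an extended real. The maximum with 0 excludes minus
      infinity, and the finite \<alpha> above it excludes plus infinity.\<close>
    define s where "s = max 0 (esssup (lebesgue_on (box a b)) (\<lambda>x. ereal (V x + \<omega>)))"
    have xs: "ereal (V x + \<omega>) \<le> s" using elim by (simp add: s_def le_max_iff_disj)
    have "0 \<le> s" by (simp add: s_def)
    then show ?case
    proof (cases s)
      case (real r)
      then have "r / 2 + 1 / 2 \<le> \<alpha>" using alpha by (simp add: s_def[symmetric])
      moreover have "V x + \<omega> \<le> r" using xs real by simp
      ultimately show ?thesis by (simp add: field_simps)
    next
      case PInf
      then show ?thesis using alpha by (simp add: s_def[symmetric])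
    qed simp
  qed
  interpret gfalm bc a b V \<omega> p \<tau> \<alpha> Cv
    using box_ne A1_p sub V_meas Cv V_nonneg A2 al tau by unfold_locales auto
  have I0: "I (u 0) = 1" using u0(2) Lpnorm_1_iff by blast
  note conv = convergence[of u, OF u0(1) I0 scheme]
  show ?thesis
  proof (intro conjI allI impI)
    obtain r w where r: "strict_mono r" and w: "w \<in> X" and lim: "(\<lambda>j. E (\<lambda>x. u (r j) x - w x)) \<longlonglongrightarrow> 0"
      using conv(1) by blast
    have "(\<lambda>j. H1dist \<Omega> (u (r j)) w) \<longlonglongrightarrow> 0"
      unfolding H1dist_eq using tendsto_real_sqrt[OF lim] by simp
    then show "\<exists>r w. strict_mono r \<and> w \<in> X \<and> (\<lambda>j. H1dist \<Omega> (u (r j)) w) \<longlonglongrightarrow> 0"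
      using r w by blast
  next
    fix us
    assume as: "us \<in> X \<and> Lpnorm \<Omega> (p + 1) us = 1 \<and> (\<exists>r. strict_mono r \<and> (\<lambda>j. H1dist \<Omega> (u (r j)) us) \<longlonglongrightarrow> 0)"
    then obtain r where r: "strict_mono r" and lim: "(\<lambda>j. H1dist \<Omega> (u (r j)) us) \<longlonglongrightarrow> 0" by blast
    have us: "us \<in> X" and Ius: "I us = 1" using as Lpnorm_1_iff by blast+
    have "(\<lambda>j. (H1dist \<Omega> (u (r j)) us)\<^sup>2) \<longlonglongrightarrow> 0\<^sup>2" by (rule tendsto_power[OF lim])
    then have "(\<lambda>j. E (\<lambda>x. u (r j) x - us x)) \<longlonglongrightarrow> 0" by (simp add: H1dist_eq)
    note c = conv(2)[OF us Ius r this]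
    show lam: "lam_tilde \<Omega> V \<omega> p us = Q us" by (rule lam_tilde_eq[OF Ius])
    show "Q us = (INF n. Q (u n))" using c by blast
    show "\<forall>v\<in>X. A us v = complex_of_real (lam_tilde \<Omega> V \<omega> p us)
        * L2ip \<Omega> (\<lambda>x. complex_of_real (norm (us x) powr (p - 1)) * us x) v"
      unfolding lam using c unfolding Nl_def by blast
  qed
qed

end
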